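(* Let $A$ and $B$ be approximately unital real operator algebras, and let $X$ be a real operator space which is a nondegenerate $A$-$B$-bimodule satisfying $$\| \alpha x \beta \| \leq \| \alpha \| \, \| x \| \, \| \beta \|, \qquad n \in \mathbb{N},\ x \in M_n(X),\ \alpha \in M_n(A),\ \beta \in M_n(B).$$ Then there exist real Hilbert spaces $H$ and $K$, a real linear completely isometric map $\Phi : X \to B(K,H)$, and completely contractive nondegenerate real linear representations $\theta$ of $A$ on $H$, and $\pi$ of $B$ on $K$, such that $$\theta(a)\Phi(x) = \Phi(ax) \quad \text{and} \quad \Phi(x)\pi(b) = \Phi(xb), \qquad a \in A,\ b\in B,\ x\in X.$$ Thus $X$ is completely $A$-$B$-isometric to the concrete operator $A$-$B$-bimodule $\Phi(X)$. Moreover, $\Phi, \theta, \pi$ may be chosen to all be completely isometric, and such that $H = K$. If $A = B$ then one may choose $H = K$ and $\Phi, \theta, \pi$ all completely isometric, with $\theta, \pi$ nondegenerate representations satisfying $\theta(a)\Phi(x) = \Phi(ax)$ and $\Phi(x)\pi(b) = \Phi(xb)$ for all $a \in A$, $b \in B$, $x \in X$, and in addition $\pi = \theta$.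
   Context: A real operator space is (up to real linear complete isometry) a real linear subspace of $B(H)$, $H$ a real Hilbert space, with the inherited norms on all $M_n(X)$. A real operator algebra is a real subalgebra of $B(H)$ for a real Hilbert space $H$ (with the inherited matrix norms); it is approximately unital if it has a contractive approximate identity. The actions of $M_n(A)$ and $M_n(B)$ on $M_n(X)$ are by formal matrix multiplication. The bimodule $X$ is nondegenerate if the spans of the products $ax$ and of the products $xb$ ($a\in A$, $b\in B$, $x\in X$) are each dense in $X$. A representation of $A$ on $H$ is a homomorphism into $B(H)$; it is nondegenerate if the span of $\theta(A)H$ is dense in $H$. Completely $A$-$B$-isometric means completely isometric via an $A$-$B$-bimodule map.
   Formalization: Added: each map x ↦ ax and x ↦ xb is continuous on X, without which the claim fails. In the part with H = K and all maps completely isometric, θ is not claimed nondegenerate if A = {0} ≠ B, nor π if B = {0} ≠ A, where this is impossible. *)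

theory Defs
  imports "HOL-Analysis.Analysis"
begin

section \<open>The real Hilbert space of square-summable families\<close>

typedef 'i ell2 = "{f :: 'i \<Rightarrow> real. (\<lambda>i. (f i)\<^sup>2) summable_on UNIV}"
  morphisms coord Abs_ell2
  by (rule exI[of _ "\<lambda>_. 0"]) simp

lemma coord_sq_summable [simp]: "(\<lambda>i. (coord f i)\<^sup>2) summable_on UNIV"
  using coord[of f] by simp

lemma ell2_eqI: "(\<And>i. coord f i = coord g i) \<Longrightarrow> f = g"
  by (metis coord_inject ext)

lemma coord_prod_summable [simp]: "(\<lambda>i. coord f i * coord g i) summable_on UNIV"
proof -
  have "(\<lambda>i. (coord f i)\<^sup>2 + (coord g i)\<^sup>2) summable_on UNIV"
    by (rule summable_on_add) auto
  moreover have "norm (coord f i * coord g i) \<le> (coord f i)\<^sup>2 + (coord g i)\<^sup>2" for i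
  proof -
    have "2 * (\<bar>coord f i\<bar> * \<bar>coord g i\<bar>) \<le> (coord f i)\<^sup>2 + (coord g i)\<^sup>2"
      using sum_squares_bound[of "\<bar>coord f i\<bar>" "\<bar>coord g i\<bar>"] by simp
    moreover have "0 \<le> \<bar>coord f i\<bar> * \<bar>coord g i\<bar>" by simp
    ultimately have "\<bar>coord f i\<bar> * \<bar>coord g i\<bar> \<le> (coord f i)\<^sup>2 + (coord g i)\<^sup>2" by linarith
    then show ?thesis by (simp add: abs_mult)
  qed
  ultimately have "(\<lambda>i. norm (coord f i * coord g i)) summable_on UNIV"
    by (rule summable_on_comparison_test) auto
  then show ?thesis by (rule abs_summable_summable)
qed

lemma sq_add_summable: "(\<lambda>i. (coord f i + coord g i)\<^sup>2) summable_on UNIV"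
proof -
  have "(\<lambda>i. (coord f i)\<^sup>2 + (coord g i)\<^sup>2 + 2 * (coord f i * coord g i)) summable_on UNIV"
    by (rule summable_on_add[OF summable_on_add summable_on_cmult_right]) auto
  then show ?thesis by (simp add: power2_sum mult.assoc)
qed

lemma sq_scale_summable: "(\<lambda>i. (c * coord f i)\<^sup>2) summable_on UNIV"
  by (simp add: power_mult_distrib summable_on_cmult_right)

instantiation ell2 :: (type) real_vector
begin

definition zero_ell2 :: "'a ell2" where "zero_ell2 = Abs_ell2 (\<lambda>_. 0)"
definition plus_ell2 :: "'a ell2 \<Rightarrow> 'a ell2 \<Rightarrow> 'a ell2"
  where "plus_ell2 f g = Abs_ell2 (\<lambda>i. coord f i + coord g i)"
definition scaleR_ell2 :: "real \<Rightarrow> 'a ell2 \<Rightarrow> 'a ell2"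
  where "scaleR_ell2 c f = Abs_ell2 (\<lambda>i. c * coord f i)"
definition uminus_ell2 :: "'a ell2 \<Rightarrow> 'a ell2"
  where "uminus_ell2 f = Abs_ell2 (\<lambda>i. - coord f i)"
definition minus_ell2 :: "'a ell2 \<Rightarrow> 'a ell2 \<Rightarrow> 'a ell2"
  where "minus_ell2 f g = f + - g"

lemma coord_zero: "coord (0 :: 'a ell2) i = 0"
  by (simp add: zero_ell2_def Abs_ell2_inverse)
lemma coord_plus: "coord (f + g :: 'a ell2) i = coord f i + coord g i"
  by (simp add: plus_ell2_def Abs_ell2_inverse sq_add_summable)
lemma coord_scaleR: "coord (c *\<^sub>R f :: 'a ell2) i = c * coord f i"
  by (simp add: scaleR_ell2_def Abs_ell2_inverse sq_scale_summable)
lemma coord_uminus: "coord (- f :: 'a ell2) i = - coord f i"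
  by (simp add: uminus_ell2_def Abs_ell2_inverse)
lemma coord_minus: "coord (f - g :: 'a ell2) i = coord f i - coord g i"
  by (simp add: minus_ell2_def coord_plus coord_uminus)

instance
  by standard
    (rule ell2_eqI, simp add: coord_zero coord_plus coord_scaleR coord_uminus coord_minus
      algebra_simps)+

end

declare coord_zero [simp] coord_plus [simp] coord_scaleR [simp] coord_uminus [simp]
  coord_minus [simp]

instantiation ell2 :: (type) real_inner
begin

definition inner_ell2 :: "'a ell2 \<Rightarrow> 'a ell2 \<Rightarrow> real"
  where "inner_ell2 f g = (\<Sum>\<^sub>\<infinity>i. coord f i * coord g i)"
definition norm_ell2 :: "'a ell2 \<Rightarrow> real" where "norm_ell2 f = sqrt (f \<bullet> f)"
definition dist_ell2 :: "'a ell2 \<Rightarrow> 'a ell2 \<Rightarrow> real" where "dist_ell2 f g = norm (f - g)"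
definition sgn_ell2 :: "'a ell2 \<Rightarrow> 'a ell2" where "sgn_ell2 f = inverse (norm f) *\<^sub>R f"
definition uniformity_ell2 :: "('a ell2 \<times> 'a ell2) filter"
  where "uniformity_ell2 = (INF e\<in>{0<..}. principal {(x, y). dist x y < e})"
definition open_ell2 :: "'a ell2 set \<Rightarrow> bool"
  where "open_ell2 U = (\<forall>x\<in>U. \<forall>\<^sub>F (x', y) in uniformity. x' = x \<longrightarrow> y \<in> U)"

instance
proof
  fix f g h :: "'a ell2" and c :: real
  show "dist f g = norm (f - g)" by (rule dist_ell2_def)
  show "sgn f = f /\<^sub>R norm f" by (rule sgn_ell2_def)
  show "uniformity = (INF e\<in>{0<..}. principal {(x, y :: 'a ell2). dist x y < e})"
    by (rule uniformity_ell2_def)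
  show "open U = (\<forall>x\<in>U. \<forall>\<^sub>F (x', y) in uniformity. x' = x \<longrightarrow> y \<in> U)"
    for U :: "'a ell2 set" by (rule open_ell2_def)
  show "f \<bullet> g = g \<bullet> f" by (simp add: inner_ell2_def mult.commute)
  show "(f + g) \<bullet> h = f \<bullet> h + g \<bullet> h"
    by (simp add: inner_ell2_def distrib_right infsum_add)
  show "(c *\<^sub>R f) \<bullet> g = c * (f \<bullet> g)"
    by (simp add: inner_ell2_def mult.assoc infsum_cmult_right)
  show "0 \<le> f \<bullet> f" by (simp add: inner_ell2_def infsum_nonneg)
  show "f \<bullet> f = 0 \<longleftrightarrow> f = 0"
  proof
    assume "f \<bullet> f = 0"
    then have "coord f i * coord f i = 0" for i
      by (intro nonneg_infsum_le_0D[of "\<lambda>i. coord f i * coord f i" UNIV i])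
        (auto simp: inner_ell2_def)
    then show "f = 0" by (intro ell2_eqI) simp
  qed (simp add: inner_ell2_def)
  show "norm f = sqrt (f \<bullet> f)" by (rule norm_ell2_def)
qed

end

lemma norm_ell2_eq: "norm f = sqrt (\<Sum>\<^sub>\<infinity>i. (coord f i)\<^sup>2)"
  by (simp add: norm_ell2_def inner_ell2_def power2_eq_square)

lemma sum_sq_le_norm_ell2:
  assumes "finite F" shows "(\<Sum>i\<in>F. (coord f i)\<^sup>2) \<le> (norm f)\<^sup>2"
proof -
  have "(\<Sum>i\<in>F. (coord f i)\<^sup>2) \<le> (\<Sum>\<^sub>\<infinity>i. (coord f i)\<^sup>2)"
    by (rule finite_sum_le_infsum) (use assms in auto)
  then show ?thesis by (simp add: norm_ell2_eq infsum_nonneg)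
qed

lemma abs_coord_le_norm: "\<bar>coord f i\<bar> \<le> norm f"
  by (rule power2_le_imp_le) (use sum_sq_le_norm_ell2[of "{i}" f] in simp_all)

lemma ell2_of_bounded_sums:
  assumes "\<And>F. finite F \<Longrightarrow> (\<Sum>i\<in>F. (a i)\<^sup>2) \<le> e\<^sup>2" and "0 \<le> e"
  obtains f where "\<And>i. coord f i = a i" and "norm f \<le> e"
proof -
  have s: "(\<lambda>i. (a i)\<^sup>2) summable_on UNIV"
    by (rule nonneg_bdd_above_summable_on) (auto intro!: bdd_aboveI2 assms(1))
  then have c: "coord (Abs_ell2 a) i = a i" for i by (simp add: Abs_ell2_inverse)
  have "(\<Sum>\<^sub>\<infinity>i. (a i)\<^sup>2) \<le> e\<^sup>2"
    by (rule infsum_le_finite_sums) (use s assms(1) in auto)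
  then have "norm (Abs_ell2 a) \<le> e"
    using assms(2) by (simp add: norm_ell2_eq c real_le_lsqrt)
  then show thesis using c that by blast
qed

instance ell2 :: (type) complete_space
proof
  fix X :: "nat \<Rightarrow> 'a ell2"
  assume X: "Cauchy X"
  have "Cauchy (\<lambda>n. coord (X n) i)" for i
  proof (rule metric_CauchyI)
    fix e :: real assume "0 < e"
    then obtain N where N: "\<And>m n. N \<le> m \<Longrightarrow> N \<le> n \<Longrightarrow> dist (X m) (X n) < e"
      using metric_CauchyD[OF X] by blast
    have "dist (coord (X m) i) (coord (X n) i) < e" if "N \<le> m" "N \<le> n" for m n
      using N[OF that] abs_coord_le_norm[of "X m - X n" i] by (simp add: dist_norm)
    then show "\<exists>M. \<forall>m\<ge>M. \<forall>n\<ge>M. dist (coord (X m) i) (coord (X n) i) < e" by blast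
  qed
  then have "\<forall>i. \<exists>c. (\<lambda>n. coord (X n) i) \<longlonglongrightarrow> c"
    using Cauchy_convergent convergent_def by blast
  then obtain a where a: "\<And>i. (\<lambda>n. coord (X n) i) \<longlonglongrightarrow> a i"
    by (auto dest!: choice)
  have tail: "\<exists>N. \<forall>n\<ge>N. \<exists>g. (\<forall>i. coord g i = coord (X n) i - a i) \<and> norm g \<le> e"
    if "0 < e" for e
  proof -
    from that obtain N where N: "\<And>m n. N \<le> m \<Longrightarrow> N \<le> n \<Longrightarrow> dist (X m) (X n) < e"
      using metric_CauchyD[OF X] by blast
    have "\<exists>g. (\<forall>i. coord g i = coord (X n) i - a i) \<and> norm g \<le> e" if n: "N \<le> n" for n
    proof -
      have "(\<Sum>i\<in>F. (coord (X n) i - a i)\<^sup>2) \<le> e\<^sup>2" if "finite F" for F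
      proof (rule LIMSEQ_le_const2)
        show "(\<lambda>m. \<Sum>i\<in>F. (coord (X n) i - coord (X m) i)\<^sup>2)
            \<longlonglongrightarrow> (\<Sum>i\<in>F. (coord (X n) i - a i)\<^sup>2)"
          by (intro tendsto_intros a)
        have "(\<Sum>i\<in>F. (coord (X n) i - coord (X m) i)\<^sup>2) \<le> e\<^sup>2" if m: "N \<le> m" for m
        proof -
          have "(\<Sum>i\<in>F. (coord (X n) i - coord (X m) i)\<^sup>2) \<le> (norm (X n - X m))\<^sup>2"
            using sum_sq_le_norm_ell2[OF \<open>finite F\<close>, of "X n - X m"] by simp
          also have "\<dots> \<le> e\<^sup>2"
            using N[OF n m] by (intro power_mono) (auto simp: dist_norm)
          finally show ?thesis .
        qed
        then show "\<exists>M. \<forall>m\<ge>M. (\<Sum>i\<in>F. (coord (X n) i - coord (X m) i)\<^sup>2) \<le> e\<^sup>2" by blast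
      qed
      then obtain g where "\<And>i. coord g i = coord (X n) i - a i" "norm g \<le> e"
        using ell2_of_bounded_sums[of "\<lambda>i. coord (X n) i - a i" e] \<open>0 < e\<close> by auto
      then show ?thesis by blast
    qed
    then show ?thesis by blast
  qed
  from tail[of 1] obtain N where "\<exists>g. (\<forall>i. coord g i = coord (X N) i - a i) \<and> norm g \<le> 1"
    by fastforce
  then obtain g where g: "\<And>i. coord g i = coord (X N) i - a i" by blast
  define L where "L = X N - g"
  have L: "coord L i = a i" for i by (simp add: L_def g)
  have "X \<longlonglongrightarrow> L"
  proof (rule metric_LIMSEQ_I)
    fix e :: real assume e: "0 < e"
    from tail[of "e / 2"] e obtain M where M:
      "\<And>n. M \<le> n \<Longrightarrow> \<exists>g. (\<forall>i. coord g i = coord (X n) i - a i) \<and> norm g \<le> e / 2"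
      by auto
    have "dist (X n) L < e" if n: "M \<le> n" for n
    proof -
      from M[OF n] obtain h where h: "\<forall>i. coord h i = coord (X n) i - a i" "norm h \<le> e / 2"
        by blast
      have "X n - L = h" by (rule ell2_eqI) (simp add: h L)
      then show ?thesis using h(2) e by (simp add: dist_norm)
    qed
    then show "\<exists>no. \<forall>n\<ge>no. dist (X n) L < e" by blast
  qed
  then show "convergent X" by (rule convergentI)
qed

text \<open>
  HOL has no existential quantification over types, so the Hilbert spaces asserted to exist are
  closed subspaces of the Hilbert space \<open>\<ell>\<^sup>2(I)\<close> with \<open>I\<close> the type below. If \<open>\<kappa>\<close> is the supremum
  of the cardinalities of \<open>'a\<close>, \<open>'b\<close>, \<open>'x\<close> and the natural numbers, then \<open>I\<close> has \<open>2\<^sup>\<kappa>\<close>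
  elements, so every real Hilbert space of Hilbert dimension at most \<open>2\<^sup>\<kappa>\<close> occurs up to unitary
  equivalence.
\<close>

type_synonym ('a, 'b, 'x) big_hilbert = "('a \<times> 'b \<times> 'x) list set ell2"

definition real_hilbert_subspace :: "'u::{real_inner, complete_space} set \<Rightarrow> bool"
  where "real_hilbert_subspace H \<longleftrightarrow> subspace H \<and> closed H"

text \<open>
  For closed subspaces \<open>K\<close>, \<open>H\<close> of a Hilbert space, \<open>B(K,H)\<close> is identified, by extending operators
  by 0 on the orthogonal complement of \<open>K\<close>, with the operators on the ambient space that vanish
  on this complement and have range in \<open>H\<close>. The identification preserves all matrix norms,
  and it preserves composition.
\<close>

definition bounded_operators ::
  "'u::{real_inner, complete_space} set \<Rightarrow> 'u set \<Rightarrow> ('u \<Rightarrow>\<^sub>L 'u) set"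
  where "bounded_operators K H =
    {T. range (blinfun_apply T) \<subseteq> H \<and>
        (\<forall>u. (\<forall>k\<in>K. orthogonal k u) \<longrightarrow> blinfun_apply T u = 0)}"


section \<open>Matrix norms and completely isometric maps\<close>

text \<open>
  An \<open>n \<times> n\<close> matrix is a function of two indices, of which only the values at indices below \<open>n\<close>
  matter.
\<close>

definition matrices :: "nat \<Rightarrow> 'x set \<Rightarrow> (nat \<Rightarrow> nat \<Rightarrow> 'x) set"
  where "matrices n X = {x. \<forall>i<n. \<forall>j<n. x i j \<in> X}"

text \<open>The norm of \<open>M\<^sub>n(B(K,H)) = B(K\<^sup>n,H\<^sup>n)\<close>, with \<open>K\<^sup>n\<close> and \<open>H\<^sup>n\<close> the Hilbert space direct sums.\<close>

definition matrix_norm ::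
  "nat \<Rightarrow> (nat \<Rightarrow> nat \<Rightarrow>
     ('k::{real_inner, complete_space} \<Rightarrow>\<^sub>L 'h::{real_inner, complete_space})) \<Rightarrow> real"
  where "matrix_norm n T =
    Sup {L2_set (\<lambda>i. norm (\<Sum>j<n. blinfun_apply (T i j) (v j))) {..<n} | v.
           L2_set (\<lambda>j. norm (v j)) {..<n} \<le> 1}"

definition real_linear_on :: "'x::real_vector set \<Rightarrow> ('x \<Rightarrow> 'y::real_vector) \<Rightarrow> bool"
  where "real_linear_on X \<phi> \<longleftrightarrow>
    (\<forall>x\<in>X. \<forall>y\<in>X. \<phi> (x + y) = \<phi> x + \<phi> y) \<and> (\<forall>c. \<forall>x\<in>X. \<phi> (c *\<^sub>R x) = c *\<^sub>R \<phi> x)"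

definition completely_isometric ::
  "('h::{real_inner, complete_space} \<Rightarrow>\<^sub>L 'h) set \<Rightarrow>
   (('h \<Rightarrow>\<^sub>L 'h) \<Rightarrow> ('u::{real_inner, complete_space} \<Rightarrow>\<^sub>L 'u)) \<Rightarrow> bool"
  where "completely_isometric X \<phi> \<longleftrightarrow>
    (\<forall>n. \<forall>x\<in>matrices n X. matrix_norm n (\<lambda>i j. \<phi> (x i j)) = matrix_norm n x)"

definition completely_contractive ::
  "('h::{real_inner, complete_space} \<Rightarrow>\<^sub>L 'h) set \<Rightarrow>
   (('h \<Rightarrow>\<^sub>L 'h) \<Rightarrow> ('u::{real_inner, complete_space} \<Rightarrow>\<^sub>L 'u)) \<Rightarrow> bool"
  where "completely_contractive X \<phi> \<longleftrightarrow>
    (\<forall>n. \<forall>x\<in>matrices n X. matrix_norm n (\<lambda>i j. \<phi> (x i j)) \<le> matrix_norm n x)"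


section \<open>Operator spaces, operator algebras and bimodules\<close>

text \<open>Neither operator spaces nor operator algebras are assumed to be norm closed.\<close>

definition real_operator_space :: "('h::{real_inner, complete_space} \<Rightarrow>\<^sub>L 'h) set \<Rightarrow> bool"
  where "real_operator_space X \<longleftrightarrow> subspace X"

definition real_operator_algebra :: "('h::{real_inner, complete_space} \<Rightarrow>\<^sub>L 'h) set \<Rightarrow> bool"
  where "real_operator_algebra A \<longleftrightarrow> subspace A \<and> (\<forall>a\<in>A. \<forall>b\<in>A. a o\<^sub>L b \<in> A)"

text \<open>
  A contractive approximate identity, as a proper filter \<open>F\<close> in place of a net: the tail filter of
  a net has these properties, and conversely \<open>F\<close> defines a net in the usual way.
\<close>

definition approximately_unital :: "('h::{real_inner, complete_space} \<Rightarrow>\<^sub>L 'h) set \<Rightarrow> bool"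
  where "approximately_unital A \<longleftrightarrow>
    (\<exists>F. F \<noteq> bot \<and> (\<forall>\<^sub>F e in F. e \<in> A \<and> norm e \<le> 1) \<and>
       (\<forall>a\<in>A. ((\<lambda>e. e o\<^sub>L a) \<longlongrightarrow> a) F \<and> ((\<lambda>e. a o\<^sub>L e) \<longlongrightarrow> a) F))"

text \<open>
  \<open>l a x\<close> and \<open>r x b\<close> are the actions \<open>ax\<close> and \<open>xb\<close>. They are unrelated to the composition of
  operators.
\<close>

definition real_bimodule ::
  "('ha::{real_inner, complete_space} \<Rightarrow>\<^sub>L 'ha) set \<Rightarrow>
   ('hb::{real_inner, complete_space} \<Rightarrow>\<^sub>L 'hb) set \<Rightarrow> 'x::real_vector set \<Rightarrow>
   (('ha \<Rightarrow>\<^sub>L 'ha) \<Rightarrow> 'x \<Rightarrow> 'x) \<Rightarrow> ('x \<Rightarrow> ('hb \<Rightarrow>\<^sub>L 'hb) \<Rightarrow> 'x) \<Rightarrow> bool"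
  where "real_bimodule A B X l r \<longleftrightarrow>
    (\<forall>a\<in>A. \<forall>x\<in>X. l a x \<in> X) \<and> (\<forall>x\<in>X. \<forall>b\<in>B. r x b \<in> X) \<and>
    (\<forall>a\<in>A. real_linear_on X (l a)) \<and> (\<forall>x\<in>X. real_linear_on A (\<lambda>a. l a x)) \<and>
    (\<forall>b\<in>B. real_linear_on X (\<lambda>x. r x b)) \<and> (\<forall>x\<in>X. real_linear_on B (r x)) \<and>
    (\<forall>a\<in>A. \<forall>a'\<in>A. \<forall>x\<in>X. l (a o\<^sub>L a') x = l a (l a' x)) \<and>
    (\<forall>x\<in>X. \<forall>b\<in>B. \<forall>b'\<in>B. r x (b o\<^sub>L b') = r (r x b) b') \<and>
    (\<forall>a\<in>A. \<forall>x\<in>X. \<forall>b\<in>B. r (l a x) b = l a (r x b))"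

text \<open>
  Continuity of the action of each fixed algebra element. Together with the matrix norm
  inequality and nondegeneracy it gives \<open>\<parallel>\<alpha>x\<parallel> \<le> \<parallel>\<alpha>\<parallel> \<parallel>x\<parallel>\<close> and \<open>\<parallel>x\<beta>\<parallel> \<le> \<parallel>x\<parallel> \<parallel>\<beta>\<parallel>\<close>. It does not
  follow from these two: if \<open>X\<close> is the algebraic direct sum of two dense subspaces, the two
  associated (discontinuous) projections \<open>p\<close>, \<open>q\<close> define a nondegenerate \<open>\<real>\<close>-\<open>\<real>\<close>-bimodule
  by \<open>ax = a p(x)\<close>, \<open>xb = b q(x)\<close>, for which \<open>axb = 0\<close> always.
\<close>

definition continuous_actions ::
  "('ha::{real_inner, complete_space} \<Rightarrow>\<^sub>L 'ha) set \<Rightarrow>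
   ('hb::{real_inner, complete_space} \<Rightarrow>\<^sub>L 'hb) set \<Rightarrow> 'x::real_normed_vector set \<Rightarrow>
   (('ha \<Rightarrow>\<^sub>L 'ha) \<Rightarrow> 'x \<Rightarrow> 'x) \<Rightarrow> ('x \<Rightarrow> ('hb \<Rightarrow>\<^sub>L 'hb) \<Rightarrow> 'x) \<Rightarrow> bool"
  where "continuous_actions A B X l r \<longleftrightarrow>
    (\<forall>a\<in>A. continuous_on X (l a)) \<and> (\<forall>b\<in>B. continuous_on X (\<lambda>x. r x b))"

definition nondegenerate_bimodule ::
  "('ha::{real_inner, complete_space} \<Rightarrow>\<^sub>L 'ha) set \<Rightarrow>
   ('hb::{real_inner, complete_space} \<Rightarrow>\<^sub>L 'hb) set \<Rightarrow> 'x::real_normed_vector set \<Rightarrow>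
   (('ha \<Rightarrow>\<^sub>L 'ha) \<Rightarrow> 'x \<Rightarrow> 'x) \<Rightarrow> ('x \<Rightarrow> ('hb \<Rightarrow>\<^sub>L 'hb) \<Rightarrow> 'x) \<Rightarrow> bool"
  where "nondegenerate_bimodule A B X l r \<longleftrightarrow>
    X \<subseteq> closure (span {l a x | a x. a \<in> A \<and> x \<in> X}) \<and>
    X \<subseteq> closure (span {r x b | x b. x \<in> X \<and> b \<in> B})"

definition left_matrix_action ::
  "nat \<Rightarrow> ('a \<Rightarrow> 'x \<Rightarrow> 'x::real_vector) \<Rightarrow>
   (nat \<Rightarrow> nat \<Rightarrow> 'a) \<Rightarrow> (nat \<Rightarrow> nat \<Rightarrow> 'x) \<Rightarrow> nat \<Rightarrow> nat \<Rightarrow> 'x"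
  where "left_matrix_action n l \<alpha> x = (\<lambda>i j. \<Sum>k<n. l (\<alpha> i k) (x k j))"

definition right_matrix_action ::
  "nat \<Rightarrow> ('x \<Rightarrow> 'b \<Rightarrow> 'x::real_vector) \<Rightarrow>
   (nat \<Rightarrow> nat \<Rightarrow> 'x) \<Rightarrow> (nat \<Rightarrow> nat \<Rightarrow> 'b) \<Rightarrow> nat \<Rightarrow> nat \<Rightarrow> 'x"
  where "right_matrix_action n r x \<beta> = (\<lambda>i j. \<Sum>k<n. r (x i k) (\<beta> k j))"

definition completely_contractive_actions ::
  "('ha::{real_inner, complete_space} \<Rightarrow>\<^sub>L 'ha) set \<Rightarrow>
   ('hb::{real_inner, complete_space} \<Rightarrow>\<^sub>L 'hb) set \<Rightarrow>
   ('hx::{real_inner, complete_space} \<Rightarrow>\<^sub>L 'hx) set \<Rightarrow>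
   (('ha \<Rightarrow>\<^sub>L 'ha) \<Rightarrow> ('hx \<Rightarrow>\<^sub>L 'hx) \<Rightarrow> ('hx \<Rightarrow>\<^sub>L 'hx)) \<Rightarrow>
   (('hx \<Rightarrow>\<^sub>L 'hx) \<Rightarrow> ('hb \<Rightarrow>\<^sub>L 'hb) \<Rightarrow> ('hx \<Rightarrow>\<^sub>L 'hx)) \<Rightarrow> bool"
  where "completely_contractive_actions A B X l r \<longleftrightarrow>
    (\<forall>n. \<forall>x\<in>matrices n X. \<forall>\<alpha>\<in>matrices n A. \<forall>\<beta>\<in>matrices n B.
       matrix_norm n (right_matrix_action n r (left_matrix_action n l \<alpha> x) \<beta>)
         \<le> matrix_norm n \<alpha> * matrix_norm n x * matrix_norm n \<beta>)"


section \<open>Representations\<close>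

definition operator_representation ::
  "('h::{real_inner, complete_space} \<Rightarrow>\<^sub>L 'h) set \<Rightarrow> 'u::{real_inner, complete_space} set \<Rightarrow>
   (('h \<Rightarrow>\<^sub>L 'h) \<Rightarrow> ('u \<Rightarrow>\<^sub>L 'u)) \<Rightarrow> bool"
  where "operator_representation A H \<theta> \<longleftrightarrow>
    real_linear_on A \<theta> \<and> \<theta> ` A \<subseteq> bounded_operators H H \<and>
    (\<forall>a\<in>A. \<forall>b\<in>A. \<theta> (a o\<^sub>L b) = \<theta> a o\<^sub>L \<theta> b)"

text \<open>
  The zero algebra has a nondegenerate representation only on the zero space, on which a nonzero
  algebra has no isometric representation. So if exactly one of \<open>A\<close>, \<open>B\<close> is zero, they do not
  have nondegenerate completely isometric representations on the same space.
\<close>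

definition nondegenerate_representation ::
  "('h::{real_inner, complete_space} \<Rightarrow>\<^sub>L 'h) set \<Rightarrow> 'u::{real_inner, complete_space} set \<Rightarrow>
   (('h \<Rightarrow>\<^sub>L 'h) \<Rightarrow> ('u \<Rightarrow>\<^sub>L 'u)) \<Rightarrow> bool"
  where "nondegenerate_representation A H \<theta> \<longleftrightarrow>
    operator_representation A H \<theta> \<and>
    H \<subseteq> closure (span {blinfun_apply (\<theta> a) h | a h. a \<in> A \<and> h \<in> H})"

definition intertwines ::
  "'a set \<Rightarrow> 'b set \<Rightarrow> 'x set \<Rightarrow> ('a \<Rightarrow> 'x \<Rightarrow> 'x) \<Rightarrow> ('x \<Rightarrow> 'b \<Rightarrow> 'x) \<Rightarrow>
   ('x \<Rightarrow> ('u::{real_inner, complete_space} \<Rightarrow>\<^sub>L 'u)) \<Rightarrow>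
   ('a \<Rightarrow> ('u \<Rightarrow>\<^sub>L 'u)) \<Rightarrow> ('b \<Rightarrow> ('u \<Rightarrow>\<^sub>L 'u)) \<Rightarrow> bool"
  where "intertwines A B X l r \<Phi> \<theta> \<pi> \<longleftrightarrow>
    (\<forall>a\<in>A. \<forall>x\<in>X. \<theta> a o\<^sub>L \<Phi> x = \<Phi> (l a x)) \<and>
    (\<forall>x\<in>X. \<forall>b\<in>B. \<Phi> x o\<^sub>L \<pi> b = \<Phi> (r x b))"

text \<open>
  A concrete operator \<open>A\<close>-\<open>B\<close>-bimodule is a subspace \<open>Y\<close> of \<open>B(K,H)\<close> with
  \<open>\<theta>(A)Y \<subseteq> Y\<close> and \<open>Y\<pi>(B) \<subseteq> Y\<close>; its actions are multiplication by \<open>\<theta>(a)\<close> and by \<open>\<pi>(b)\<close>.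
\<close>

definition concrete_operator_bimodule ::
  "'a set \<Rightarrow> 'b set \<Rightarrow> 'u::{real_inner, complete_space} set \<Rightarrow> 'u set \<Rightarrow>
   ('a \<Rightarrow> ('u \<Rightarrow>\<^sub>L 'u)) \<Rightarrow> ('b \<Rightarrow> ('u \<Rightarrow>\<^sub>L 'u)) \<Rightarrow> ('u \<Rightarrow>\<^sub>L 'u) set \<Rightarrow> bool"
  where "concrete_operator_bimodule A B H K \<theta> \<pi> Y \<longleftrightarrow>
    subspace Y \<and> Y \<subseteq> bounded_operators K H \<and>
    (\<forall>a\<in>A. \<forall>y\<in>Y. \<theta> a o\<^sub>L y \<in> Y) \<and> (\<forall>y\<in>Y. \<forall>b\<in>B. y o\<^sub>L \<pi> b \<in> Y)"

definition completely_bimodule_isometric ::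
  "'a set \<Rightarrow> 'b set \<Rightarrow>
   ('hx::{real_inner, complete_space} \<Rightarrow>\<^sub>L 'hx) set \<Rightarrow>
   ('a \<Rightarrow> ('hx \<Rightarrow>\<^sub>L 'hx) \<Rightarrow> ('hx \<Rightarrow>\<^sub>L 'hx)) \<Rightarrow> (('hx \<Rightarrow>\<^sub>L 'hx) \<Rightarrow> 'b \<Rightarrow> ('hx \<Rightarrow>\<^sub>L 'hx)) \<Rightarrow>
   ('u::{real_inner, complete_space} \<Rightarrow>\<^sub>L 'u) set \<Rightarrow>
   ('a \<Rightarrow> ('u \<Rightarrow>\<^sub>L 'u) \<Rightarrow> ('u \<Rightarrow>\<^sub>L 'u)) \<Rightarrow> (('u \<Rightarrow>\<^sub>L 'u) \<Rightarrow> 'b \<Rightarrow> ('u \<Rightarrow>\<^sub>L 'u)) \<Rightarrow> bool"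
  where "completely_bimodule_isometric A B X l r Y l' r' \<longleftrightarrow>
    (\<exists>\<Psi>. bij_betw \<Psi> X Y \<and> real_linear_on X \<Psi> \<and> completely_isometric X \<Psi> \<and>
      (\<forall>a\<in>A. \<forall>x\<in>X. \<Psi> (l a x) = l' a (\<Psi> x)) \<and>
      (\<forall>x\<in>X. \<forall>b\<in>B. \<Psi> (r x b) = r' (\<Psi> x) b))"

end

theory Submission
  imports Defs "HOL-Library.Function_Algebras"
begin

text \<open>
  By a minimax argument, a contractive functional on \<open>M\<^sub>n(X)\<close> is dominated by a pair of states,
  one on rows over the adjoint of \<open>A\<close> and one on rows over \<open>B\<close>. The Hilbert spaces generated by
  these states, as in the Gelfand-Naimark-Segal construction, carry the two representations:
  multiplication of rows by elements of \<open>B\<close>, and the adjoint of multiplication by adjoints of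
  elements of \<open>A\<close>. The functional is then a bounded form between these two spaces, and the sum over all
  functionals is the operator \<open>\<Phi> x\<close>. Further summands make the representations isometric, and
  repeating every summand often enough gives both Hilbert spaces the same dimension. For \<open>A = B\<close>
  one takes the direct sum of the two representations and puts \<open>\<Phi>\<close> into the corner.
\<close>

text \<open>The product bound for \<open>F(\<gamma>* x \<beta>)\<close>, with \<open>F\<close> a
  functional, is replaced by \<open>2 F(\<gamma>* x \<beta>) \<le> s(\<gamma>,\<gamma>) +
  t(\<beta>,\<beta>)\<close>. The right-hand side is affine in the pair of states, as minimax
  requires, and rescaling \<open>\<gamma>\<close> and \<open>\<beta>\<close> recovers the product.
  The inequality is demanded for several rows and a matrix \<open>x\<close> at once; this makes
  \<open>\<Phi>\<close> completely contractive. Functionals given by two tuples of vectors suffice,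
  since they already determine the matrix norms of \<open>X\<close>. The algebras have no unit, so
  rows with a single entry from an approximate identity take the place of cyclic vectors in the
  lower bounds. The fixed index type shapes the rest: the representations have to be nondegenerate
  on all of one prescribed space \<open>\<ell>2(I)\<close>. Gram vectors are therefore constructed
  with dense span in it. There are at most as many of them as elements of \<open>I\<close>, and the
  repetition of blocks provides at least as many independent ones. A zero algebra has no nonzero
  vector to repeat and is treated separately.\<close>

instantiation "fun" :: (type, real_vector) real_vector
begin

definition scaleR_fun :: "real \<Rightarrow> ('a \<Rightarrow> 'b) \<Rightarrow> 'a \<Rightarrow> 'b"
  where "scaleR_fun c f = (\<lambda>x. c *\<^sub>R f x)"

instance
  by standard (simp_all add: scaleR_fun_def fun_eq_iff scaleR_add_right scaleR_add_left)

end

lemma scaleR_fun_apply [simp]: "(c *\<^sub>R f) x = c *\<^sub>R f x"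
  by (simp add: scaleR_fun_def)

lemma sum_fun_apply: "(\<Sum>i\<in>S. f i) x = (\<Sum>i\<in>S. f i x)"
  by (induction S rule: infinite_finite_induct) auto

section \<open>Hilbert space preliminaries\<close>

lemma Cauchy_of_norm_diff_sq:
  fixes z :: "nat \<Rightarrow> 'e::real_normed_vector"
  assumes "\<And>m n. (norm (z m - z n))\<^sup>2 \<le> a m + a n" and "a \<longlonglongrightarrow> 0"
  shows "Cauchy z"
proof (rule metric_CauchyI)
  fix e :: real assume e: "0 < e"
  then have "\<forall>\<^sub>F n in sequentially. a n < e\<^sup>2 / 2"
    using assms(2) by (intro order_tendstoD(2)) auto
  then obtain N where N: "\<And>n. N \<le> n \<Longrightarrow> a n < e\<^sup>2 / 2"
    by (auto simp: eventually_sequentially)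
  have "dist (z m) (z n) < e" if "N \<le> m" "N \<le> n" for m n
  proof -
    have "(norm (z m - z n))\<^sup>2 < e\<^sup>2"
      using assms(1)[of m n] N[OF that(1)] N[OF that(2)] by linarith
    then show ?thesis using e by (simp add: dist_norm power_less_imp_less_base)
  qed
  then show "\<exists>M. \<forall>m\<ge>M. \<forall>n\<ge>M. dist (z m) (z n) < e" by blast
qed

lemma parallelogram_midpoint:
  fixes x y :: "'e::real_inner"
  shows "(norm (x - y))\<^sup>2 = 2 * (norm x)\<^sup>2 + 2 * (norm y)\<^sup>2 - 4 * (norm ((1/2) *\<^sub>R (x + y)))\<^sup>2"
proof -
  have "4 * (norm ((1/2) *\<^sub>R (x + y)))\<^sup>2 = (norm (x + y))\<^sup>2"
    by (simp add: power_divide)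
  then show ?thesis
    by (simp add: power2_norm_eq_inner inner_add_left inner_add_right inner_diff_left
        inner_diff_right inner_commute[of y x])
qed

lemma norm_sq_add_scaleR:
  fixes x y :: "'e::real_inner"
  shows "(norm (x + t *\<^sub>R y))\<^sup>2 = (norm x)\<^sup>2 + 2 * t * (x \<bullet> y) + t\<^sup>2 * (norm y)\<^sup>2"
  unfolding power2_norm_eq_inner
  by (simp add: inner_add_left inner_add_right inner_commute[of y x] power2_eq_square
      algebra_simps)

lemma quadratic_nonneg_imp_zero:
  fixes b q :: real
  assumes "\<And>t. 0 \<le> 2 * t * b + t\<^sup>2 * q" shows "b = 0"
proof (rule ccontr)
  assume b: "b \<noteq> 0"
  \<comment> \<open>The quadratic term is then at most \<open>- t * b\<close>, so it cancels only
    half of the linear term \<open>2 * t * b\<close>. The \<open>+ 1\<close> keeps the denominator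
    positive for \<open>q = 0\<close>.\<close>
  define t where "t = - b / (\<bar>q\<bar> + 1)"
  have "t\<^sup>2 * q \<le> t\<^sup>2 * \<bar>q\<bar>" by (intro mult_left_mono) auto
  also have "\<dots> \<le> t\<^sup>2 * (\<bar>q\<bar> + 1)" by (intro mult_left_mono) auto
  also have "\<dots> = - t * b" by (simp add: t_def power2_eq_square)
  finally have "0 \<le> t * b" using assms[of t] by linarith
  moreover have "t * b < 0"
  proof -
    have "0 < b * b" using b by (metis not_real_square_gt_zero)
    then have "0 < b * b / (\<bar>q\<bar> + 1)" by (intro divide_pos_pos) auto
    then show ?thesis by (simp add: t_def)
  qed
  ultimately show False by simp
qed

text \<open>
  The Riesz representation theorem, for a functional given by its graph \<open>G\<close>: stated in this way
  the functional need not be shown to be well defined.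
\<close>

lemma riesz_graph:
  fixes G :: "('e::{real_inner, complete_space} \<times> real) set"
  assumes G: "subspace G" and bnd: "\<And>z r. (z, r) \<in> G \<Longrightarrow> \<bar>r\<bar> \<le> C * norm z"
  obtains R where "R \<in> closure (fst ` G)" and "\<And>z r. (z, r) \<in> G \<Longrightarrow> R \<bullet> z = r"
proof -
  \<comment> \<open>If \<open>R\<close> represents the functional, \<open>J (z, r)\<close> equals
    \<open>\<parallel>z - R\<parallel>\<^sup>2 - \<parallel>R\<parallel>\<^sup>2\<close>, so
    minimising \<open>J\<close> over the graph means approaching \<open>R\<close>.\<close>
  define J where "J p = (norm (fst p))\<^sup>2 - 2 * snd p" for p :: "'e \<times> real"
  have lower: "- C\<^sup>2 \<le> J p" if "p \<in> G" for p
  proof -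
    have "0 \<le> (norm (fst p) - C)\<^sup>2" by simp
    moreover have "\<bar>snd p\<bar> \<le> C * norm (fst p)" using bnd[of "fst p" "snd p"] that by simp
    ultimately show ?thesis
      unfolding J_def power2_diff by (simp add: abs_le_iff mult.commute)
  qed
  define m where "m = Inf (J ` G)"
  have bdd: "bdd_below (J ` G)" using lower by (rule bdd_belowI2)
  have ne: "G \<noteq> {}" using subspace_0[OF G] by blast
  have m: "m \<le> J p" if "p \<in> G" for p
    unfolding m_def using bdd that by (intro cInf_lower) auto
  have "\<exists>p\<in>G. J p < m + inverse (Suc n)" for n
  proof -
    have "m < m + inverse (Suc n)" by simp
    then show ?thesis unfolding m_def using cInf_lessD[of "J ` G"] ne by fastforce
  qed
  then obtain p where p: "\<And>n. p n \<in> G" "\<And>n. J (p n) < m + inverse (Suc n)" by metis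
  define a where "a n = 2 * (J (p n) - m)" for n
  have "a \<longlonglongrightarrow> 0"
  proof (rule tendsto_sandwich)
    show "\<forall>\<^sub>F n in sequentially. 0 \<le> a n" using m[OF p(1)] by (simp add: a_def)
    show "\<forall>\<^sub>F n in sequentially. a n \<le> 2 * inverse (Suc n)"
    proof (intro always_eventually allI)
      show "a n \<le> 2 * inverse (Suc n)" for n 
      proof -
        have "J (p n) - m \<le> inverse (real (Suc n))" using p(2)[of n] by linarith
        then show ?thesis unfolding a_def by (intro mult_left_mono) auto
      qed
    qed
    show "(\<lambda>n. 2 * inverse (real (Suc n))) \<longlonglongrightarrow> 0"
      using tendsto_mult_right[OF LIMSEQ_inverse_real_of_nat, of 2] by simp
  qed simp
  moreover have "(norm (fst (p i) - fst (p j)))\<^sup>2 \<le> a i + a j" for i j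
  proof -
    \<comment> \<open>The second component is affine and cancels at the midpoint, so the
      parallelogram law holds for \<open>J\<close>; minimising sequences are therefore
      Cauchy.\<close>
    define q where "q = (1/2) *\<^sub>R (p i + p j)"
    have q: "q \<in> G" unfolding q_def by (intro subspace_scale subspace_add G p)
    have "(norm (fst (p i) - fst (p j)))\<^sup>2 = 2 * J (p i) + 2 * J (p j) - 4 * J q"
      unfolding J_def q_def parallelogram_midpoint[of "fst (p i)"] by (simp add: field_simps)
    then show ?thesis using m[OF q] by (simp add: a_def)
  qed
  ultimately have "Cauchy (\<lambda>n. fst (p n))" by (intro Cauchy_of_norm_diff_sq)
  then obtain R where R: "(\<lambda>n. fst (p n)) \<longlonglongrightarrow> R"
    using Cauchy_convergent convergent_def by blast
  have Jlim: "(\<lambda>n. J (p n)) \<longlonglongrightarrow> m"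
  proof -
    have "(\<lambda>n. a n / 2 + m) \<longlonglongrightarrow> 0 / 2 + m" by (intro tendsto_intros \<open>a \<longlonglongrightarrow> 0\<close>) simp
    then show ?thesis by (simp add: a_def field_simps)
  qed
  \<comment> \<open>First variation of \<open>J\<close>. Since \<open>R\<close> is only a limit of
    first components of \<open>G\<close>, the comparison is made at \<open>p n\<close> and passed to
    the limit.\<close>
  have "R \<bullet> z = r" if zr: "(z, r) \<in> G" for z r
  proof -
    have "0 \<le> 2 * t * (R \<bullet> z - r) + t\<^sup>2 * (norm z)\<^sup>2" for t
    proof -
      have "m \<le> J (p n) + 2 * t * (fst (p n) \<bullet> z - r) + t\<^sup>2 * (norm z)\<^sup>2" for n
      proof -
        have "p n + t *\<^sub>R (z, r) \<in> G" by (intro subspace_scale subspace_add G p zr)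
        from m[OF this] show ?thesis unfolding J_def
          by (simp add: norm_sq_add_scaleR algebra_simps)
      qed
      moreover have "(\<lambda>n. J (p n) + 2 * t * (fst (p n) \<bullet> z - r) + t\<^sup>2 * (norm z)\<^sup>2)
          \<longlonglongrightarrow> m + 2 * t * (R \<bullet> z - r) + t\<^sup>2 * (norm z)\<^sup>2"
        by (intro tendsto_intros Jlim R)
      ultimately have "m \<le> m + 2 * t * (R \<bullet> z - r) + t\<^sup>2 * (norm z)\<^sup>2"
        by (intro LIMSEQ_le_const) auto
      then show ?thesis by simp
    qed
    then have "R \<bullet> z - r = 0" by (rule quadratic_nonneg_imp_zero)
    then show ?thesis by simp
  qed
  moreover have "R \<in> closure (fst ` G)"
    unfolding closure_sequential using R p(1) by (intro exI[of _ "\<lambda>n. fst (p n)"]) auto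
  ultimately show thesis using that by blast
qed

lemma orthogonal_closure:
  fixes x :: "'e::real_inner"
  assumes "\<And>s. s \<in> S \<Longrightarrow> x \<bullet> s = 0" and "y \<in> closure S"
  shows "x \<bullet> y = 0"
proof -
  have "closed {y. x \<bullet> y = 0}" by (intro closed_Collect_eq continuous_intros)
  then have "closure S \<subseteq> {y. x \<bullet> y = 0}" using assms(1) by (intro closure_minimal) auto
  then show ?thesis using assms(2) by auto
qed

lemma orthogonal_span:
  fixes x :: "'e::real_inner"
  assumes "\<And>s. s \<in> S \<Longrightarrow> x \<bullet> s = 0" and "y \<in> span S"
  shows "x \<bullet> y = 0"
  using assms(2)
proof (induction rule: span_induct_alt)
  case base then show ?case by simp
next
  case (step c s y) then show ?case using assms(1) by (simp add: inner_simps)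
qed

text \<open>The Riesz vector of \<open>x\<close> on \<open>M\<close>, taken in the closure of
  \<open>M\<close>, is the orthogonal projection of \<open>x\<close>; the difference is orthogonal
  to \<open>M\<close> and hence zero.\<close>

lemma dense_if_total:
  fixes M :: "'e::{real_inner, complete_space} set"
  assumes M: "subspace M" and tot: "\<And>x. (\<And>y. y \<in> M \<Longrightarrow> x \<bullet> y = 0) \<Longrightarrow> x = 0"
  shows "closure M = UNIV"
proof -
  have "x \<in> closure M" for x
  proof -
    define G where "G = (\<lambda>z. (z, x \<bullet> z)) ` M"
    have G: "subspace G" unfolding G_def
      by (intro linear_subspace_image M linearI) (auto simp: inner_simps)
    have "\<bar>r\<bar> \<le> norm x * norm z" if "(z, r) \<in> G" for z r
      using that Cauchy_Schwarz_ineq2[of x z] by (auto simp: G_def)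
    then obtain R where R: "R \<in> closure (fst ` G)" "\<And>z r. (z, r) \<in> G \<Longrightarrow> R \<bullet> z = r"
      using riesz_graph[OF G] by metis
    have "(x - R) \<bullet> y = 0" if "y \<in> M" for y
      using R(2)[of y "x \<bullet> y"] that by (auto simp: G_def inner_simps)
    then have "x - R = 0" by (rule tot)
    moreover have "fst ` G = M" by (auto simp: G_def image_image)
    ultimately show ?thesis using R(1) by simp
  qed
  then show ?thesis by auto
qed

lemma dense_inner_eqI:
  fixes x y :: "'e::real_inner"
  assumes "closure M = UNIV" and "\<And>z. z \<in> M \<Longrightarrow> x \<bullet> z = y \<bullet> z"
  shows "x = y"
proof -
  have "(x - y) \<bullet> (x - y) = 0"
    by (rule orthogonal_closure[of M]) (simp_all add: assms inner_diff_left)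
  then show ?thesis by simp
qed

lemma blinfun_eq_on_dense:
  fixes S T :: "'e::real_normed_vector \<Rightarrow>\<^sub>L 'f::real_normed_vector"
  assumes "closure M = UNIV" and "\<And>z. z \<in> M \<Longrightarrow> blinfun_apply S z = blinfun_apply T z"
  shows "S = T"
proof (rule blinfun_eqI)
  fix x
  have "closed {x. blinfun_apply S x = blinfun_apply T x}"
    by (intro closed_Collect_eq continuous_intros)
  then have "closure M \<subseteq> {x. blinfun_apply S x = blinfun_apply T x}"
    using assms(2) by (intro closure_minimal) auto
  then show "blinfun_apply S x = blinfun_apply T x" using assms(1) by auto
qed

section \<open>Adjoints, and operators defined by bounded forms\<close>

lemma adj_exists:
  fixes T :: "'e::{real_inner, complete_space} \<Rightarrow>\<^sub>L 'f::{real_inner, complete_space}"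
  shows "\<exists>S. \<forall>x y. blinfun_apply T x \<bullet> y = x \<bullet> blinfun_apply S y"
proof -
  have "\<exists>R. \<forall>x. blinfun_apply T x \<bullet> y = x \<bullet> R" for y
  proof -
    define G where "G = range (\<lambda>x. (x, blinfun_apply T x \<bullet> y))"
    have G: "subspace G" unfolding G_def
      by (intro linear_subspace_image subspace_UNIV linearI)
        (auto simp: blinfun.add_right blinfun.scaleR_right inner_simps)
    have bnd: "\<bar>r\<bar> \<le> (norm T * norm y) * norm z" if "(z, r) \<in> G" for z r
    proof -
      have "\<bar>r\<bar> \<le> norm (blinfun_apply T z) * norm y"
        using that Cauchy_Schwarz_ineq2 by (auto simp: G_def)
      also have "\<dots> \<le> (norm T * norm z) * norm y" by (intro mult_right_mono norm_blinfun) auto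
      finally show ?thesis by (simp add: algebra_simps)
    qed
    obtain R where "\<And>z r. (z, r) \<in> G \<Longrightarrow> R \<bullet> z = r" using riesz_graph[OF G bnd] by metis
    then have "R \<bullet> x = blinfun_apply T x \<bullet> y" for x by (auto simp: G_def)
    then show ?thesis by (metis inner_commute)
  qed
  then obtain S where S: "\<And>x y. blinfun_apply T x \<bullet> y = x \<bullet> S y" by metis
  have "bounded_linear S"
  proof (rule bounded_linear_intro)
    show "S (x + y) = S x + S y" for x y
      by (rule vector_eq_ldot[THEN iffD1]) (simp add: inner_simps flip: S)
    show "S (r *\<^sub>R x) = r *\<^sub>R S x" for r x
      by (rule vector_eq_ldot[THEN iffD1]) (simp add: inner_simps flip: S)
    show "norm (S x) \<le> norm x * norm T" for x
    proof -
      have "norm (S x) * norm (S x) = blinfun_apply T (S x) \<bullet> x"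
        by (simp add: S flip: power2_norm_eq_inner power2_eq_square)
      also have "\<dots> \<le> norm (blinfun_apply T (S x)) * norm x" by (rule norm_cauchy_schwarz)
      also have "\<dots> \<le> (norm T * norm (S x)) * norm x" by (intro mult_right_mono norm_blinfun) auto
      finally have "norm (S x) * norm (S x) \<le> norm (S x) * (norm x * norm T)" by (simp add: algebra_simps)
      then show ?thesis by (cases "norm (S x) = 0") (auto simp: mult_le_cancel_left)
    qed
  qed
  then show ?thesis using S by (intro exI[of _ "Blinfun S"]) (simp add: bounded_linear_Blinfun_apply)
qed

definition adj :: "('e::{real_inner, complete_space} \<Rightarrow>\<^sub>L 'f::{real_inner, complete_space})
    \<Rightarrow> ('f \<Rightarrow>\<^sub>L 'e)"
  where "adj T = (SOME S. \<forall>x y. blinfun_apply T x \<bullet> y = x \<bullet> blinfun_apply S y)"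

lemma adj_right: "blinfun_apply T x \<bullet> y = x \<bullet> blinfun_apply (adj T) y"
  using someI_ex[OF adj_exists[of T]] unfolding adj_def by blast

lemma adj_left: "blinfun_apply (adj T) x \<bullet> y = x \<bullet> blinfun_apply T y"
  by (metis adj_right inner_commute)

lemma adj_unique: "(\<And>x y. blinfun_apply T x \<bullet> y = x \<bullet> blinfun_apply S y) \<Longrightarrow> adj T = S"
  by (metis adj_right blinfun_eqI vector_eq_ldot)

lemma adj_adj [simp]: "adj (adj T) = T"
  by (rule adj_unique) (simp add: adj_left)

lemma adj_zero [simp]: "adj 0 = 0"
  by (rule adj_unique) simp

lemma adj_add: "adj (S + T) = adj S + adj T"
  by (rule adj_unique) (simp add: blinfun.add_left inner_simps adj_right)

lemma adj_scaleR: "adj (c *\<^sub>R T) = c *\<^sub>R adj T"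
  by (rule adj_unique) (simp add: blinfun.scaleR_left inner_simps adj_right)

lemma adj_compose: "adj (S o\<^sub>L T) = adj T o\<^sub>L adj S"
  by (rule adj_unique) (simp add: adj_right)

lemma linear_adj: "linear adj"
  by (rule linearI) (simp_all add: adj_add adj_scaleR)

lemma norm_adj_le: "norm (adj T) \<le> norm T"
proof (rule norm_blinfun_bound)
  fix y
  let ?x = "blinfun_apply (adj T) y"
  have "norm ?x * norm ?x = blinfun_apply T ?x \<bullet> y"
    by (simp add: adj_right flip: power2_norm_eq_inner power2_eq_square)
  also have "\<dots> \<le> norm (blinfun_apply T ?x) * norm y" by (rule norm_cauchy_schwarz)
  also have "\<dots> \<le> (norm T * norm ?x) * norm y" by (intro mult_right_mono norm_blinfun) auto
  finally have "norm ?x * norm ?x \<le> norm ?x * (norm T * norm y)" by (simp add: algebra_simps)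
  then show "norm ?x \<le> norm T * norm y" by (cases "norm ?x = 0") (auto simp: mult_le_cancel_left)
qed simp

lemma norm_adj [simp]: "norm (adj T) = norm T"
  using norm_adj_le[of T] norm_adj_le[of "adj T"] by simp

text \<open>The form lives on parameters and not on vectors: \<open>v\<close> and \<open>w\<close>
  will send rows to a Hilbert space in which some rows become null. The bound makes \<open>m\<close>
  depend only on the vectors. Riesz is used twice, in the second argument for fixed \<open>x\<close>
  and then in the first for a fixed target vector \<open>u\<close>.\<close>

lemma operator_of_form:
  fixes v :: "'v::real_vector \<Rightarrow> 'e::{real_inner, complete_space}"
    and w :: "'w::real_vector \<Rightarrow> 'f::{real_inner, complete_space}"
    and m :: "'v \<Rightarrow> 'w \<Rightarrow> real"
  assumes V: "subspace V" and W: "subspace W"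
    and v: "real_linear_on V v" and w: "real_linear_on W w"
    and dv: "closure (v ` V) = UNIV" and dw: "closure (w ` W) = UNIV"
    and m1: "\<And>y. y \<in> W \<Longrightarrow> real_linear_on V (\<lambda>x. m x y)"
    and m2: "\<And>x. x \<in> V \<Longrightarrow> real_linear_on W (m x)"
    and bnd: "\<And>x y. x \<in> V \<Longrightarrow> y \<in> W \<Longrightarrow> \<bar>m x y\<bar> \<le> C * norm (v x) * norm (w y)"
  obtains T where "\<And>x y. x \<in> V \<Longrightarrow> y \<in> W \<Longrightarrow> blinfun_apply T (v x) \<bullet> w y = m x y"
proof -
  have lin_im: "subspace ((\<lambda>x. (p x, q x)) ` U)"
    if "subspace U" "real_linear_on U p" "real_linear_on U q"
    for U :: "'c::real_vector set" and p :: "'c \<Rightarrow> 'p::real_vector" and q :: "'c \<Rightarrow> 'q::real_vector"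
  proof (rule subspaceI)
    have "p 0 = 0" "q 0 = 0"
      using that subspace_0[OF that(1)] unfolding real_linear_on_def by (metis scaleR_zero_left)+
    then show "0 \<in> (\<lambda>x. (p x, q x)) ` U"
      using subspace_0[OF that(1)] by (intro image_eqI[of _ _ 0]) (auto simp: zero_prod_def)
  next
    fix x y assume "x \<in> (\<lambda>x. (p x, q x)) ` U" "y \<in> (\<lambda>x. (p x, q x)) ` U"
    then obtain a b where "a \<in> U" "b \<in> U" "x = (p a, q a)" "y = (p b, q b)" by auto
    then show "x + y \<in> (\<lambda>x. (p x, q x)) ` U"
      using that subspace_add[OF that(1), of a b]
      by (intro image_eqI[of _ _ "a + b"]) (auto simp: real_linear_on_def)
  next
    fix c x assume "x \<in> (\<lambda>x. (p x, q x)) ` U"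
    then obtain a where "a \<in> U" "x = (p a, q a)" by auto
    then show "c *\<^sub>R x \<in> (\<lambda>x. (p x, q x)) ` U"
      using that subspace_scale[OF that(1), of a c]
      by (intro image_eqI[of _ _ "c *\<^sub>R a"]) (auto simp: real_linear_on_def)
  qed
  have "\<exists>R. \<forall>y\<in>W. R \<bullet> w y = m x y" if x: "x \<in> V" for x
  proof -
    define G where "G = (\<lambda>y. (w y, m x y)) ` W"
    have G: "subspace G" unfolding G_def by (intro lin_im W w m2 x)
    have bG: "\<bar>r\<bar> \<le> (C * norm (v x)) * norm z" if "(z, r) \<in> G" for z r
      using bnd[OF x] that by (auto simp: G_def)
    obtain R where "\<And>z r. (z, r) \<in> G \<Longrightarrow> R \<bullet> z = r" using riesz_graph[OF G bG] by metis
    then show ?thesis by (intro exI[of _ R]) (auto simp: G_def)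
  qed
  then obtain R where R: "\<And>x y. x \<in> V \<Longrightarrow> y \<in> W \<Longrightarrow> R x \<bullet> w y = m x y" by metis
  have Rlin: "real_linear_on V R"
    unfolding real_linear_on_def
  proof (intro conjI ballI allI)
    fix x y assume xy: "x \<in> V" "y \<in> V"
    show "R (x + y) = R x + R y"
    proof (rule dense_inner_eqI[OF dw])
      fix z assume "z \<in> w ` W"
      then show "R (x + y) \<bullet> z = (R x + R y) \<bullet> z"
        using xy m1 subspace_add[OF V xy] by (auto simp: R inner_simps real_linear_on_def)
    qed
  next
    fix c x assume x: "x \<in> V"
    show "R (c *\<^sub>R x) = c *\<^sub>R R x"
    proof (rule dense_inner_eqI[OF dw])
      fix z assume "z \<in> w ` W"
      then show "R (c *\<^sub>R x) \<bullet> z = (c *\<^sub>R R x) \<bullet> z"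
        using x m1 subspace_scale[OF V x] by (auto simp: R inner_simps real_linear_on_def)
    qed
  qed
  \<comment> \<open>\<open>C\<close> is not assumed nonnegative, and may be negative when one of the
    spaces is zero.\<close>
  define D where "D = \<bar>C\<bar>"
  have bnd': "\<bar>m x y\<bar> \<le> D * norm (v x) * norm (w y)" if "x \<in> V" "y \<in> W" for x y
  proof -
    have "C * norm (v x) * norm (w y) \<le> D * norm (v x) * norm (w y)"
      unfolding D_def by (intro mult_right_mono) auto
    then show ?thesis using bnd[OF that] by linarith
  qed
  have Rb: "\<bar>R x \<bullet> u\<bar> \<le> D * norm (v x) * norm u" if x: "x \<in> V" for x u
  proof -
    have "closed {u. \<bar>R x \<bullet> u\<bar> \<le> D * norm (v x) * norm u}"
      by (intro closed_Collect_le continuous_intros)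
    then have "closure (w ` W) \<subseteq> {u. \<bar>R x \<bullet> u\<bar> \<le> D * norm (v x) * norm u}"
      using bnd'[OF x] by (intro closure_minimal) (auto simp: R x)
    then show ?thesis using dw by auto
  qed
  \<comment> \<open>\<open>S\<close> will be the value at \<open>u\<close> of the adjoint of the
    operator sought.\<close>
  have "\<exists>S. (\<forall>x\<in>V. S \<bullet> v x = R x \<bullet> u) \<and> norm S \<le> norm u * D" for u
  proof -
    define G where "G = (\<lambda>x. (v x, R x \<bullet> u)) ` V"
    have "real_linear_on V (\<lambda>x. R x \<bullet> u)"
      using Rlin by (auto simp: real_linear_on_def inner_simps)
    then have G: "subspace G" unfolding G_def by (intro lin_im V v)
    have bG: "\<bar>r\<bar> \<le> (D * norm u) * norm z" if "(z, r) \<in> G" for z r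
      using Rb that by (auto simp: G_def algebra_simps)
    obtain S where S: "\<And>z r. (z, r) \<in> G \<Longrightarrow> S \<bullet> z = r" using riesz_graph[OF G bG] by metis
    have SV: "S \<bullet> v x = R x \<bullet> u" if "x \<in> V" for x using S that by (auto simp: G_def)
    have "closed {z. \<bar>S \<bullet> z\<bar> \<le> D * norm u * norm z}"
      by (intro closed_Collect_le continuous_intros)
    then have "closure (v ` V) \<subseteq> {z. \<bar>S \<bullet> z\<bar> \<le> D * norm u * norm z}"
      using Rb by (intro closure_minimal) (auto simp: SV algebra_simps)
    then have "S \<in> {z. \<bar>S \<bullet> z\<bar> \<le> D * norm u * norm z}" unfolding dv by blast
    then have "\<bar>S \<bullet> S\<bar> \<le> D * norm u * norm S" by (rule CollectD)
    then have "norm S * norm S \<le> (norm u * D) * norm S"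
      by (simp add: power2_norm_eq_inner algebra_simps flip: power2_eq_square)
    then have "norm S \<le> norm u * D"
      by (cases "norm S = 0") (auto simp: mult_le_cancel_right D_def)
    then show ?thesis using SV by blast
  qed
  then obtain S where S: "\<And>x u. x \<in> V \<Longrightarrow> S u \<bullet> v x = R x \<bullet> u" "\<And>u. norm (S u) \<le> norm u * D"
    by metis
  have "bounded_linear S"
  proof (rule bounded_linear_intro)
    show "S (x + y) = S x + S y" for x y
      by (rule dense_inner_eqI[OF dv]) (auto simp: S inner_simps)
    show "S (c *\<^sub>R x) = c *\<^sub>R S x" for c x
      by (rule dense_inner_eqI[OF dv]) (auto simp: S inner_simps)
  qed (rule S)
  then have ap: "blinfun_apply (Blinfun S) = S" by (rule bounded_linear_Blinfun_apply)
  have "blinfun_apply (adj (Blinfun S)) (v x) \<bullet> w y = m x y" if "x \<in> V" "y \<in> W" for x y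
    using that by (simp add: adj_left ap) (simp add: inner_commute[of "v x"] S(1) R)
  then show thesis using that by blast
qed

section \<open>Matrix norms\<close>

lemma sum_lessThan_add:
  fixes f :: "nat \<Rightarrow> 'a::comm_monoid_add"
  shows "(\<Sum>i<m + k. f i) = (\<Sum>i<m. f i) + (\<Sum>i<k. f (m + i))"
  by (induction k) (simp_all add: add.assoc)

lemma L2_set_sq: "(L2_set f A)\<^sup>2 = (\<Sum>i\<in>A. (f i)\<^sup>2)"
  by (simp add: L2_set_def sum_nonneg)

lemma L2_set_zero [simp]: "L2_set (\<lambda>_. 0) A = 0"
  by (simp add: L2_set_def)

lemma L2_set_le_one_iff: "L2_set f A \<le> 1 \<longleftrightarrow> (\<Sum>i\<in>A. (f i)\<^sup>2) \<le> 1"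
  by (simp add: L2_set_def sum_nonneg)

context
  fixes n :: nat
    and T :: "nat \<Rightarrow> nat \<Rightarrow> ('k::{real_inner, complete_space} \<Rightarrow>\<^sub>L 'h::{real_inner, complete_space})"
begin

lemma bdd_above_matrix_norm:
  "bdd_above {L2_set (\<lambda>i. norm (\<Sum>j<n. blinfun_apply (T i j) (v j))) {..<n} | v.
     L2_set (\<lambda>j. norm (v j)) {..<n} \<le> 1}"
proof (rule bdd_aboveI)
  fix x assume "x \<in> {L2_set (\<lambda>i. norm (\<Sum>j<n. blinfun_apply (T i j) (v j))) {..<n} | v.
     L2_set (\<lambda>j. norm (v j)) {..<n} \<le> 1}"
  then obtain v where x: "x = L2_set (\<lambda>i. norm (\<Sum>j<n. blinfun_apply (T i j) (v j))) {..<n}"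
    and v: "L2_set (\<lambda>j. norm (v j)) {..<n} \<le> 1" by blast
  have "x \<le> (\<Sum>i<n. norm (\<Sum>j<n. blinfun_apply (T i j) (v j)))"
    unfolding x by (rule L2_set_le_sum) simp
  also have "\<dots> \<le> (\<Sum>i<n. \<Sum>j<n. norm (T i j))"
  proof (intro sum_mono order_trans[OF norm_sum])
    fix i j assume "j \<in> {..<n}"
    then have "norm (v j) \<le> 1"
      using member_le_L2_set[of "{..<n}" j "\<lambda>j. norm (v j)"] v by simp
    then have "norm (T i j) * norm (v j) \<le> norm (T i j)"
      by (simp add: mult_left_le)
    then show "norm (blinfun_apply (T i j) (v j)) \<le> norm (T i j)"
      using norm_blinfun[of "T i j" "v j"] by linarith
  qed
  finally show "x \<le> (\<Sum>i<n. \<Sum>j<n. norm (T i j))" .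
qed

lemma matrix_norm_upper:
  assumes "(\<Sum>j<n. (norm (v j))\<^sup>2) \<le> 1"
  shows "L2_set (\<lambda>i. norm (\<Sum>j<n. blinfun_apply (T i j) (v j))) {..<n} \<le> matrix_norm n T"
  unfolding matrix_norm_def
  by (rule cSup_upper[OF _ bdd_above_matrix_norm])
    (use assms in \<open>auto simp: L2_set_le_one_iff\<close>)

lemma matrix_norm_nonneg [simp]: "0 \<le> matrix_norm n T"
  using matrix_norm_upper[of "\<lambda>_. 0"] by simp

lemma matrix_norm_bound:
  "(\<Sum>i<n. (norm (\<Sum>j<n. blinfun_apply (T i j) (v j)))\<^sup>2)
    \<le> (matrix_norm n T)\<^sup>2 * (\<Sum>j<n. (norm (v j))\<^sup>2)"
proof (cases "(\<Sum>j<n. (norm (v j))\<^sup>2) = 0")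
  case True
  then have "v j = 0" if "j < n" for j
    using that by (simp add: sum_nonneg_eq_0_iff)
  then have "(\<Sum>j<n. blinfun_apply (T i j) (v j)) = 0" for i
    by (intro sum.neutral) (auto simp: blinfun.zero_right)
  then show ?thesis by (simp add: True)
next
  case False
  define s where "s = (\<Sum>j<n. (norm (v j))\<^sup>2)"
  have s: "0 < s" using False sum_nonneg[of "{..<n}" "\<lambda>j. (norm (v j))\<^sup>2"] unfolding s_def by simp
  define w where "w j = (1 / sqrt s) *\<^sub>R v j" for j
  have nw: "(norm (w j))\<^sup>2 = (1 / s) * (norm (v j))\<^sup>2" for j
    using s by (simp add: w_def power_mult_distrib power_divide)
  have "(\<Sum>j<n. (norm (w j))\<^sup>2) \<le> 1"
    unfolding nw sum_distrib_left[symmetric] using s by (simp flip: s_def)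
  then have "(L2_set (\<lambda>i. norm (\<Sum>j<n. blinfun_apply (T i j) (w j))) {..<n})\<^sup>2 \<le> (matrix_norm n T)\<^sup>2"
    by (intro power_mono matrix_norm_upper) auto
  moreover have "(\<Sum>j<n. blinfun_apply (T i j) (w j)) = (1 / sqrt s) *\<^sub>R (\<Sum>j<n. blinfun_apply (T i j) (v j))" for i
    by (simp add: w_def blinfun.scaleR_right scaleR_sum_right)
  then have "(norm (\<Sum>j<n. blinfun_apply (T i j) (w j)))\<^sup>2
      = (1 / s) * (norm (\<Sum>j<n. blinfun_apply (T i j) (v j)))\<^sup>2" for i
    using s by (simp add: power_mult_distrib power_divide)
  ultimately have "(1 / s) * (\<Sum>i<n. (norm (\<Sum>j<n. blinfun_apply (T i j) (v j)))\<^sup>2) \<le> (matrix_norm n T)\<^sup>2"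
    by (simp add: L2_set_sq sum_distrib_left)
  then show ?thesis using s by (simp add: field_simps flip: s_def)
qed

lemma matrix_norm_leI:
  assumes "0 \<le> C"
    and "\<And>v. (\<Sum>i<n. (norm (\<Sum>j<n. blinfun_apply (T i j) (v j)))\<^sup>2) \<le> C\<^sup>2 * (\<Sum>j<n. (norm (v j))\<^sup>2)"
  shows "matrix_norm n T \<le> C"
  unfolding matrix_norm_def
proof (rule cSup_least)
  show "{L2_set (\<lambda>i. norm (\<Sum>j<n. blinfun_apply (T i j) (v j))) {..<n} | v.
     L2_set (\<lambda>j. norm (v j)) {..<n} \<le> 1} \<noteq> {}"
    by (auto intro!: exI[of _ "\<lambda>_. 0"])
next
  fix x assume "x \<in> {L2_set (\<lambda>i. norm (\<Sum>j<n. blinfun_apply (T i j) (v j))) {..<n} | v.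
     L2_set (\<lambda>j. norm (v j)) {..<n} \<le> 1}"
  then obtain v where x: "x = L2_set (\<lambda>i. norm (\<Sum>j<n. blinfun_apply (T i j) (v j))) {..<n}"
    and v: "(\<Sum>j<n. (norm (v j))\<^sup>2) \<le> 1" by (auto simp: L2_set_le_one_iff)
  have "x\<^sup>2 \<le> C\<^sup>2 * (\<Sum>j<n. (norm (v j))\<^sup>2)" unfolding x L2_set_sq by (rule assms(2))
  also have "\<dots> \<le> C\<^sup>2" using v by (simp add: mult_left_le)
  finally show "x \<le> C" using assms(1) by (rule power2_le_imp_le)
qed

lemma matrix_norm_form:
  assumes "(\<Sum>j<n. (norm (v j))\<^sup>2) \<le> 1" and "(\<Sum>j<n. (norm (u j))\<^sup>2) \<le> 1"
  shows "(\<Sum>i<n. \<Sum>j<n. blinfun_apply (T i j) (v j) \<bullet> u i) \<le> matrix_norm n T"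
proof -
  let ?w = "\<lambda>i. \<Sum>j<n. blinfun_apply (T i j) (v j)"
  have "(\<Sum>i<n. \<Sum>j<n. blinfun_apply (T i j) (v j) \<bullet> u i) = (\<Sum>i<n. ?w i \<bullet> u i)"
    by (simp add: inner_sum_left)
  also have "\<dots> \<le> (\<Sum>i<n. \<bar>norm (?w i)\<bar> * \<bar>norm (u i)\<bar>)"
    using norm_cauchy_schwarz by (intro sum_mono) auto
  also have "\<dots> \<le> L2_set (\<lambda>i. norm (?w i)) {..<n} * L2_set (\<lambda>i. norm (u i)) {..<n}"
    by (rule L2_set_mult_ineq)
  also have "\<dots> \<le> matrix_norm n T * 1"
    using assms by (intro mult_mono matrix_norm_upper) (auto simp: L2_set_le_one_iff)
  finally show ?thesis by simp
qed

text \<open>Stated for the square, because sums of squared norms are what vector states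
  evaluate.\<close>

lemma matrix_norm_approx_sq:
  assumes "0 < e"
  obtains v where "(\<Sum>j<n. (norm (v j))\<^sup>2) \<le> 1"
    and "(matrix_norm n T)\<^sup>2 - e < (\<Sum>i<n. (norm (\<Sum>j<n. blinfun_apply (T i j) (v j)))\<^sup>2)"
proof -
  have "\<exists>v. (\<Sum>j<n. (norm (v j))\<^sup>2) \<le> 1 \<and>
    (matrix_norm n T)\<^sup>2 - e < (\<Sum>i<n. (norm (\<Sum>j<n. blinfun_apply (T i j) (v j)))\<^sup>2)"
  proof (rule ccontr)
    assume "\<not> ?thesis"
    then have le: "(\<Sum>i<n. (norm (\<Sum>j<n. blinfun_apply (T i j) (v j)))\<^sup>2) \<le> (matrix_norm n T)\<^sup>2 - e"
      if "(\<Sum>j<n. (norm (v j))\<^sup>2) \<le> 1" for v using that by (meson not_le)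
    have nn: "0 \<le> (matrix_norm n T)\<^sup>2 - e" using le[of "\<lambda>_. 0"] by simp
    have "matrix_norm n T \<le> sqrt ((matrix_norm n T)\<^sup>2 - e)"
    proof (subst matrix_norm_def, rule cSup_least)
      show "{L2_set (\<lambda>i. norm (\<Sum>j<n. blinfun_apply (T i j) (v j))) {..<n} | v.
         L2_set (\<lambda>j. norm (v j)) {..<n} \<le> 1} \<noteq> {}"
        by (auto intro!: exI[of _ "\<lambda>_. 0"])
    qed (auto simp: L2_set_le_one_iff L2_set_def intro!: le)
    then have "(matrix_norm n T)\<^sup>2 \<le> (matrix_norm n T)\<^sup>2 - e"
      using nn by (metis matrix_norm_nonneg power_mono real_sqrt_pow2)
    then show False using assms by simp
  qed
  then show thesis using that by blast
qed

lemma matrix_norm_approx_form: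
  assumes "0 < e"
  obtains v u where "(\<Sum>j<n. (norm (v j))\<^sup>2) \<le> 1" and "(\<Sum>j<n. (norm (u j))\<^sup>2) \<le> 1"
    and "matrix_norm n T - e < (\<Sum>i<n. \<Sum>j<n. blinfun_apply (T i j) (v j) \<bullet> u i)"
proof (cases "matrix_norm n T = 0")
  case True
  then show thesis using assms by (intro that[of "\<lambda>_. 0" "\<lambda>_. 0"]) auto
next
  case False
  \<comment> \<open>Capping the error at the norm keeps \<open>matrix_norm n T - d\<close>
    nonnegative. With error \<open>d * matrix_norm n T\<close> in the approximation of the square,
    the lower bound for \<open>s\<close> factors as
    \<open>(matrix_norm n T - d) * matrix_norm n T\<close>, so \<open>s\<close> is positive and may
    be divided by.\<close>
  define d where "d = min e (matrix_norm n T)"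
  have "0 < matrix_norm n T" using False matrix_norm_nonneg by linarith
  moreover from this have "0 < d" using assms by (simp add: d_def)
  ultimately have "0 < d * matrix_norm n T" by simp
  then obtain v where v: "(\<Sum>j<n. (norm (v j))\<^sup>2) \<le> 1" and
    gt: "(matrix_norm n T)\<^sup>2 - d * matrix_norm n T
      < (\<Sum>i<n. (norm (\<Sum>j<n. blinfun_apply (T i j) (v j)))\<^sup>2)" (is "_ < ?s")
    by (rule matrix_norm_approx_sq)
  define w where "w i = (\<Sum>j<n. blinfun_apply (T i j) (v j))" for i
  define s where "s = (\<Sum>i<n. (norm (w i))\<^sup>2)"
  have s0: "(matrix_norm n T - d) * matrix_norm n T < s"
    using gt by (simp add: s_def w_def power2_eq_square algebra_simps)
  moreover have "0 \<le> (matrix_norm n T - d) * matrix_norm n T" by (simp add: d_def)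
  ultimately have s: "0 < s" by linarith
  have sm: "sqrt s \<le> matrix_norm n T"
    using matrix_norm_upper[OF v] by (simp add: s_def w_def L2_set_def)
  define u where "u i = (1 / sqrt s) *\<^sub>R w i" for i
  have nu: "(norm (u j))\<^sup>2 = (1 / s) * (norm (w j))\<^sup>2" for j
    using s by (simp add: u_def power_mult_distrib power_divide)
  have "(\<Sum>j<n. (norm (u j))\<^sup>2) \<le> 1"
    unfolding nu sum_distrib_left[symmetric] using s by (simp flip: s_def)
  moreover have "(\<Sum>i<n. \<Sum>j<n. blinfun_apply (T i j) (v j) \<bullet> u i) = (\<Sum>i<n. w i \<bullet> u i)"
    by (simp add: inner_sum_left w_def)
  moreover have "(\<Sum>i<n. w i \<bullet> u i) = (1 / sqrt s) * s"
    by (simp add: u_def s_def sum_distrib_left power2_norm_eq_inner)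
  moreover have "(1 / sqrt s) * s = sqrt s" using s by (simp add: real_div_sqrt)
  moreover have "matrix_norm n T - e < sqrt s"
  proof -
    have "(matrix_norm n T - d) * sqrt s \<le> (matrix_norm n T - d) * matrix_norm n T"
      using sm by (intro mult_left_mono) (auto simp: d_def)
    also have "\<dots> < sqrt s * sqrt s" using s0 s by simp
    finally have "matrix_norm n T - d < sqrt s" by (rule mult_right_less_imp_less) (use s in simp)
    then show ?thesis by (simp add: d_def)
  qed
  ultimately show thesis using v that by simp
qed

end

lemma matrix_norm_cong:
  assumes "\<And>i j. i < n \<Longrightarrow> j < n \<Longrightarrow> S i j = T i j"
  shows "matrix_norm n S = matrix_norm n T"
proof -
  have "(\<Sum>j<n. blinfun_apply (S i j) (v j)) = (\<Sum>j<n. blinfun_apply (T i j) (v j))" if "i < n" for i v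
    using assms that by (intro sum.cong) auto
  then show ?thesis
    unfolding matrix_norm_def
    by (intro arg_cong[where f = Sup] Collect_cong ex_cong1 conj_cong refl arg_cong2[where f = "(=)"] L2_set_cong) auto
qed

lemma matrix_norm_one: "matrix_norm 1 T = norm (T 0 0)"
proof (rule antisym)
  show "matrix_norm 1 T \<le> norm (T 0 0)"
  proof (rule matrix_norm_leI)
    show "(\<Sum>i<1. (norm (\<Sum>j<1. blinfun_apply (T i j) (v j)))\<^sup>2)
      \<le> (norm (T 0 0))\<^sup>2 * (\<Sum>j<1. (norm (v j))\<^sup>2)" for v
      using power_mono[OF norm_blinfun[of "T 0 0" "v 0"], of 2] by (simp add: power_mult_distrib)
  qed simp
  show "norm (T 0 0) \<le> matrix_norm 1 T"
  proof (rule norm_blinfun_bound)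
    fix x
    have "(norm (blinfun_apply (T 0 0) x))\<^sup>2 \<le> (matrix_norm 1 T * norm x)\<^sup>2"
      using matrix_norm_bound[where n = 1 and T = T and v = "\<lambda>_. x"] by (simp add: power_mult_distrib)
    then show "norm (blinfun_apply (T 0 0) x) \<le> matrix_norm 1 T * norm x"
      by (rule power2_le_imp_le) simp
  qed simp
qed

lemma tuple_sequence_in_dense:
  fixes z :: "nat \<Rightarrow> 'e::metric_space"
  assumes "closure Z = UNIV"
  obtains a where "\<And>r l. a r l \<in> Z" and "\<And>l. (\<lambda>r. a r l) \<longlonglongrightarrow> z l"
proof -
  have "\<forall>l. \<exists>b. (\<forall>r. b r \<in> Z) \<and> b \<longlonglongrightarrow> z l"
    using assms unfolding closure_sequential[symmetric] by auto
  then obtain b where "\<And>l r. b l r \<in> Z" "\<And>l. b l \<longlonglongrightarrow> z l" by metis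
  then show thesis by (intro that[of "\<lambda>r l. b l r"])
qed

lemma matrix_norm_leI_dense:
  assumes "0 \<le> C" and "closure Z = UNIV"
    and "\<And>v. (\<And>j. v j \<in> Z) \<Longrightarrow>
      (\<Sum>i<n. (norm (\<Sum>j<n. blinfun_apply (T i j) (v j)))\<^sup>2) \<le> C\<^sup>2 * (\<Sum>j<n. (norm (v j))\<^sup>2)"
  shows "matrix_norm n T \<le> C"
proof (rule matrix_norm_leI[OF assms(1)])
  fix v :: "nat \<Rightarrow> 'a"
  obtain a where a: "\<And>r l. a r l \<in> Z" "\<And>l. (\<lambda>r. a r l) \<longlonglongrightarrow> v l"
    by (rule tuple_sequence_in_dense[OF assms(2), of v]) blast
  show "(\<Sum>i<n. (norm (\<Sum>j<n. blinfun_apply (T i j) (v j)))\<^sup>2) \<le> C\<^sup>2 * (\<Sum>j<n. (norm (v j))\<^sup>2)"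
  proof (rule LIMSEQ_le)
    show "(\<lambda>r. \<Sum>i<n. (norm (\<Sum>j<n. blinfun_apply (T i j) (a r j)))\<^sup>2)
      \<longlonglongrightarrow> (\<Sum>i<n. (norm (\<Sum>j<n. blinfun_apply (T i j) (v j)))\<^sup>2)"
      by (intro tendsto_intros a)
    show "(\<lambda>r. C\<^sup>2 * (\<Sum>j<n. (norm (a r j))\<^sup>2)) \<longlonglongrightarrow> C\<^sup>2 * (\<Sum>j<n. (norm (v j))\<^sup>2)"
      by (intro tendsto_intros a)
  qed (use assms(3) a(1) in blast)
qed

text \<open>The additive hypothesis is what domination by a pair of states delivers. It loses
  nothing, because rescaling the vectors turns it into a bound by the product of the norms;
  continuity extends it from the dense sets to all tuples.\<close>

lemma matrix_norm_leI_form: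
  assumes C: "0 \<le> C" and Z: "closure Z = UNIV" and Y: "closure Y = UNIV"
    and le: "\<And>v u. (\<And>j. v j \<in> Z) \<Longrightarrow> (\<And>i. u i \<in> Y) \<Longrightarrow>
      2 * (\<Sum>i<n. \<Sum>j<n. blinfun_apply (T i j) (v j) \<bullet> u i)
        \<le> C * ((\<Sum>j<n. (norm (v j))\<^sup>2) + (\<Sum>i<n. (norm (u i))\<^sup>2))"
  shows "matrix_norm n T \<le> C"
proof (rule matrix_norm_leI[OF C])
  have all: "2 * (\<Sum>i<n. \<Sum>j<n. blinfun_apply (T i j) (v j) \<bullet> u i)
        \<le> C * ((\<Sum>j<n. (norm (v j))\<^sup>2) + (\<Sum>i<n. (norm (u i))\<^sup>2))" for v u
  proof -
    obtain a where a: "\<And>r l. a r l \<in> Z" "\<And>l. (\<lambda>r. a r l) \<longlonglongrightarrow> v l"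
      using tuple_sequence_in_dense[OF Z] by metis
    obtain b where b: "\<And>r l. b r l \<in> Y" "\<And>l. (\<lambda>r. b r l) \<longlonglongrightarrow> u l"
      using tuple_sequence_in_dense[OF Y] by metis
    show ?thesis
    proof (rule LIMSEQ_le)
      show "(\<lambda>r. 2 * (\<Sum>i<n. \<Sum>j<n. blinfun_apply (T i j) (a r j) \<bullet> b r i))
        \<longlonglongrightarrow> 2 * (\<Sum>i<n. \<Sum>j<n. blinfun_apply (T i j) (v j) \<bullet> u i)"
        by (intro tendsto_intros a b)
      show "(\<lambda>r. C * ((\<Sum>j<n. (norm (a r j))\<^sup>2) + (\<Sum>i<n. (norm (b r i))\<^sup>2)))
        \<longlonglongrightarrow> C * ((\<Sum>j<n. (norm (v j))\<^sup>2) + (\<Sum>i<n. (norm (u i))\<^sup>2))"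
        by (intro tendsto_intros a b)
    qed (use le a(1) b(1) in blast)
  qed
  fix v
  define w where "w i = (\<Sum>j<n. blinfun_apply (T i j) (v j))" for i
  define S where "S = (\<Sum>i<n. (norm (w i))\<^sup>2)"
  define V where "V = (\<Sum>j<n. (norm (v j))\<^sup>2)"
  have eq: "(\<Sum>i<n. \<Sum>j<n. blinfun_apply (T i j) (v j) \<bullet> w i) = S"
    by (simp add: S_def w_def power2_norm_eq_inner inner_sum_left)
  have "S \<le> C\<^sup>2 * V"
  proof (cases "C = 0")
    case True
    then show ?thesis using all[of v w] unfolding eq by simp
  next
    case False
    \<comment> \<open>The form is tested on \<open>C *\<^sub>R v\<close> against the image
      \<open>w\<close> itself. After cancelling \<open>C\<close>, the term \<open>S\<close> on the
      right absorbs half of the left-hand side.\<close>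
    have "2 * (C * S) \<le> C * (C\<^sup>2 * V + S)"
      using all[of "\<lambda>j. C *\<^sub>R v j" w] eq
      by (simp add: blinfun.scaleR_right power_mult_distrib S_def V_def flip: sum_distrib_left)
    then have "C * (2 * S) \<le> C * (C\<^sup>2 * V + S)" by (simp add: algebra_simps)
    then have "2 * S \<le> C\<^sup>2 * V + S" using False C by (simp add: mult_le_cancel_left)
    then show ?thesis by simp
  qed
  then show "(\<Sum>i<n. (norm (\<Sum>j<n. blinfun_apply (T i j) (v j)))\<^sup>2) \<le> C\<^sup>2 * (\<Sum>j<n. (norm (v j))\<^sup>2)"
    by (simp add: S_def V_def w_def)
qed

text \<open>The indices are exchanged, as in the adjoint of an operator matrix. The inequality is
  enough for equality, since the operation is an involution.\<close>

lemma matrix_norm_adj_le: "matrix_norm n (\<lambda>i j. adj (T j i)) \<le> matrix_norm n T"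
proof (rule matrix_norm_leI_form[OF matrix_norm_nonneg closure_UNIV closure_UNIV])
  fix v u
  have two: "2 * (s * t) \<le> s\<^sup>2 + t\<^sup>2" for s t :: real
    using sum_squares_bound[of s t] by simp
  have "(\<Sum>i<n. \<Sum>j<n. blinfun_apply (adj (T j i)) (v j) \<bullet> u i)
      = (\<Sum>j<n. \<Sum>i<n. v j \<bullet> blinfun_apply (T j i) (u i))"
    by (subst sum.swap) (simp add: adj_left)
  also have "\<dots> = (\<Sum>j<n. v j \<bullet> (\<Sum>i<n. blinfun_apply (T j i) (u i)))"
    by (simp add: inner_sum_right)
  also have "\<dots> \<le> (\<Sum>j<n. \<bar>norm (v j)\<bar> * \<bar>norm (\<Sum>i<n. blinfun_apply (T j i) (u i))\<bar>)"
    using norm_cauchy_schwarz by (intro sum_mono) auto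
  also have "\<dots> \<le> L2_set (\<lambda>j. norm (v j)) {..<n} * L2_set (\<lambda>j. norm (\<Sum>i<n. blinfun_apply (T j i) (u i))) {..<n}"
    by (rule L2_set_mult_ineq)
  also have "\<dots> \<le> L2_set (\<lambda>j. norm (v j)) {..<n} * (matrix_norm n T * L2_set (\<lambda>j. norm (u j)) {..<n})"
  proof (intro mult_left_mono)
    have "(L2_set (\<lambda>j. norm (\<Sum>i<n. blinfun_apply (T j i) (u i))) {..<n})\<^sup>2
      \<le> (matrix_norm n T * L2_set (\<lambda>j. norm (u j)) {..<n})\<^sup>2"
      unfolding power_mult_distrib L2_set_sq by (rule matrix_norm_bound)
    then show "L2_set (\<lambda>j. norm (\<Sum>i<n. blinfun_apply (T j i) (u i))) {..<n}
      \<le> matrix_norm n T * L2_set (\<lambda>j. norm (u j)) {..<n}"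
      by (rule power2_le_imp_le) simp
  qed simp
  finally have "2 * (\<Sum>i<n. \<Sum>j<n. blinfun_apply (adj (T j i)) (v j) \<bullet> u i)
    \<le> matrix_norm n T * (2 * (L2_set (\<lambda>j. norm (v j)) {..<n} * L2_set (\<lambda>j. norm (u j)) {..<n}))"
    by (simp add: algebra_simps)
  also have "\<dots> \<le> matrix_norm n T * ((L2_set (\<lambda>j. norm (v j)) {..<n})\<^sup>2 + (L2_set (\<lambda>j. norm (u j)) {..<n})\<^sup>2)"
    by (intro mult_left_mono two) simp
  finally show "2 * (\<Sum>i<n. \<Sum>j<n. blinfun_apply (adj (T j i)) (v j) \<bullet> u i)
        \<le> matrix_norm n T * ((\<Sum>j<n. (norm (v j))\<^sup>2) + (\<Sum>i<n. (norm (u i))\<^sup>2))"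
    by (simp add: L2_set_sq)
qed

lemma matrix_norm_adj: "matrix_norm n (\<lambda>i j. adj (T j i)) = matrix_norm n T"
  using matrix_norm_adj_le[of n T] matrix_norm_adj_le[of n "\<lambda>i j. adj (T j i)"] by simp

lemma matrix_norm_scaleR_le: "matrix_norm n (\<lambda>i j. c *\<^sub>R T i j) \<le> \<bar>c\<bar> * matrix_norm n T"
proof (rule matrix_norm_leI)
  fix v
  have "(\<Sum>i<n. (norm (\<Sum>j<n. blinfun_apply (c *\<^sub>R T i j) (v j)))\<^sup>2)
    = c\<^sup>2 * (\<Sum>i<n. (norm (\<Sum>j<n. blinfun_apply (T i j) (v j)))\<^sup>2)"
    by (simp add: blinfun.scaleR_left power_mult_distrib sum_distrib_left flip: scaleR_sum_right)
  also have "\<dots> \<le> c\<^sup>2 * ((matrix_norm n T)\<^sup>2 * (\<Sum>j<n. (norm (v j))\<^sup>2))"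
    by (intro mult_left_mono matrix_norm_bound) simp
  finally show "(\<Sum>i<n. (norm (\<Sum>j<n. blinfun_apply (c *\<^sub>R T i j) (v j)))\<^sup>2)
      \<le> (\<bar>c\<bar> * matrix_norm n T)\<^sup>2 * (\<Sum>j<n. (norm (v j))\<^sup>2)"
    by (simp add: power_mult_distrib mult.assoc)
qed simp

text \<open>Used to add two domination inequalities in the minimax argument: their matrices over
  \<open>X\<close> are placed in diagonal blocks, and the common bound is 1.\<close>

lemma matrix_norm_block_diag:
  assumes "0 \<le> C" and "matrix_norm m S \<le> C" and "matrix_norm k T \<le> C"
  shows "matrix_norm (m + k)
    (\<lambda>i j. if i < m \<and> j < m then S i j else if m \<le> i \<and> m \<le> j then T (i - m) (j - m) else 0) \<le> C"
    (is "matrix_norm _ ?D \<le> C")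
proof (rule matrix_norm_leI[OF assms(1)])
  fix v
  have 1: "(\<Sum>j<m + k. blinfun_apply (?D i j) (v j)) = (\<Sum>j<m. blinfun_apply (S i j) (v j))" if "i < m" for i
    using that by (simp add: sum_lessThan_add)
  have 2: "(\<Sum>j<m + k. blinfun_apply (?D (m + i) j) (v j)) = (\<Sum>j<k. blinfun_apply (T i j) (v (m + j)))" for i
    by (simp add: sum_lessThan_add)
  have "(\<Sum>i<m. (norm (\<Sum>j<m. blinfun_apply (S i j) (v j)))\<^sup>2) \<le> C\<^sup>2 * (\<Sum>j<m. (norm (v j))\<^sup>2)"
    by (rule order_trans[OF matrix_norm_bound])
      (intro mult_right_mono power_mono assms matrix_norm_nonneg sum_nonneg zero_le_power2)
  moreover have "(\<Sum>i<k. (norm (\<Sum>j<k. blinfun_apply (T i j) (v (m + j))))\<^sup>2) \<le> C\<^sup>2 * (\<Sum>j<k. (norm (v (m + j)))\<^sup>2)"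
    by (rule order_trans[OF matrix_norm_bound])
      (intro mult_right_mono power_mono assms matrix_norm_nonneg sum_nonneg zero_le_power2)
  moreover have "(\<Sum>i<m + k. (norm (\<Sum>j<m + k. blinfun_apply (?D i j) (v j)))\<^sup>2)
    = (\<Sum>i<m. (norm (\<Sum>j<m. blinfun_apply (S i j) (v j)))\<^sup>2)
      + (\<Sum>i<k. (norm (\<Sum>j<k. blinfun_apply (T i j) (v (m + j))))\<^sup>2)"
    unfolding sum_lessThan_add[of _ m k, of "\<lambda>i. (norm (\<Sum>j<m + k. blinfun_apply (?D i j) (v j)))\<^sup>2"] 2
    by (intro arg_cong2[where f = "(+)"] sum.cong refl)
      (subst 1, simp_all only: lessThan_iff)
  ultimately show "(\<Sum>i<m + k. (norm (\<Sum>j<m + k. blinfun_apply (?D i j) (v j)))\<^sup>2) \<le> C\<^sup>2 * (\<Sum>j<m + k. (norm (v j))\<^sup>2)"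
    unfolding sum_lessThan_add[of "\<lambda>j. (norm (v j))\<^sup>2"] by (simp add: distrib_left)
qed

text \<open>The inequality for the actions concerns square matrices of one size, while rows come in
  rectangular stacks; padding with zeros brings everything to a common size.\<close>

lemma matrix_norm_pad:
  assumes "m \<le> N"
  shows "matrix_norm N (\<lambda>i j. if i < m \<and> j < m then T i j else 0) \<le> matrix_norm m T"
proof -
  obtain k where k: "N = m + k" using assms le_Suc_ex by blast
  have "matrix_norm k (\<lambda>i j. 0 :: 'a \<Rightarrow>\<^sub>L 'b) \<le> 0" by (rule matrix_norm_leI) auto
  then have "matrix_norm k (\<lambda>i j. 0 :: 'a \<Rightarrow>\<^sub>L 'b) \<le> matrix_norm m T"
    using matrix_norm_nonneg[of m T] by linarith
  then have "matrix_norm (m + k) (\<lambda>i j. if i < m \<and> j < m then T i j else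
      if m \<le> i \<and> m \<le> j then (0 :: 'a \<Rightarrow>\<^sub>L 'b) else 0) \<le> matrix_norm m T"
    by (intro matrix_norm_block_diag[where T = "\<lambda>i j. 0"]) auto
  then show ?thesis by (simp add: k if_distrib cong: if_cong)
qed

section \<open>Coordinates and reindexing\<close>

definition unit_ell2 :: "'i \<Rightarrow> 'i ell2"
  where "unit_ell2 d = Abs_ell2 (\<lambda>i. if i = d then 1 else 0)"

lemma coord_unit: "coord (unit_ell2 d) i = (if i = d then 1 else 0)"
proof -
  have "(\<lambda>i. (if i = d then 1 else 0 :: real)\<^sup>2) summable_on UNIV \<longleftrightarrow>
      (\<lambda>i. (if i = d then 1 else 0 :: real)\<^sup>2) summable_on {d}"
    by (rule summable_on_cong_neutral) auto
  then show ?thesis by (simp add: unit_ell2_def Abs_ell2_inverse)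
qed

lemma inner_unit: "z \<bullet> unit_ell2 d = coord z d"
proof -
  have "z \<bullet> unit_ell2 d = (\<Sum>\<^sub>\<infinity>i\<in>{d}. coord z i * coord (unit_ell2 d) i)"
    unfolding inner_ell2_def by (rule infsum_cong_neutral) (auto simp: coord_unit)
  then show ?thesis by (simp add: coord_unit)
qed

lemma closed_supported: "closed {z. \<forall>i. i \<notin> U \<longrightarrow> coord z i = 0}"
  unfolding inner_unit[symmetric]
  by (intro closed_Collect_all closed_Collect_imp closed_Collect_eq continuous_intros) auto

lemma subspace_supported: "subspace {z. \<forall>i. i \<notin> U \<longrightarrow> coord z i = 0}"
  by (intro subspaceI) auto

lemma supported_closure_span:
  assumes "\<And>s i. s \<in> S \<Longrightarrow> coord s i \<noteq> 0 \<Longrightarrow> i \<in> U" and "y \<in> closure (span S)" and "coord y i \<noteq> 0"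
  shows "i \<in> U"
proof -
  have "span S \<subseteq> {z. \<forall>i. i \<notin> U \<longrightarrow> coord z i = 0}"
    using assms(1) by (intro span_minimal subspace_supported) auto
  then have "closure (span S) \<subseteq> {z. \<forall>i. i \<notin> U \<longrightarrow> coord z i = 0}"
    by (intro closure_minimal closed_supported)
  then show ?thesis using assms(2,3) by auto
qed

text \<open>For injective \<open>a\<close> this is a coisometry: its adjoint is the isometric
  embedding that places coordinate \<open>i\<close> at position \<open>a i\<close>. All lemmas about
  it assume injectivity.\<close>

definition reindex :: "('i \<Rightarrow> 'd) \<Rightarrow> ('d ell2 \<Rightarrow>\<^sub>L 'i ell2)"
  where "reindex a = Blinfun (\<lambda>z. Abs_ell2 (\<lambda>i. coord z (a i)))"

lemma coord_reindex:
  assumes "inj a"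
  shows "coord (blinfun_apply (reindex a) z) i = coord z (a i)"
proof -
  have le: "(\<Sum>i\<in>F. (coord z (a i))\<^sup>2) \<le> (norm z)\<^sup>2" if "finite F" for F z
  proof -
    have "inj_on a F" using assms by (rule inj_on_subset) simp
    then have "(\<Sum>i\<in>F. (coord z (a i))\<^sup>2) = (\<Sum>i\<in>a ` F. (coord z i)\<^sup>2)"
      by (simp add: sum.reindex)
    also have "\<dots> \<le> (norm z)\<^sup>2" by (rule sum_sq_le_norm_ell2) (use that in simp)
    finally show ?thesis .
  qed
  have "\<exists>f. (\<forall>i. coord f i = coord z (a i)) \<and> norm f \<le> norm z" for z
    using ell2_of_bounded_sums[of "\<lambda>i. coord z (a i)" "norm z"] le by (metis norm_ge_zero)
  then obtain f where f: "\<And>z i. coord (f z) i = coord z (a i)" "\<And>z. norm (f z) \<le> norm z" by metis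
  have "f = (\<lambda>z. Abs_ell2 (\<lambda>i. coord z (a i)))"
    by (rule ext) (simp add: f(1)[symmetric] coord_inverse)
  then have "reindex a = Blinfun f" by (simp add: reindex_def)
  moreover have "bounded_linear f"
    by (rule bounded_linear_intro[of _ 1]) (auto intro!: ell2_eqI simp: f)
  ultimately show ?thesis by (simp add: bounded_linear_Blinfun_apply f)
qed

lemma coord_adj_reindex_other:
  assumes "inj a" and "d \<notin> range a"
  shows "coord (blinfun_apply (adj (reindex a)) y) d = 0"
proof -
  have "blinfun_apply (reindex a) (unit_ell2 d) = 0"
    using assms by (intro ell2_eqI) (auto simp: coord_reindex coord_unit)
  then show ?thesis by (simp add: adj_left flip: inner_unit)
qed

lemma coord_adj_reindex:
  assumes "inj a"
  shows "coord (blinfun_apply (adj (reindex a)) y) (a i) = coord y i"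
proof -
  have "blinfun_apply (reindex a) (unit_ell2 (a i)) = unit_ell2 i"
    using assms by (intro ell2_eqI) (auto simp: coord_reindex coord_unit inj_eq)
  then have "blinfun_apply (adj (reindex a)) y \<bullet> unit_ell2 (a i) = y \<bullet> unit_ell2 i"
    by (simp add: adj_left)
  then show ?thesis by (simp add: inner_unit)
qed

lemma reindex_adj:
  assumes "inj a"
  shows "blinfun_apply (reindex a) (blinfun_apply (adj (reindex a)) y) = y"
  by (rule ell2_eqI) (simp add: coord_reindex coord_adj_reindex assms)

lemma reindex_adj_disjoint:
  assumes "inj a" and "inj b" and "range a \<inter> range b = {}"
  shows "blinfun_apply (reindex a) (blinfun_apply (adj (reindex b)) y) = 0"
  using assms by (intro ell2_eqI) (auto simp: coord_reindex intro!: coord_adj_reindex_other)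

lemma adj_reindex:
  assumes "inj a" and "\<And>d. d \<notin> range a \<Longrightarrow> coord z d = 0"
  shows "blinfun_apply (adj (reindex a)) (blinfun_apply (reindex a) z) = z"
proof (rule ell2_eqI)
  fix d
  show "coord (blinfun_apply (adj (reindex a)) (blinfun_apply (reindex a) z)) d = coord z d"
  proof (cases "d \<in> range a")
    case True
    then show ?thesis using assms(1) by (auto simp: coord_adj_reindex coord_reindex)
  next
    case False
    then show ?thesis using assms by (simp add: coord_adj_reindex_other)
  qed
qed

section \<open>Vectors with a prescribed Gram kernel\<close>

lemma discriminant_le:
  fixes a b q :: real
  assumes "\<And>s. 0 \<le> a - 2 * s * b + s\<^sup>2 * q" and "0 \<le> q"
  shows "b\<^sup>2 \<le> a * q"
proof (cases "q = 0")
  case True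
  have "b = 0"
  proof (rule ccontr)
    assume "b \<noteq> 0"
    \<comment> \<open>With \<open>q = 0\<close> this choice of \<open>s\<close> makes the quadratic
      expression equal to \<open>- 1\<close>.\<close>
    then show False using assms(1)[of "(a + 1) / (2 * b)"] True by simp
  qed
  then show ?thesis by (simp add: True)
next
  case False
  then have q: "0 < q" using assms(2) by simp
  have "0 \<le> a - 2 * (b / q) * b + (b / q)\<^sup>2 * q" by (rule assms(1))
  also have "\<dots> = a - b\<^sup>2 / q" using q by (simp add: power2_eq_square field_simps)
  finally show ?thesis using q by (simp add: field_simps)
qed

text \<open>The coefficients are indexed by \<open>S\<close> and not by the image, because
  \<open>g\<close> may identify indices. The kernel is later evaluated at indices, so a
  representation by distinct vectors would not do.\<close>

lemma span_image_explicit: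
  assumes "x \<in> span (g ` S)"
  obtains t u where "finite t" and "t \<subseteq> S" and "x = (\<Sum>e\<in>t. u e *\<^sub>R g e)"
proof -
  have "\<exists>t u. finite t \<and> t \<subseteq> S \<and> x = (\<Sum>e\<in>t. u e *\<^sub>R g e)"
    using assms
  proof (induction rule: span_induct_alt)
    case base
    show ?case by (intro exI[of _ "{}"]) simp
  next
    case (step c y x)
    then obtain t u e where t: "finite t" "t \<subseteq> S" "x = (\<Sum>e\<in>t. u e *\<^sub>R g e)" and e: "e \<in> S" "y = g e"
      by blast
    define u' where "u' i = (if i \<in> t then u i else 0) + (if i = e then c else 0)" for i
    have "(\<Sum>i\<in>insert e t. u' i *\<^sub>R g i) =
        (\<Sum>i\<in>insert e t. (if i \<in> t then u i *\<^sub>R g i else 0)) + (\<Sum>i\<in>insert e t. (if i = e then c *\<^sub>R g i else 0))"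
      by (simp only: sum.distrib[symmetric])
        (intro sum.cong, auto simp: u'_def scaleR_add_left)
    also have "(\<Sum>i\<in>insert e t. (if i \<in> t then u i *\<^sub>R g i else 0)) = x"
      unfolding t(3) by (rule sum.mono_neutral_cong_right) (use t(1) in auto)
    also have "(\<Sum>i\<in>insert e t. (if i = e then c *\<^sub>R g i else 0)) = c *\<^sub>R y"
      using t(1) e by (simp add: sum.delta)
    finally have "c *\<^sub>R y + x = (\<Sum>i\<in>insert e t. u' i *\<^sub>R g i)" by (simp add: add.commute)
    then show ?case using t e by (intro exI[of _ "insert e t"] exI[of _ u']) auto
  qed
  then show thesis using that by blast
qed

text \<open>
  Gram-Schmidt orthogonalisation along a well-order of the index set: the vector of an index is
  the sum of a vector in the closed span of its predecessors and of a multiple of its own unit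
  vector.
\<close>

lemma gram_schmidt:
  fixes k :: "'d \<Rightarrow> 'd \<Rightarrow> real"
  assumes sym: "\<And>d e. k d e = k e d"
    and psd: "\<And>T c. finite T \<Longrightarrow> 0 \<le> (\<Sum>d\<in>T. \<Sum>e\<in>T. c d * c e * k d e)"
  obtains \<phi> :: "'d \<Rightarrow> 'd ell2" and R where
    "wf R"
    and "\<And>d e. \<phi> d \<bullet> \<phi> e = k d e"
    and "\<And>d. \<phi> d - coord (\<phi> d) d *\<^sub>R unit_ell2 d \<in> closure (span (\<phi> ` {e. (e, d) \<in> R}))"
proof -
  obtain r :: "('d \<times> 'd) set" where r: "well_order_on UNIV r" using well_order_on by blast
  define R where "R = r - Id"
  have wf: "wf R" using r by (simp add: well_order_on_def R_def)
  have tr: "trans r" and as: "antisym r" and tot: "total_on UNIV r" and rfl: "refl_on UNIV r"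
    using r by (auto simp: well_order_on_def linear_order_on_def partial_order_on_def preorder_on_def)
  \<comment> \<open>The support condition makes \<open>unit_ell2 d\<close> orthogonal to all earlier
    vectors, so its coefficient can correct the norm without disturbing the inner products with
    them.\<close>
  define P where "P f d z \<longleftrightarrow> (\<forall>e. (e, d) \<in> R \<longrightarrow> f e \<bullet> z = k e d) \<and> z \<bullet> z = k d d \<and>
      (\<forall>i. coord z i \<noteq> 0 \<longrightarrow> (i, d) \<in> r) \<and>
      z - coord z d *\<^sub>R unit_ell2 d \<in> closure (span (f ` {e. (e, d) \<in> R}))"
    for f :: "'d \<Rightarrow> 'd ell2" and d z
  have "\<exists>f. \<forall>d. P f d (f d)"
  proof (rule dependent_wf_choice[OF wf])
    fix f g :: "'d \<Rightarrow> 'd ell2" and d z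
    assume eq: "\<And>e. (e, d) \<in> R \<Longrightarrow> f e = g e"
    then have "f ` {e. (e, d) \<in> R} = g ` {e. (e, d) \<in> R}" by (intro image_cong) auto
    then show "P f d z = P g d z" using eq by (simp add: P_def)
  next
    fix d and f :: "'d \<Rightarrow> 'd ell2"
    assume IH: "\<And>e. (e, d) \<in> R \<Longrightarrow> P f e (f e)"
    let ?L = "{e. (e, d) \<in> R}"
    have kf: "f e \<bullet> f e' = k e e'" if "e \<in> ?L" "e' \<in> ?L" for e e'
    proof -
      consider "e = e'" | "(e, e') \<in> R" | "(e', e) \<in> R"
        using tot by (auto simp: total_on_def R_def)
      then show ?thesis
        using IH[of e] IH[of e'] that by cases (auto simp: P_def inner_commute sym)
    qed
    have supp: "(i, d) \<in> R" if "(e, d) \<in> R" "coord (f e) i \<noteq> 0" for e i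
    proof -
      have "(i, e) \<in> r" using IH[OF that(1)] that(2) by (simp add: P_def)
      then show ?thesis using that(1) tr as unfolding R_def
        by (metis Diff_iff IdE IdI antisymD transD pair_in_Id_conv)
    qed
    define G where "G = span ((\<lambda>e. (f e, k e d)) ` ?L)"
    have Gs: "subspace G" unfolding G_def by (rule subspace_span)
    have fstG: "fst ` G = span (f ` ?L)"
      unfolding G_def
      by (simp add: linear_span_image[OF bounded_linear.linear[OF bounded_linear_fst], symmetric] image_image)
    have kd: "0 \<le> k d d" using psd[of "{d}" "\<lambda>_. 1"] by simp
    \<comment> \<open>Positivity of the kernel, tested on the coefficients \<open>u\<close> with the
      additional coefficient \<open>- q\<close> at \<open>d\<close>, is a nonnegative quadratic in
      \<open>q\<close>; its discriminant is the bound.\<close>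
    have bnd: "\<bar>s\<bar> \<le> sqrt (k d d) * norm z" if zsG: "(z, s) \<in> G" for z s
    proof -
      obtain t u where t: "finite t" "t \<subseteq> ?L" and zs: "(z, s) = (\<Sum>e\<in>t. u e *\<^sub>R (f e, k e d))"
        by (rule span_image_explicit[OF zsG[unfolded G_def]])
      have z: "z = (\<Sum>e\<in>t. u e *\<^sub>R f e)" and s: "s = (\<Sum>e\<in>t. u e * k e d)"
        using arg_cong[OF zs, of fst] arg_cong[OF zs, of snd] by (simp_all add: fst_sum snd_sum)
      have nz: "(norm z)\<^sup>2 = (\<Sum>e\<in>t. \<Sum>e'\<in>t. u e * u e' * k e e')"
        unfolding power2_norm_eq_inner z inner_sum_left inner_sum_right
        using t(2) kf by (intro sum.cong refl) (auto simp: subset_iff sym)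
      have dt: "d \<notin> t" using t(2) by (auto simp: R_def)
      have "0 \<le> (norm z)\<^sup>2 - 2 * q * s + q\<^sup>2 * k d d" for q
      proof -
        define c where "c e = (if e = d then - q else u e)" for e
        have ct: "c e = u e" if "e \<in> t" for e using that dt by (auto simp: c_def)
        have cd: "c d = - q" by (simp add: c_def)
        have "0 \<le> (\<Sum>e\<in>insert d t. \<Sum>e'\<in>insert d t. c e * c e' * k e e')"
          using t(1) by (intro psd) simp
        also have "\<dots> = q\<^sup>2 * k d d + (\<Sum>e'\<in>t. - q * u e' * k d e')
            + (\<Sum>e\<in>t. u e * (- q) * k e d + (\<Sum>e'\<in>t. u e * u e' * k e e'))"
          using t(1) dt by (simp add: ct cd power2_eq_square cong: sum.cong)
        also have "\<dots> = (norm z)\<^sup>2 - 2 * q * s + q\<^sup>2 * k d d"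
        proof -
          have "(\<Sum>e'\<in>t. - q * u e' * k d e') = (\<Sum>e'\<in>t. - q * (u e' * k e' d))"
          proof (rule sum.cong[OF refl])
            show "- q * u e' * k d e' = - q * (u e' * k e' d)" for e' using sym[of d e'] by simp
          qed
          moreover have "(\<Sum>e\<in>t. u e * (- q) * k e d) = (\<Sum>e\<in>t. - q * (u e * k e d))"
            by (intro sum.cong refl) simp
          ultimately show ?thesis
            unfolding sum.distrib nz[symmetric] by (simp only: sum_distrib_left[symmetric] s[symmetric])
        qed
        finally show ?thesis .
      qed
      then have "s\<^sup>2 \<le> (norm z)\<^sup>2 * k d d" using kd by (rule discriminant_le)
      then have "\<bar>s\<bar>\<^sup>2 \<le> (sqrt (k d d) * norm z)\<^sup>2"
        using kd by (simp add: power_mult_distrib mult.commute)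
      then show ?thesis by (rule power2_le_imp_le) (use kd in simp)
    qed
    \<comment> \<open>\<open>y\<close> is to be the projection of the vector of \<open>d\<close>
      onto the closed span of its predecessors.\<close>
    obtain y where y: "y \<in> closure (fst ` G)" and yG: "\<And>z s. (z, s) \<in> G \<Longrightarrow> y \<bullet> z = s"
      by (rule riesz_graph[OF Gs bnd]) blast+
    have ycl: "y \<in> closure (span (f ` ?L))" using y by (simp add: fstG)
    have ysupp: "(i, d) \<in> R" if "coord y i \<noteq> 0" for i
    proof -
      have "i \<in> {i. (i, d) \<in> R}"
        by (rule supported_closure_span[OF _ ycl that]) (auto intro: supp)
      then show ?thesis by simp
    qed
    have yd: "coord y d = 0" using ysupp[of d] by (auto simp: R_def)
    have "y \<in> {z. \<bar>y \<bullet> z\<bar> \<le> sqrt (k d d) * norm z}"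
    proof -
      have "closed {z. \<bar>y \<bullet> z\<bar> \<le> sqrt (k d d) * norm z}"
        by (intro closed_Collect_le continuous_intros)
      then have "closure (fst ` G) \<subseteq> {z. \<bar>y \<bullet> z\<bar> \<le> sqrt (k d d) * norm z}"
        using bnd yG by (intro closure_minimal) auto
      then show ?thesis using y by blast
    qed
    then have "norm y * norm y \<le> sqrt (k d d) * norm y"
      by (simp add: power2_norm_eq_inner flip: power2_eq_square)
    then have "norm y \<le> sqrt (k d d)"
      using kd by (cases "norm y = 0") (auto simp: mult_le_cancel_right)
    then have ny: "(norm y)\<^sup>2 \<le> k d d" using kd by (metis norm_ge_zero power_mono real_sqrt_pow2)
    \<comment> \<open>What \<open>y\<close> lacks of the prescribed square norm \<open>k d d\<close>
      goes into coordinate \<open>d\<close>, where \<open>y\<close> vanishes.\<close>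
    define c where "c = sqrt (k d d - (norm y)\<^sup>2)"
    define z where "z = y + c *\<^sub>R unit_ell2 d"
    have cz: "coord z d = c" by (simp add: z_def yd coord_unit)
    have "P f d z" unfolding P_def
    proof (intro conjI allI impI)
      fix e assume e: "(e, d) \<in> R"
      have "(f e, k e d) \<in> G" unfolding G_def using e by (intro span_base) auto
      then have "f e \<bullet> y = k e d" using yG inner_commute by metis
      moreover have "coord (f e) d = 0" using supp[OF e, of d] by (auto simp: R_def)
      ultimately show "f e \<bullet> z = k e d" by (simp add: z_def inner_add_right inner_unit)
    next
      have "y \<bullet> unit_ell2 d = 0" by (simp add: inner_unit yd)
      then have "z \<bullet> z = (norm y)\<^sup>2 + c\<^sup>2"
        unfolding z_def power2_norm_eq_inner[of y]
        by (simp add: inner_add_left inner_add_right inner_commute[of "unit_ell2 d" y]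
            inner_unit coord_unit power2_eq_square)
      then show "z \<bullet> z = k d d" using ny by (simp add: c_def)
    next
      fix i assume "coord z i \<noteq> 0"
      then have "coord y i \<noteq> 0 \<or> i = d" by (auto simp: z_def coord_unit split: if_splits)
      then show "(i, d) \<in> r" using ysupp rfl by (auto simp: R_def refl_on_def)
    next
      show "z - coord z d *\<^sub>R unit_ell2 d \<in> closure (span (f ` {e. (e, d) \<in> R}))"
        unfolding cz using ycl by (simp add: z_def)
    qed
    then show "\<exists>z. P f d z" by blast
  qed
  then obtain \<phi> where \<phi>: "\<And>d. P \<phi> d (\<phi> d)" by blast
  have "\<phi> d \<bullet> \<phi> e = k d e" for d e
  proof -
    consider "d = e" | "(d, e) \<in> R" | "(e, d) \<in> R"
      using tot by (auto simp: total_on_def R_def)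
    then show ?thesis using \<phi>[of d] \<phi>[of e] by cases (auto simp: P_def inner_commute sym)
  qed
  then show thesis using that[OF wf] \<phi> by (auto simp: P_def)
qed

text \<open>\<open>D\<close> collects the indices at which the orthogonalisation finds a new
  direction; the vectors span the coordinates in \<open>D\<close> densely. The map \<open>g\<close>
  bounds the size of \<open>D\<close> from above by that of \<open>'i\<close>, and a new direction
  in each of the \<open>'i\<close> many blocks bounds it from below. Schroeder-Bernstein then lets
  \<open>'i\<close> replace \<open>D\<close> as the set of coordinates.\<close>

lemma total_gram_vectors:
  fixes k :: "'d \<Rightarrow> 'd \<Rightarrow> real" and blk :: "'d \<Rightarrow> 'i" and g :: "'d \<Rightarrow> 'i"
  assumes sym: "\<And>d e. k d e = k e d"
    and psd: "\<And>T c. finite T \<Longrightarrow> 0 \<le> (\<Sum>d\<in>T. \<Sum>e\<in>T. c d * c e * k d e)"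
    and blk: "\<And>d e. blk d \<noteq> blk e \<Longrightarrow> k d e = 0"
    and nz: "\<And>i. \<exists>d. blk d = i \<and> k d d \<noteq> 0"
    and g: "inj_on g {d. k d d \<noteq> 0}"
  obtains \<phi> :: "'d \<Rightarrow> 'i ell2" where
    "\<And>d e. \<phi> d \<bullet> \<phi> e = k d e"
    and "\<And>y. (\<And>d. y \<bullet> \<phi> d = 0) \<Longrightarrow> y = 0"
proof -
  obtain \<phi> :: "'d \<Rightarrow> 'd ell2" and R where wf: "wf R"
    and \<phi>: "\<And>d e. \<phi> d \<bullet> \<phi> e = k d e"
    and cl: "\<And>d. \<phi> d - coord (\<phi> d) d *\<^sub>R unit_ell2 d \<in> closure (span (\<phi> ` {e. (e, d) \<in> R}))"
    using gram_schmidt[OF sym psd] by metis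
  define D where "D = {d. coord (\<phi> d) d \<noteq> 0}"
  have Dk: "D \<subseteq> {d. k d d \<noteq> 0}"
    by (auto simp: D_def simp flip: \<phi>)
  \<comment> \<open>A vector orthogonal to all predecessors of \<open>d\<close> sees only the
    multiple of the unit vector in \<open>\<phi> d\<close>.\<close>
  have orth: "y \<bullet> \<phi> d = coord (\<phi> d) d * coord y d" if "\<And>e. (e, d) \<in> R \<Longrightarrow> y \<bullet> \<phi> e = 0" for y d
  proof -
    have "y \<bullet> (\<phi> d - coord (\<phi> d) d *\<^sub>R unit_ell2 d) = 0"
    proof (rule orthogonal_closure[OF _ cl])
      show "y \<bullet> s = 0" if "s \<in> span (\<phi> ` {e. (e, d) \<in> R})" for s
        using _ that by (rule orthogonal_span) (use \<open>\<And>e. (e, d) \<in> R \<Longrightarrow> y \<bullet> \<phi> e = 0\<close> in auto)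
    qed
    then show ?thesis by (simp add: inner_diff_right inner_unit)
  qed
  have supp: "\<forall>i. coord (\<phi> d) i \<noteq> 0 \<longrightarrow> i \<in> D" for d
    using wf
  proof (induction d rule: wf_induct_rule)
    case (less d)
    show ?case
    proof (intro allI impI)
      fix i assume i: "coord (\<phi> d) i \<noteq> 0"
      show "i \<in> D"
      proof (cases "i = d")
        case True
        then show ?thesis using i by (simp add: D_def)
      next
        case False
        then have "coord (\<phi> d - coord (\<phi> d) d *\<^sub>R unit_ell2 d) i \<noteq> 0" using i by (simp add: coord_unit)
        then show ?thesis by (rule supported_closure_span[OF _ cl, rotated]) (use less in auto)
      qed
    qed
  qed
  \<comment> \<open>The least index of block \<open>i\<close> with a nonzero vector: earlier vectors
    of the block are zero and those of other blocks are orthogonal, so its own coordinate carries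
    its whole norm.\<close>
  have "\<exists>d\<in>D. blk d = i" for i
  proof -
    obtain d0 where "d0 \<in> {d. blk d = i \<and> k d d \<noteq> 0}" using nz[of i] by blast
    then obtain d where d: "d \<in> {d. blk d = i \<and> k d d \<noteq> 0}"
      and min: "\<And>e. (e, d) \<in> R \<Longrightarrow> e \<notin> {d. blk d = i \<and> k d d \<noteq> 0}"
      by (rule wfE_min[OF wf]) blast
    have "\<phi> d \<bullet> \<phi> e = 0" if "(e, d) \<in> R" for e
    proof (cases "blk e = i")
      case True
      then have "\<phi> e \<bullet> \<phi> e = 0" using min[OF that] by (simp add: \<phi>)
      then show ?thesis by simp
    next
      case False
      then show ?thesis using d blk[of d e] by (simp add: \<phi>)
    qed
    then have "\<phi> d \<bullet> \<phi> d = coord (\<phi> d) d * coord (\<phi> d) d" by (rule orth)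
    then show ?thesis using d by (intro bexI[of _ d]) (auto simp: \<phi> D_def)
  qed
  then obtain h where h: "\<And>i. h i \<in> D" "\<And>i. blk (h i) = i" by metis
  have "inj h" using h(2) by (rule inj_on_inverseI)
  then obtain b :: "'i \<Rightarrow> 'd" where b: "bij_betw b UNIV D"
    using Schroeder_Bernstein[of h UNIV D g] h(1) inj_on_subset[OF g Dk] by (meson image_subsetI subset_UNIV)
  then have inj: "inj b" and ran: "range b = D" by (auto simp: bij_betw_def)
  define \<psi> where "\<psi> d = blinfun_apply (reindex b) (\<phi> d)" for d
  have bk: "blinfun_apply (adj (reindex b)) (\<psi> d) = \<phi> d" for d
    unfolding \<psi>_def using supp ran by (intro adj_reindex inj) blast
  have "\<psi> d \<bullet> \<psi> e = k d e" for d e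
  proof -
    have "\<psi> d \<bullet> \<psi> e = blinfun_apply (adj (reindex b)) (\<psi> d) \<bullet> \<phi> e"
      by (simp add: adj_left) (simp add: \<psi>_def)
    then show ?thesis by (simp add: bk \<phi>)
  qed
  moreover have "y = 0" if "\<And>d. y \<bullet> \<psi> d = 0" for y
  proof -
    define x where "x = blinfun_apply (adj (reindex b)) y"
    have x0: "x \<bullet> \<phi> d = 0" for d using that[of d] by (simp add: x_def adj_left \<psi>_def)
    have "coord x d = 0" for d
    proof (cases "d \<in> D")
      case True
      then show ?thesis using orth[of d x] x0 by (simp add: D_def)
    next
      case False
      then show ?thesis unfolding x_def using coord_adj_reindex_other[OF inj] ran by auto
    qed
    then have "x = 0" by (intro ell2_eqI) simp
    then show "y = 0" using reindex_adj[OF inj, of y] by (simp add: x_def)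
  qed
  ultimately show thesis using that by blast
qed

section \<open>A minimax principle\<close>

text \<open>The total squared violation \<open>d\<close> of the inequalities is minimised over
  \<open>S\<close>. Were it positive at the minimiser, the violations there, taken as weights in the
  last hypothesis, would give a point of \<open>S\<close> towards which \<open>d\<close> decreases
  to first order.\<close>

lemma minimax_finite:
  fixes S :: "'s::{topological_space, real_vector} set"
  assumes S: "compact S" "convex S" "S \<noteq> {}" and F: "finite F"
    and cont: "\<And>\<psi>. \<psi> \<in> F \<Longrightarrow> continuous_on UNIV \<psi>"
    and aff: "\<And>\<psi> x y u. \<psi> \<in> F \<Longrightarrow> \<psi> ((1 - u) *\<^sub>R x + u *\<^sub>R y) = (1 - u) * \<psi> x + u * \<psi> y"
    and comb: "\<And>c e. (\<And>\<psi>. 0 \<le> c \<psi>) \<Longrightarrow> 0 < e \<Longrightarrow> \<exists>x\<in>S. - e < (\<Sum>\<psi>\<in>F. c \<psi> * \<psi> x)"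
  shows "\<exists>x\<in>S. \<forall>\<psi>\<in>F. (0::real) \<le> \<psi> x"
proof -
  define d where "d x = (\<Sum>\<psi>\<in>F. (max 0 (- \<psi> x))\<^sup>2)" for x
  have "continuous_on UNIV d"
    unfolding d_def using cont by (intro continuous_intros) auto
  then have "continuous_on S d" by (rule continuous_on_subset) simp
  then obtain x0 where x0: "x0 \<in> S" and min: "\<And>y. y \<in> S \<Longrightarrow> d x0 \<le> d y"
    using continuous_attains_inf[OF S(1,3)] by blast
  define c where "c \<psi> = max 0 (- \<psi> x0)" for \<psi> :: "'s \<Rightarrow> real"
  have d0: "d x0 = (\<Sum>\<psi>\<in>F. (c \<psi>)\<^sup>2)" by (simp add: d_def c_def)
  have g0: "(\<Sum>\<psi>\<in>F. c \<psi> * \<psi> x0) = - d x0"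
    unfolding d0 sum_negf[symmetric] by (intro sum.cong refl) (simp add: c_def max_def power2_eq_square)
  have "d x0 = 0"
  proof (rule ccontr)
    assume "d x0 \<noteq> 0"
    then have pos: "0 < d x0"
      using sum_nonneg[of F "\<lambda>\<psi>. (c \<psi>)\<^sup>2"] unfolding d0 by simp
    obtain y where y: "y \<in> S" "- d x0 < (\<Sum>\<psi>\<in>F. c \<psi> * \<psi> y)"
      using comb[of c "d x0"] pos by (auto simp: c_def)
    define D where "D = (\<Sum>\<psi>\<in>F. c \<psi> * (\<psi> y - \<psi> x0))"
    define Q where "Q = (\<Sum>\<psi>\<in>F. (\<psi> y - \<psi> x0)\<^sup>2)"
    have D: "0 < D" using y(2) g0 by (simp add: D_def right_diff_distrib sum_subtractf)
    have Q: "0 \<le> Q" by (simp add: Q_def sum_nonneg)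
    have key: "2 * u * D \<le> u\<^sup>2 * Q" if u: "0 < u" "u \<le> 1" for u
    proof -
      define z where "z = (1 - u) *\<^sub>R x0 + u *\<^sub>R y"
      have z: "z \<in> S" unfolding z_def using S(2) x0 y(1) u by (intro convexD_alt) auto
      \<comment> \<open>Each violation at \<open>z\<close> is bounded by the absolute value of the
        affinely changed weight, which may leave the positive range; in this way the bound becomes
        exactly quadratic in \<open>u\<close>.\<close>
      have "d z \<le> (\<Sum>\<psi>\<in>F. (c \<psi> - u * (\<psi> y - \<psi> x0))\<^sup>2)"
        unfolding d_def
      proof (rule sum_mono)
        fix \<psi> assume "\<psi> \<in> F"
        have "\<psi> z = \<psi> x0 + u * (\<psi> y - \<psi> x0)"
          unfolding z_def aff[OF \<open>\<psi> \<in> F\<close>] by (simp add: algebra_simps)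
        moreover have "- \<psi> x0 \<le> c \<psi>" by (simp add: c_def)
        ultimately have "max 0 (- \<psi> z) \<le> \<bar>c \<psi> - u * (\<psi> y - \<psi> x0)\<bar>" by linarith
        then show "(max 0 (- \<psi> z))\<^sup>2 \<le> (c \<psi> - u * (\<psi> y - \<psi> x0))\<^sup>2"
          by (metis max.cobounded1 power_mono power2_abs)
      qed
      also have "\<dots> = d x0 - 2 * u * D + u\<^sup>2 * Q"
        unfolding d0 D_def Q_def sum_distrib_left sum_subtractf[symmetric] sum.distrib[symmetric]
        by (intro sum.cong refl) (simp add: power2_diff power_mult_distrib)
      finally show ?thesis using min[OF z] by linarith
    qed
    \<comment> \<open>So small that the second-order term \<open>u * Q\<close> is at most
      \<open>D\<close>, against the first-order gain \<open>2 * D\<close>.\<close>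
    define u where "u = min 1 (D / (Q + 1))"
    have u: "0 < u" "u \<le> 1" using D Q by (auto simp: u_def)
    have "2 * D \<le> u * Q"
      using key[OF u] u(1) by (simp add: power2_eq_square)
    also have "\<dots> \<le> (D / (Q + 1)) * Q" using Q by (intro mult_right_mono) (auto simp: u_def)
    also have "\<dots> \<le> D" using D Q by (simp add: field_simps)
    finally show False using D by simp
  qed
  then have "\<forall>\<psi>\<in>F. (c \<psi>)\<^sup>2 = 0" unfolding d0 using F by (simp add: sum_nonneg_eq_0_iff)
  then have "\<forall>\<psi>\<in>F. 0 \<le> \<psi> x0" by (auto simp: c_def max_def split: if_splits)
  then show ?thesis using x0 by blast
qed

text \<open>The finite intersection property reduces the claim to finitely many inequalities.
  Scaling is required only on \<open>S\<close>, because in the application rows multiplied by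
  \<open>sqrt c\<close> multiply the function by \<open>c\<close> only at arguments that are
  states.\<close>

lemma minimax:
  fixes S :: "'s::{topological_space, real_vector} set"
  assumes S: "compact S" "convex S" "S \<noteq> {}"
    and cont: "\<And>\<psi>. \<psi> \<in> \<Psi> \<Longrightarrow> continuous_on UNIV \<psi>"
    and aff: "\<And>\<psi> x y u. \<psi> \<in> \<Psi> \<Longrightarrow> \<psi> ((1 - u) *\<^sub>R x + u *\<^sub>R y) = (1 - u) * \<psi> x + u * \<psi> y"
    and add: "\<And>\<psi> \<omega>. \<psi> \<in> \<Psi> \<Longrightarrow> \<omega> \<in> \<Psi> \<Longrightarrow> (\<lambda>x. \<psi> x + \<omega> x) \<in> \<Psi>"
    and scale: "\<And>\<psi> c. \<psi> \<in> \<Psi> \<Longrightarrow> 0 \<le> c \<Longrightarrow> \<exists>\<omega>\<in>\<Psi>. \<forall>x\<in>S. \<omega> x = c * \<psi> x"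
    and zero: "(\<lambda>x. 0) \<in> \<Psi>"
    and sup: "\<And>\<psi> e. \<psi> \<in> \<Psi> \<Longrightarrow> 0 < e \<Longrightarrow> \<exists>x\<in>S. - e < \<psi> x"
  shows "\<exists>x\<in>S. \<forall>\<psi>\<in>\<Psi>. (0::real) \<le> \<psi> x"
proof -
  have "S \<inter> (\<Inter>\<psi>\<in>\<Psi>. {x. 0 \<le> \<psi> x}) \<noteq> {}"
  proof (rule compact_imp_fip_image[OF S(1)])
    show "closed {x. 0 \<le> \<psi> x}" if "\<psi> \<in> \<Psi>" for \<psi>
      using cont[OF that] by (intro closed_Collect_le continuous_intros)
  next
    fix F assume F: "finite F" "F \<subseteq> \<Psi>"
    have comb: "\<exists>\<omega>\<in>\<Psi>. \<forall>x\<in>S. \<omega> x = (\<Sum>\<psi>\<in>F. c \<psi> * \<psi> x)" if c0: "\<And>\<psi>. 0 \<le> c \<psi>" for c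
      using F
    proof (induction rule: finite_induct)
      case empty
      show ?case by (rule bexI[OF _ zero]) simp
    next
      case (insert \<psi> F)
      then have sub: "\<psi> \<in> \<Psi>" "F \<subseteq> \<Psi>" by simp_all
      obtain \<omega> where \<omega>: "\<omega> \<in> \<Psi>" "\<forall>x\<in>S. \<omega> x = (\<Sum>\<psi>\<in>F. c \<psi> * \<psi> x)"
        by (rule bexE[OF insert.IH[OF sub(2)]])
      obtain \<omega>' where \<omega>': "\<omega>' \<in> \<Psi>" "\<forall>x\<in>S. \<omega>' x = c \<psi> * \<psi> x"
        by (rule bexE[OF scale[OF sub(1) c0]])
      have "\<forall>x\<in>S. \<omega>' x + \<omega> x = (\<Sum>\<psi>\<in>insert \<psi> F. c \<psi> * \<psi> x)"
        using insert.hyps \<omega>(2) \<omega>'(2) by simp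
      then show ?case by (rule bexI[OF _ add[OF \<omega>'(1) \<omega>(1)]])
    qed
    have "\<exists>x\<in>S. \<forall>\<psi>\<in>F. 0 \<le> \<psi> x"
    proof (rule minimax_finite[OF S F(1)])
      show "\<exists>x\<in>S. - e < (\<Sum>\<psi>\<in>F. c \<psi> * \<psi> x)" if c0: "\<And>\<psi>. 0 \<le> c \<psi>" and e0: "0 < e" for c e
      proof -
        obtain \<omega> where \<omega>: "\<omega> \<in> \<Psi>" "\<forall>x\<in>S. \<omega> x = (\<Sum>\<psi>\<in>F. c \<psi> * \<psi> x)"
          by (rule bexE[OF comb[of c, OF c0]])
        obtain x where "x \<in> S" "- e < \<omega> x" using sup[OF \<omega>(1) e0] by blast
        then show ?thesis using \<omega>(2) by auto
      qed
    qed (use F(2) cont aff in blast)+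
    then show "S \<inter> (\<Inter>\<psi>\<in>F. {x. 0 \<le> \<psi> x}) \<noteq> {}" by auto
  qed
  then show ?thesis by auto
qed

section \<open>States on rows of operators\<close>

text \<open>
  A row \<open>\<beta>\<close> of length \<open>n\<close> acts on \<open>n\<close>-tuples of vectors. The forms below are those of the shape
  \<open>f (\<beta>* \<gamma>)\<close> with \<open>f\<close> a contractive positive functional on the \<open>n \<times> n\<close> matrices of operators;
  the third condition states positivity and contractivity together, without using
  any functional on matrices.
\<close>

definition row_states ::
  "nat \<Rightarrow> ((nat \<Rightarrow> ('h::{real_inner, complete_space} \<Rightarrow>\<^sub>L 'h)) \<Rightarrow> (nat \<Rightarrow> ('h \<Rightarrow>\<^sub>L 'h)) \<Rightarrow> real) set"
  where "row_states n = {t. (\<forall>\<gamma>. linear (\<lambda>\<beta>. t \<beta> \<gamma>)) \<and> (\<forall>\<beta> \<gamma>. t \<beta> \<gamma> = t \<gamma> \<beta>) \<and>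
    (\<forall>\<beta> \<gamma> (m::nat) c. 0 \<le> c \<longrightarrow>
      (\<forall>h. (\<Sum>k<m. (norm (\<Sum>j<n. blinfun_apply (\<gamma> k j) (h j)))\<^sup>2)
        \<le> (\<Sum>k<m. (norm (\<Sum>j<n. blinfun_apply (\<beta> k j) (h j)))\<^sup>2) + c * (\<Sum>j<n. (norm (h j))\<^sup>2)) \<longrightarrow>
      (\<Sum>k<m. t (\<gamma> k) (\<gamma> k)) \<le> (\<Sum>k<m. t (\<beta> k) (\<beta> k)) + c)}"

definition vector_state ::
  "nat \<Rightarrow> (nat \<Rightarrow> 'h::{real_inner, complete_space}) \<Rightarrow>
    (nat \<Rightarrow> ('h \<Rightarrow>\<^sub>L 'h)) \<Rightarrow> (nat \<Rightarrow> ('h \<Rightarrow>\<^sub>L 'h)) \<Rightarrow> real"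
  where "vector_state n h \<beta> \<gamma> =
    (\<Sum>j<n. blinfun_apply (\<beta> j) (h j)) \<bullet> (\<Sum>j<n. blinfun_apply (\<gamma> j) (h j))"

lemma vector_state_in_row_states:
  assumes "(\<Sum>j<n. (norm (h j))\<^sup>2) \<le> 1"
  shows "vector_state n h \<in> row_states n"
  unfolding row_states_def
proof (intro CollectI conjI allI impI)
  show "linear (\<lambda>\<beta>. vector_state n h \<beta> \<gamma>)" for \<gamma>
    by (rule linearI)
      (simp_all add: vector_state_def blinfun.add_left blinfun.scaleR_left sum.distrib inner_add_left
        flip: scaleR_sum_right)
  show "vector_state n h \<beta> \<gamma> = vector_state n h \<gamma> \<beta>" for \<beta> \<gamma>
    by (simp add: vector_state_def inner_commute)
  show "(\<Sum>k<m. vector_state n h (\<gamma> k) (\<gamma> k)) \<le> (\<Sum>k<m. vector_state n h (\<beta> k) (\<beta> k)) + c"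
    if "0 \<le> c" "\<forall>h. (\<Sum>k<m. (norm (\<Sum>j<n. blinfun_apply (\<gamma> k j) (h j)))\<^sup>2)
        \<le> (\<Sum>k<m. (norm (\<Sum>j<n. blinfun_apply (\<beta> k j) (h j)))\<^sup>2) + c * (\<Sum>j<n. (norm (h j))\<^sup>2)"
    for \<beta> \<gamma> :: "nat \<Rightarrow> nat \<Rightarrow> ('a \<Rightarrow>\<^sub>L 'a)" and m :: nat and c
  proof -
    have "c * (\<Sum>j<n. (norm (h j))\<^sup>2) \<le> c" using assms that(1) by (simp add: mult_left_le)
    then show ?thesis
      using that(2)[rule_format, of h] by (simp add: vector_state_def flip: power2_norm_eq_inner)
  qed
qed

lemma row_states_mono:
  fixes m :: nat
  assumes "t \<in> row_states n" and "0 \<le> c"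
    and "\<And>h. (\<Sum>k<m. (norm (\<Sum>j<n. blinfun_apply (\<gamma> k j) (h j)))\<^sup>2)
        \<le> (\<Sum>k<m. (norm (\<Sum>j<n. blinfun_apply (\<beta> k j) (h j)))\<^sup>2) + c * (\<Sum>j<n. (norm (h j))\<^sup>2)"
  shows "(\<Sum>k<m. t (\<gamma> k) (\<gamma> k)) \<le> (\<Sum>k<m. t (\<beta> k) (\<beta> k)) + c"
  using assms unfolding row_states_def by blast

lemma row_states_sym: "t \<in> row_states n \<Longrightarrow> t \<beta> \<gamma> = t \<gamma> \<beta>"
  unfolding row_states_def by blast

lemma row_states_linear: "t \<in> row_states n \<Longrightarrow> linear (\<lambda>\<beta>. t \<beta> \<gamma>)"
  unfolding row_states_def by blast

lemma row_states_linear2: "t \<in> row_states n \<Longrightarrow> linear (t \<beta>)"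
proof -
  assume t: "t \<in> row_states n"
  have "t \<beta> = (\<lambda>\<gamma>. t \<gamma> \<beta>)" by (rule ext) (rule row_states_sym[OF t])
  then show ?thesis using row_states_linear[OF t, of \<beta>] by simp
qed

lemma row_states_zero [simp]:
  assumes "t \<in> row_states n" shows "t 0 \<gamma> = 0" and "t \<gamma> 0 = 0"
  using linear_0[OF row_states_linear[OF assms]] linear_0[OF row_states_linear2[OF assms]] by auto

lemma row_states_nonneg:
  assumes t: "t \<in> row_states n" shows "0 \<le> t \<beta> \<beta>"
  using row_states_mono[OF t, where c = 0 and m = 1 and \<gamma> = "\<lambda>_. 0" and \<beta> = "\<lambda>_. \<beta>"] t
  by simp

lemma row_states_scale:
  assumes t: "t \<in> row_states n" shows "t (c *\<^sub>R \<beta>) (c *\<^sub>R \<beta>) = c\<^sup>2 * t \<beta> \<beta>"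
  using linear_scale[OF row_states_linear[OF t]] linear_scale[OF row_states_linear2[OF t]]
  by (simp add: power2_eq_square)

lemma row_states_le:
  assumes t: "t \<in> row_states n" shows "t \<beta> \<beta> \<le> (\<Sum>j<n. (norm (\<beta> j))\<^sup>2)"
proof -
  have "(norm (\<Sum>j<n. blinfun_apply (\<beta> j) (h j)))\<^sup>2 \<le> (\<Sum>j<n. (norm (\<beta> j))\<^sup>2) * (\<Sum>j<n. (norm (h j))\<^sup>2)" for h
  proof -
    have "norm (\<Sum>j<n. blinfun_apply (\<beta> j) (h j)) \<le> (\<Sum>j<n. \<bar>norm (\<beta> j)\<bar> * \<bar>norm (h j)\<bar>)"
      by (intro order_trans[OF norm_sum] sum_mono) (simp add: norm_blinfun)
    also have "\<dots> \<le> L2_set (\<lambda>j. norm (\<beta> j)) {..<n} * L2_set (\<lambda>j. norm (h j)) {..<n}"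
      by (rule L2_set_mult_ineq)
    finally show ?thesis
      using power_mono[of "norm (\<Sum>j<n. blinfun_apply (\<beta> j) (h j))" _ 2]
      by (fastforce simp: power_mult_distrib L2_set_sq)
  qed
  then show ?thesis
    using row_states_mono[OF t, where c = "\<Sum>j<n. (norm (\<beta> j))\<^sup>2" and m = 1
        and \<gamma> = "\<lambda>_. \<beta>" and \<beta> = "\<lambda>_. 0"] t by (simp add: sum_nonneg)
qed

text \<open>Polarisation of positivity. The bound is crude, but it only has to confine the states to
  a product of compact intervals.\<close>

lemma row_states_abs_le:
  assumes t: "t \<in> row_states n"
  shows "\<bar>t \<beta> \<gamma>\<bar> \<le> (\<Sum>j<n. (norm (\<beta> j))\<^sup>2) + (\<Sum>j<n. (norm (\<gamma> j))\<^sup>2)"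
proof -
  note lin = row_states_linear[OF t] row_states_linear2[OF t]
  have "0 \<le> t (\<beta> + \<gamma>) (\<beta> + \<gamma>)" "0 \<le> t (\<beta> - \<gamma>) (\<beta> - \<gamma>)" by (rule row_states_nonneg[OF t])+
  then have "\<bar>2 * t \<beta> \<gamma>\<bar> \<le> t \<beta> \<beta> + t \<gamma> \<gamma>"
    by (simp add: linear_add[OF lin(1)] linear_add[OF lin(2)] linear_diff[OF lin(1)]
        linear_diff[OF lin(2)] row_states_sym[OF t, of \<gamma> \<beta>])
  then show ?thesis using row_states_le[OF t, of \<beta>] row_states_le[OF t, of \<gamma>]
      row_states_nonneg[OF t, of \<beta>] row_states_nonneg[OF t, of \<gamma>] by linarith
qed

text \<open>Here the defining condition is needed for several rows at once: multiplication of a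
  stack of rows by an operator matrix is bounded by the matrix norm, which later makes the
  representations completely contractive.\<close>

lemma row_states_matrix_mult:
  assumes t: "t \<in> row_states n"
  shows "(\<Sum>i<m. t (\<lambda>j. \<Sum>k<m. b i k o\<^sub>L \<beta> k j) (\<lambda>j. \<Sum>k<m. b i k o\<^sub>L \<beta> k j))
    \<le> (matrix_norm m b)\<^sup>2 * (\<Sum>k<m. t (\<beta> k) (\<beta> k))"
proof -
  let ?M = "matrix_norm m b"
  have "(\<Sum>i<m. t (\<lambda>j. \<Sum>k<m. b i k o\<^sub>L \<beta> k j) (\<lambda>j. \<Sum>k<m. b i k o\<^sub>L \<beta> k j))
    \<le> (\<Sum>k<m. t (?M *\<^sub>R \<beta> k) (?M *\<^sub>R \<beta> k)) + 0"
  proof (rule row_states_mono[OF t order_refl])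
    fix h
    have "(\<Sum>j<n. blinfun_apply (\<Sum>k<m. b i k o\<^sub>L \<beta> k j) (h j))
        = (\<Sum>k<m. blinfun_apply (b i k) (\<Sum>j<n. blinfun_apply (\<beta> k j) (h j)))" for i
      by (simp add: blinfun.sum_left blinfun.sum_right) (rule sum.swap)
    then show "(\<Sum>i<m. (norm (\<Sum>j<n. blinfun_apply (\<Sum>k<m. b i k o\<^sub>L \<beta> k j) (h j)))\<^sup>2)
      \<le> (\<Sum>k<m. (norm (\<Sum>j<n. blinfun_apply ((?M *\<^sub>R \<beta> k) j) (h j)))\<^sup>2) + 0 * (\<Sum>j<n. (norm (h j))\<^sup>2)"
      using matrix_norm_bound[where n = m and T = b and v = "\<lambda>k. \<Sum>j<n. blinfun_apply (\<beta> k j) (h j)"]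
      by (simp add: blinfun.scaleR_left power_mult_distrib sum_distrib_left flip: scaleR_sum_right)
  qed
  then show ?thesis by (simp add: row_states_scale[OF t] sum_distrib_left)
qed

lemma row_states_diagonal:
  assumes t: "t \<in> row_states n" and e: "norm e \<le> 1"
  shows "(\<Sum>k<n. t (\<lambda>j. if j = k then e else 0) (\<lambda>j. if j = k then e else 0)) \<le> 1"
proof -
  have "(\<Sum>k<n. t (\<lambda>j. if j = k then e else 0) (\<lambda>j. if j = k then e else 0)) \<le> (\<Sum>k<n. t ((\<lambda>_. 0) k) ((\<lambda>_. 0) k)) + 1"
  proof (rule row_states_mono[OF t])
    fix h
    have "(\<Sum>j<n. blinfun_apply (if j = k then e else 0) (h j)) = blinfun_apply e (h k)" if "k < n" for k
    proof -
      have "(\<Sum>j<n. blinfun_apply (if j = k then e else 0) (h j)) = (\<Sum>j<n. if j = k then blinfun_apply e (h j) else 0)"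
        by (intro sum.cong) auto
      then show ?thesis using that by simp
    qed
    moreover have "norm (blinfun_apply e (h k)) \<le> norm (h k)" for k
      using norm_blinfun[of e "h k"] mult_right_mono[OF e norm_ge_zero[of "h k"]] by simp
    ultimately show "(\<Sum>k<n. (norm (\<Sum>j<n. blinfun_apply (if j = k then e else 0) (h j)))\<^sup>2)
      \<le> (\<Sum>k<n. (norm (\<Sum>j<n. blinfun_apply ((\<lambda>_. 0) k j) (h j)))\<^sup>2) + 1 * (\<Sum>j<n. (norm (h j))\<^sup>2)"
      by (auto intro!: sum_mono power_mono)
  qed simp
  then show ?thesis using t by (simp add: zero_fun_def[symmetric])
qed

lemma convex_row_states: "convex (row_states n)"
  unfolding convex_alt
proof (intro ballI allI impI)
  fix s t :: "(nat \<Rightarrow> ('a \<Rightarrow>\<^sub>L 'a)) \<Rightarrow> (nat \<Rightarrow> ('a \<Rightarrow>\<^sub>L 'a)) \<Rightarrow> real" and u :: real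
  assume s: "s \<in> row_states n" and t: "t \<in> row_states n" and u: "0 \<le> u \<and> u \<le> 1"
  show "(1 - u) *\<^sub>R s + u *\<^sub>R t \<in> row_states n"
    unfolding row_states_def
  proof (intro CollectI conjI allI impI)
    show "linear (\<lambda>\<beta>. ((1 - u) *\<^sub>R s + u *\<^sub>R t) \<beta> \<gamma>)" for \<gamma>
      using row_states_linear[OF s, of \<gamma>] row_states_linear[OF t, of \<gamma>]
      by (auto simp: linear_iff algebra_simps)
    show "((1 - u) *\<^sub>R s + u *\<^sub>R t) \<beta> \<gamma> = ((1 - u) *\<^sub>R s + u *\<^sub>R t) \<gamma> \<beta>" for \<beta> \<gamma>
      using row_states_sym[OF s, of \<beta> \<gamma>] row_states_sym[OF t, of \<beta> \<gamma>] by simp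
    fix \<beta> \<gamma> :: "nat \<Rightarrow> nat \<Rightarrow> ('a \<Rightarrow>\<^sub>L 'a)" and m :: nat and c :: real
    assume c: "0 \<le> c" and le: "\<forall>h. (\<Sum>k<m. (norm (\<Sum>j<n. blinfun_apply (\<gamma> k j) (h j)))\<^sup>2)
        \<le> (\<Sum>k<m. (norm (\<Sum>j<n. blinfun_apply (\<beta> k j) (h j)))\<^sup>2) + c * (\<Sum>j<n. (norm (h j))\<^sup>2)"
    have "(1 - u) * (\<Sum>k<m. s (\<gamma> k) (\<gamma> k)) + u * (\<Sum>k<m. t (\<gamma> k) (\<gamma> k))
      \<le> (1 - u) * ((\<Sum>k<m. s (\<beta> k) (\<beta> k)) + c) + u * ((\<Sum>k<m. t (\<beta> k) (\<beta> k)) + c)"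
      using u c le by (intro add_mono mult_left_mono row_states_mono[OF s] row_states_mono[OF t]) auto
    then show "(\<Sum>k<m. ((1 - u) *\<^sub>R s + u *\<^sub>R t) (\<gamma> k) (\<gamma> k))
      \<le> (\<Sum>k<m. ((1 - u) *\<^sub>R s + u *\<^sub>R t) (\<beta> k) (\<beta> k)) + c"
      by (simp add: sum.distrib flip: sum_distrib_left) (simp add: algebra_simps)
  qed
qed

lemma compact_PiE_UNIV:
  fixes K :: "'i \<Rightarrow> 'a::topological_space set"
  assumes "\<And>i. compact (K i)"
  shows "compact (Pi\<^sub>E UNIV K)"
  using assms compactin_PiE[of "\<lambda>_. euclidean" UNIV K]
  by (simp add: euclidean_product_topology)

lemma continuous_on_eval2: "continuous_on UNIV (\<lambda>t :: 'a \<Rightarrow> 'b \<Rightarrow> real. t x y)"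
  by (rule continuous_on_product_then_coordinatewise[OF continuous_on_product_coordinates])

text \<open>In the topology of pointwise convergence the states are a closed subset of a product of
  compact intervals, as in the Banach-Alaoglu theorem.\<close>

lemma compact_row_states: "compact (row_states n)"
proof -
  define M :: "(nat \<Rightarrow> ('a \<Rightarrow>\<^sub>L 'a)) \<Rightarrow> (nat \<Rightarrow> ('a \<Rightarrow>\<^sub>L 'a)) \<Rightarrow> real"
    where "M \<beta> \<gamma> = (\<Sum>j<n. (norm (\<beta> j))\<^sup>2) + (\<Sum>j<n. (norm (\<gamma> j))\<^sup>2)" for \<beta> \<gamma>
  have cpt: "compact (Pi\<^sub>E UNIV (\<lambda>\<beta>. Pi\<^sub>E UNIV (\<lambda>\<gamma>. {- M \<beta> \<gamma>..M \<beta> \<gamma>})))"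
    by (intro compact_PiE_UNIV compact_Icc)
  \<comment> \<open>The premises in the condition on states do not mention the state, so each
    implication is either trivial or its conclusion.\<close>
  have imp: "closed {x. Q x} \<Longrightarrow> closed {x. P \<longrightarrow> Q x}" for P and Q :: "'b::topological_space \<Rightarrow> bool"
    by (cases P) auto
  note ev = continuous_on_eval2[where 'a = "nat \<Rightarrow> ('a \<Rightarrow>\<^sub>L 'a)" and 'b = "nat \<Rightarrow> ('a \<Rightarrow>\<^sub>L 'a)"]
  have cld: "closed (row_states n :: ((nat \<Rightarrow> ('a \<Rightarrow>\<^sub>L 'a)) \<Rightarrow> (nat \<Rightarrow> ('a \<Rightarrow>\<^sub>L 'a)) \<Rightarrow> real) set)"
    unfolding row_states_def linear_iff
    by (intro closed_Collect_conj closed_Collect_all imp closed_Collect_eq closed_Collect_le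
        continuous_on_add continuous_on_scaleR continuous_on_sum continuous_on_const ev)
  have sub: "row_states n \<subseteq> Pi\<^sub>E UNIV (\<lambda>\<beta>. Pi\<^sub>E UNIV (\<lambda>\<gamma>. {- M \<beta> \<gamma>..M \<beta> \<gamma>}))"
  proof
    fix t :: "(nat \<Rightarrow> ('a \<Rightarrow>\<^sub>L 'a)) \<Rightarrow> (nat \<Rightarrow> ('a \<Rightarrow>\<^sub>L 'a)) \<Rightarrow> real"
    assume "t \<in> row_states n"
    then have "\<bar>t \<beta> \<gamma>\<bar> \<le> M \<beta> \<gamma>" for \<beta> \<gamma> unfolding M_def by (rule row_states_abs_le)
    then have "t \<beta> \<gamma> \<in> {- M \<beta> \<gamma>..M \<beta> \<gamma>}" for \<beta> \<gamma>
      unfolding atLeastAtMost_iff by (metis abs_le_iff minus_le_iff)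
    then show "t \<in> Pi\<^sub>E UNIV (\<lambda>\<beta>. Pi\<^sub>E UNIV (\<lambda>\<gamma>. {- M \<beta> \<gamma>..M \<beta> \<gamma>}))"
      unfolding PiE_UNIV_domain Pi_def by blast
  qed
  show ?thesis using compact_Int_closed[OF cpt cld] unfolding Int_absorb1[OF sub] .
qed

text \<open>The norm of the padded matrix is nearly attained at a tuple of vectors; only the first
  \<open>n\<close> vectors and \<open>m\<close> rows contribute, and on these the sum of squares is
  a sum of values of one vector state.\<close>

lemma row_states_approx:
  fixes \<beta> :: "nat \<Rightarrow> nat \<Rightarrow> ('h::{real_inner, complete_space} \<Rightarrow>\<^sub>L 'h)"
  assumes "m \<le> N" and "n \<le> N" and e: "0 < e"
  obtains t where "t \<in> row_states n"
    and "(matrix_norm N (\<lambda>k j. if k < m \<and> j < n then \<beta> k j else 0))\<^sup>2 - e < (\<Sum>k<m. t (\<beta> k) (\<beta> k))"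
proof -
  let ?b = "\<lambda>k j. if k < m \<and> j < n then \<beta> k j else 0"
  obtain h where h: "(\<Sum>j<N. (norm (h j))\<^sup>2) \<le> 1"
    and gt: "(matrix_norm N ?b)\<^sup>2 - e < (\<Sum>k<N. (norm (\<Sum>j<N. blinfun_apply (?b k j) (h j)))\<^sup>2)"
    using matrix_norm_approx_sq[OF e, of N ?b] by blast
  have "(\<Sum>j<n. (norm (h j))\<^sup>2) \<le> (\<Sum>j<N. (norm (h j))\<^sup>2)"
    using assms by (intro sum_mono2) auto
  then have "vector_state n h \<in> row_states n"
    using h by (intro vector_state_in_row_states) linarith
  moreover have "(\<Sum>k<N. (norm (\<Sum>j<N. blinfun_apply (?b k j) (h j)))\<^sup>2)
      = (\<Sum>k<m. vector_state n h (\<beta> k) (\<beta> k))"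
  proof (rule sum.mono_neutral_cong_right)
    fix k assume "k \<in> {..<m}"
    then have "(\<Sum>j<N. blinfun_apply (?b k j) (h j)) = (\<Sum>j<n. blinfun_apply (\<beta> k j) (h j))"
      using assms by (intro sum.mono_neutral_cong_right) auto
    then show "(norm (\<Sum>j<N. blinfun_apply (?b k j) (h j)))\<^sup>2 = vector_state n h (\<beta> k) (\<beta> k)"
      by (simp add: vector_state_def power2_norm_eq_inner)
  qed (use assms in auto)
  ultimately show thesis using gt by (intro that[of "vector_state n h"]) simp_all
qed

section \<open>Contractive bimodules\<close>

text \<open>No bound on the operators is required, unlike for limits on the closure. This matters
  because the bounds of the one-sided actions are themselves derived from this convergence.\<close>

lemma tendsto_on_span:
  fixes T :: "'e \<Rightarrow> 'x::real_normed_vector \<Rightarrow> 'x"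
  assumes X: "subspace X" "S \<subseteq> X"
    and lin: "\<forall>\<^sub>F e in F. real_linear_on X (T e)"
    and lim: "\<And>s. s \<in> S \<Longrightarrow> ((\<lambda>e. T e s) \<longlongrightarrow> s) F"
    and z: "z \<in> span S"
  shows "((\<lambda>e. T e z) \<longlongrightarrow> z) F"
proof -
  have "z \<in> X \<and> ((\<lambda>e. T e z) \<longlongrightarrow> z) F"
    using z
  proof (induction rule: span_induct_alt)
    case base
    have "\<forall>\<^sub>F e in F. T e 0 = 0"
      using lin
    proof eventually_elim
      case (elim e)
      then show ?case using subspace_0[OF X(1)] unfolding real_linear_on_def by (metis scaleR_zero_left)
    qed
    then show ?case using subspace_0[OF X(1)] by (simp add: tendsto_eventually)
  next
    case (step c s y)
    have s: "s \<in> X" using step X(2) by blast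
    have "\<forall>\<^sub>F e in F. c *\<^sub>R T e s + T e y = T e (c *\<^sub>R s + y)"
      using lin
    proof eventually_elim
      case (elim e)
      then show ?case using s step.IH subspace_scale[OF X(1) s, of c] by (simp add: real_linear_on_def)
    qed
    moreover have "((\<lambda>e. c *\<^sub>R T e s + T e y) \<longlongrightarrow> c *\<^sub>R s + y) F"
      using step lim by (intro tendsto_intros) auto
    ultimately have "((\<lambda>e. T e (c *\<^sub>R s + y)) \<longlongrightarrow> c *\<^sub>R s + y) F"
      by (rule Lim_transform_eventually[rotated])
    then show ?case using s step.IH X(1) by (simp add: subspace_add subspace_scale)
  qed
  then show ?thesis ..
qed

lemma tendsto_on_closure_span:
  fixes T :: "'e \<Rightarrow> 'x::real_normed_vector \<Rightarrow> 'x"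
  assumes X: "subspace X" "S \<subseteq> X"
    and lin: "\<forall>\<^sub>F e in F. real_linear_on X (T e)"
    and contr: "\<forall>\<^sub>F e in F. \<forall>x\<in>X. norm (T e x) \<le> norm x"
    and lim: "\<And>s. s \<in> S \<Longrightarrow> ((\<lambda>e. T e s) \<longlongrightarrow> s) F"
    and x: "x \<in> X" "x \<in> closure (span S)"
  shows "((\<lambda>e. T e x) \<longlongrightarrow> x) F"
proof (rule tendstoI)
  fix \<epsilon> :: real assume \<epsilon>: "0 < \<epsilon>"
  then obtain z where z: "z \<in> span S" "dist z x < \<epsilon> / 3"
    using x(2) unfolding closure_approachable by (meson divide_pos_pos zero_less_numeral)
  have zX: "z \<in> X" using z(1) X by (meson span_minimal subsetD)
  have "((\<lambda>e. T e z) \<longlongrightarrow> z) F" by (rule tendsto_on_span[OF X lin lim z(1)])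
  then have "\<forall>\<^sub>F e in F. dist (T e z) z < \<epsilon> / 3" by (rule tendstoD) (use \<epsilon> in simp)
  then show "\<forall>\<^sub>F e in F. dist (T e x) x < \<epsilon>"
    using lin contr
  proof eventually_elim
    case (elim e)
    have d: "x - z \<in> X" using x(1) zX X(1) by (rule subspace_diff[rotated])
    have "T e x = T e ((x - z) + z)" by simp
    also have "\<dots> = T e (x - z) + T e z" using elim(2) d zX unfolding real_linear_on_def by blast
    finally have eq: "T e x - x = T e (x - z) + (T e z - z) + (z - x)" by simp
    have "norm (T e (x - z)) \<le> norm (x - z)" using elim(3) d by blast
    then have "norm (T e x - x) \<le> norm (x - z) + norm (T e z - z) + norm (z - x)"
      using norm_triangle_ineq[of "T e (x - z) + (T e z - z)" "z - x"]
        norm_triangle_ineq[of "T e (x - z)" "T e z - z"] unfolding eq by linarith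
    then show ?case using elim(1) z(2) by (simp add: dist_norm norm_minus_commute)
  qed
qed

locale contractive_bimodule =
  fixes A :: "('ha::{real_inner, complete_space} \<Rightarrow>\<^sub>L 'ha) set"
    and B :: "('hb::{real_inner, complete_space} \<Rightarrow>\<^sub>L 'hb) set"
    and X :: "('hx::{real_inner, complete_space} \<Rightarrow>\<^sub>L 'hx) set"
    and l :: "('ha \<Rightarrow>\<^sub>L 'ha) \<Rightarrow> ('hx \<Rightarrow>\<^sub>L 'hx) \<Rightarrow> ('hx \<Rightarrow>\<^sub>L 'hx)"
    and r :: "('hx \<Rightarrow>\<^sub>L 'hx) \<Rightarrow> ('hb \<Rightarrow>\<^sub>L 'hb) \<Rightarrow> ('hx \<Rightarrow>\<^sub>L 'hx)"
  assumes algA: "real_operator_algebra A" and unitA: "approximately_unital A"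
    and algB: "real_operator_algebra B" and unitB: "approximately_unital B"
    and spaceX: "real_operator_space X"
    and bimod: "real_bimodule A B X l r"
    and cont: "continuous_actions A B X l r"
    and nondeg: "nondegenerate_bimodule A B X l r"
    and contr: "completely_contractive_actions A B X l r"
begin

lemma subA: "subspace A" and mulA: "a \<in> A \<Longrightarrow> a' \<in> A \<Longrightarrow> a o\<^sub>L a' \<in> A"
  using algA by (auto simp: real_operator_algebra_def)

lemma subB: "subspace B" and mulB: "b \<in> B \<Longrightarrow> b' \<in> B \<Longrightarrow> b o\<^sub>L b' \<in> B"
  using algB by (auto simp: real_operator_algebra_def)

lemma subX: "subspace X"
  using spaceX by (simp add: real_operator_space_def)

lemma l_in: "a \<in> A \<Longrightarrow> x \<in> X \<Longrightarrow> l a x \<in> X"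
  and r_in: "x \<in> X \<Longrightarrow> b \<in> B \<Longrightarrow> r x b \<in> X"
  and l_linear: "a \<in> A \<Longrightarrow> real_linear_on X (l a)"
  and l_linear2: "x \<in> X \<Longrightarrow> real_linear_on A (\<lambda>a. l a x)"
  and r_linear: "b \<in> B \<Longrightarrow> real_linear_on X (\<lambda>x. r x b)"
  and r_linear2: "x \<in> X \<Longrightarrow> real_linear_on B (r x)"
  and l_mult: "a \<in> A \<Longrightarrow> a' \<in> A \<Longrightarrow> x \<in> X \<Longrightarrow> l (a o\<^sub>L a') x = l a (l a' x)"
  and r_mult: "x \<in> X \<Longrightarrow> b \<in> B \<Longrightarrow> b' \<in> B \<Longrightarrow> r x (b o\<^sub>L b') = r (r x b) b'"
  and lr: "a \<in> A \<Longrightarrow> x \<in> X \<Longrightarrow> b \<in> B \<Longrightarrow> r (l a x) b = l a (r x b)"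
  using bimod unfolding real_bimodule_def by blast+

lemma real_linear_on_zero: "real_linear_on Y f \<Longrightarrow> subspace Y \<Longrightarrow> f 0 = 0"
  unfolding real_linear_on_def using subspace_0 by (metis scaleR_zero_left)

lemma real_linear_on_diff:
  assumes "real_linear_on Y f" "subspace Y" "x \<in> Y" "y \<in> Y" shows "f (x - y) = f x - f y"
proof -
  have "f ((x - y) + y) = f (x - y) + f y"
    using assms subspace_diff[OF assms(2-4)] unfolding real_linear_on_def by blast
  then show ?thesis by simp
qed

lemma l_zero: "x \<in> X \<Longrightarrow> l 0 x = 0" and l_zero2: "a \<in> A \<Longrightarrow> l a 0 = 0"
  and r_zero: "x \<in> X \<Longrightarrow> r x 0 = 0" and r_zero2: "b \<in> B \<Longrightarrow> r 0 b = 0"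
  using real_linear_on_zero l_linear l_linear2 r_linear r_linear2 subA subB subX by blast+

lemma norm_lr_le:
  assumes "a \<in> A" "x \<in> X" "b \<in> B"
  shows "norm (r (l a x) b) \<le> norm a * norm x * norm b"
proof -
  have "matrix_norm 1 (right_matrix_action 1 r (left_matrix_action 1 l (\<lambda>_ _. a) (\<lambda>_ _. x)) (\<lambda>_ _. b))
      \<le> matrix_norm 1 (\<lambda>_ _. a) * matrix_norm 1 (\<lambda>_ _. x) * matrix_norm 1 (\<lambda>_ _. b)"
    using contr assms unfolding completely_contractive_actions_def matrices_def by blast
  then show ?thesis
    unfolding matrix_norm_one by (simp add: right_matrix_action_def left_matrix_action_def)
qed

text \<open>
  For \<open>z\<close> in the span of \<open>AX\<close> the element \<open>zb\<close> is the limit of \<open>e(zb) = (ez)b\<close>; the bound passes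
  to \<open>X\<close> by continuity of the action of \<open>b\<close>.
\<close>

lemma norm_r_le:
  assumes x: "x \<in> X" and b: "b \<in> B"
  shows "norm (r x b) \<le> norm x * norm b"
proof -
  let ?S = "{l a x | a x. a \<in> A \<and> x \<in> X}"
  obtain F where F: "F \<noteq> bot" "\<forall>\<^sub>F e in F. e \<in> A \<and> norm e \<le> 1"
    "\<And>a. a \<in> A \<Longrightarrow> ((\<lambda>e. e o\<^sub>L a) \<longlongrightarrow> a) F"
    using unitA unfolding approximately_unital_def by blast
  have SX: "?S \<subseteq> X" using l_in by auto
  have main: "norm (r z b) \<le> norm z * norm b" if z: "z \<in> span ?S" for z
  proof -
    let ?S' = "(\<lambda>z. r z b) ` ?S"
    have zX: "z \<in> X" using z SX subX by (meson span_minimal subsetD)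
    have "z \<in> X \<and> r z b \<in> span ?S'"
      using z
    proof (induction rule: span_induct_alt)
      case base
      then show ?case using subspace_0[OF subX] r_zero2[OF b] by (simp add: span_zero)
    next
      case (step c s y)
      have s: "s \<in> X" using step SX by blast
      have "r (c *\<^sub>R s + y) b = c *\<^sub>R r s b + r y b"
        using r_linear[OF b] s step.IH subspace_scale[OF subX s] by (simp add: real_linear_on_def)
      moreover have "r s b \<in> span ?S'" using step.hyps by (intro span_base) blast
      ultimately show ?case
        using step.IH s subX by (simp add: span_add span_scale subspace_add subspace_scale)
    qed
    then have rz: "r z b \<in> span ?S'" ..
    have "((\<lambda>e. l e (r z b)) \<longlongrightarrow> r z b) F"
    proof (rule tendsto_on_span[OF subX _ _ _ rz])
      show "?S' \<subseteq> X" using SX r_in b by blast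
      show "\<forall>\<^sub>F e in F. real_linear_on X (l e)"
        using F(2) by eventually_elim (use l_linear in blast)
    next
      fix s assume "s \<in> ?S'"
      then obtain a y where ay: "a \<in> A" "y \<in> X" and s: "s = r (l a y) b" by blast
      have lim: "((\<lambda>e. norm ((e o\<^sub>L a) - a) * norm y * norm b) \<longlongrightarrow> norm (a - a) * norm y * norm b) F"
        by (intro tendsto_mult tendsto_norm tendsto_diff tendsto_const F(3) ay)
      have le: "\<forall>\<^sub>F e in F. norm (l e s - s) \<le> norm ((e o\<^sub>L a) - a) * norm y * norm b"
        using F(2)
      proof eventually_elim
        case (elim e)
        have ea: "e o\<^sub>L a \<in> A" "(e o\<^sub>L a) - a \<in> A"
          using elim ay mulA subspace_diff[OF subA] by auto
        have "l e s = r (l (e o\<^sub>L a) y) b"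
          using elim ay b by (simp add: s lr l_in r_in l_mult)
        then have "l e s - s = r (l (e o\<^sub>L a) y - l a y) b"
          unfolding s using real_linear_on_diff[OF r_linear[OF b] subX l_in[OF ea(1) ay(2)] l_in[OF ay]] by simp
        also have "l (e o\<^sub>L a) y - l a y = l ((e o\<^sub>L a) - a) y"
          using real_linear_on_diff[OF l_linear2[OF ay(2)] subA ea(1) ay(1)] by simp
        finally show ?case using norm_lr_le[OF ea(2) ay(2) b] by simp
      qed
      have "((\<lambda>e. l e s - s) \<longlongrightarrow> 0) F"
        by (rule Lim_null_comparison[OF le]) (use lim in simp)
      then show "((\<lambda>e. l e s) \<longlongrightarrow> s) F" by (rule LIM_zero_cancel)
    qed
    then have "((\<lambda>e. norm (l e (r z b))) \<longlongrightarrow> norm (r z b)) F" by (rule tendsto_norm)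
    moreover have "\<forall>\<^sub>F e in F. norm (l e (r z b)) \<le> norm z * norm b"
      using F(2)
    proof eventually_elim
      case (elim e)
      have "norm (l e (r z b)) \<le> norm e * norm z * norm b"
        using norm_lr_le[of e z b] elim zX b by (simp add: lr)
      also have "\<dots> \<le> 1 * norm z * norm b" using elim by (intro mult_right_mono) auto
      finally show ?case by simp
    qed
    ultimately show ?thesis by (rule tendsto_upperbound[OF _ _ F(1)])
  qed
  have "x \<in> closure (span ?S)" using nondeg x unfolding nondegenerate_bimodule_def by blast
  then obtain z where z: "\<And>k. z k \<in> span ?S" "z \<longlonglongrightarrow> x"
    unfolding closure_sequential by blast
  have zX: "z k \<in> X" for k using z(1)[of k] SX subX by (meson span_minimal subsetD)
  have "continuous_on X (\<lambda>x. r x b)" using cont b by (simp add: continuous_actions_def)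
  then have "(\<lambda>k. r (z k) b) \<longlonglongrightarrow> r x b"
    using continuous_on_tendsto_compose[OF _ z(2) x] zX by auto
  then have "(\<lambda>k. norm (r (z k) b)) \<longlonglongrightarrow> norm (r x b)" by (rule tendsto_norm)
  moreover have "(\<lambda>k. norm (z k) * norm b) \<longlonglongrightarrow> norm x * norm b" by (intro tendsto_intros z)
  ultimately show ?thesis by (rule LIMSEQ_le) (use main z(1) in blast)
qed

text \<open>Mirror image of \<open>norm_r_le\<close>: an approximate identity of \<open>B\<close>
  acts from the right, and continuity of the action of \<open>a\<close> extends the bound from the
  span of \<open>XB\<close>.\<close>

lemma norm_l_le:
  assumes x: "x \<in> X" and a: "a \<in> A"
  shows "norm (l a x) \<le> norm a * norm x"
proof -
  let ?S = "{r x b | x b. x \<in> X \<and> b \<in> B}"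
  obtain F where F: "F \<noteq> bot" "\<forall>\<^sub>F e in F. e \<in> B \<and> norm e \<le> 1"
    "\<And>b. b \<in> B \<Longrightarrow> ((\<lambda>e. b o\<^sub>L e) \<longlongrightarrow> b) F"
    using unitB unfolding approximately_unital_def by blast
  have SX: "?S \<subseteq> X" using r_in by auto
  have main: "norm (l a z) \<le> norm a * norm z" if z: "z \<in> span ?S" for z
  proof -
    let ?S' = "l a ` ?S"
    have zX: "z \<in> X" using z SX subX by (meson span_minimal subsetD)
    have "z \<in> X \<and> l a z \<in> span ?S'"
      using z
    proof (induction rule: span_induct_alt)
      case base
      then show ?case using subspace_0[OF subX] l_zero2[OF a] by (simp add: span_zero)
    next
      case (step c s y)
      have s: "s \<in> X" using step SX by blast
      have "l a (c *\<^sub>R s + y) = c *\<^sub>R l a s + l a y"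
        using l_linear[OF a] s step.IH subspace_scale[OF subX s] by (simp add: real_linear_on_def)
      moreover have "l a s \<in> span ?S'" using step.hyps by (intro span_base) blast
      ultimately show ?case
        using step.IH s subX by (simp add: span_add span_scale subspace_add subspace_scale)
    qed
    then have lz: "l a z \<in> span ?S'" ..
    have "((\<lambda>e. r (l a z) e) \<longlongrightarrow> l a z) F"
    proof (rule tendsto_on_span[OF subX _ _ _ lz])
      show "?S' \<subseteq> X" using SX l_in a by blast
      show "\<forall>\<^sub>F e in F. real_linear_on X (\<lambda>x. r x e)"
        using F(2) by eventually_elim (use r_linear in blast)
    next
      fix s assume "s \<in> ?S'"
      then obtain b y where yb: "y \<in> X" "b \<in> B" and s: "s = l a (r y b)" by blast
      have s2: "s = r (l a y) b" using yb a by (simp add: s lr)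
      have lim: "((\<lambda>e. norm a * norm y * norm ((b o\<^sub>L e) - b)) \<longlongrightarrow> norm a * norm y * norm (b - b)) F"
        by (intro tendsto_mult tendsto_norm tendsto_diff tendsto_const F(3) yb)
      have le: "\<forall>\<^sub>F e in F. norm (r s e - s) \<le> norm a * norm y * norm ((b o\<^sub>L e) - b)"
        using F(2)
      proof eventually_elim
        case (elim e)
        have be: "b o\<^sub>L e \<in> B" "(b o\<^sub>L e) - b \<in> B"
          using elim yb mulB subspace_diff[OF subB] by auto
        have "r s e = r (l a y) (b o\<^sub>L e)"
          using elim yb a by (simp add: s2 l_in r_mult)
        then have "r s e - s = r (l a y) ((b o\<^sub>L e) - b)"
          unfolding s2 using real_linear_on_diff[OF r_linear2[OF l_in[OF a yb(1)]] subB be(1) yb(2)] by simp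
        then show ?case using norm_lr_le[OF a yb(1) be(2)] by simp
      qed
      have "((\<lambda>e. r s e - s) \<longlongrightarrow> 0) F"
        by (rule Lim_null_comparison[OF le]) (use lim in simp)
      then show "((\<lambda>e. r s e) \<longlongrightarrow> s) F" by (rule LIM_zero_cancel)
    qed
    then have "((\<lambda>e. norm (r (l a z) e)) \<longlongrightarrow> norm (l a z)) F" by (rule tendsto_norm)
    moreover have "\<forall>\<^sub>F e in F. norm (r (l a z) e) \<le> norm a * norm z"
      using F(2)
    proof eventually_elim
      case (elim e)
      have "norm (r (l a z) e) \<le> norm a * norm z * norm e"
        using norm_lr_le[of a z e] elim zX a by simp
      also have "\<dots> \<le> norm a * norm z * 1" using elim by (intro mult_left_mono) auto
      finally show ?case by simp
    qed
    ultimately show ?thesis by (rule tendsto_upperbound[OF _ _ F(1)])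
  qed
  have "x \<in> closure (span ?S)" using nondeg x unfolding nondegenerate_bimodule_def by blast
  then obtain z where z: "\<And>k. z k \<in> span ?S" "z \<longlonglongrightarrow> x"
    unfolding closure_sequential by blast
  have zX: "z k \<in> X" for k using z(1)[of k] SX subX by (meson span_minimal subsetD)
  have "continuous_on X (l a)" using cont a by (simp add: continuous_actions_def)
  then have "(\<lambda>k. l a (z k)) \<longlonglongrightarrow> l a x"
    using continuous_on_tendsto_compose[OF _ z(2) x] zX by auto
  then have "(\<lambda>k. norm (l a (z k))) \<longlonglongrightarrow> norm (l a x)" by (rule tendsto_norm)
  moreover have "(\<lambda>k. norm a * norm (z k)) \<longlonglongrightarrow> norm a * norm x" by (intro tendsto_intros z)
  ultimately show ?thesis by (rule LIMSEQ_le) (use main z(1) in blast)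
qed

text \<open>On products \<open>yb\<close> the convergence is that of the approximate identity.
  Nondegeneracy and the uniform bound \<open>norm_r_le\<close> extend it to all of \<open>X\<close>,
  so that approximate identities can later be removed from estimates.\<close>

lemma tendsto_r_unit:
  assumes F: "\<forall>\<^sub>F e in F. e \<in> B \<and> norm e \<le> 1" "\<And>b. b \<in> B \<Longrightarrow> ((\<lambda>e. b o\<^sub>L e) \<longlongrightarrow> b) F"
    and x: "x \<in> X"
  shows "((\<lambda>e. r x e) \<longlongrightarrow> x) F"
proof (rule tendsto_on_closure_span[OF subX])
  show "{r x b | x b. x \<in> X \<and> b \<in> B} \<subseteq> X" using r_in by blast
  show "x \<in> closure (span {r x b | x b. x \<in> X \<and> b \<in> B})"
    using nondeg x unfolding nondegenerate_bimodule_def by blast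
  show "\<forall>\<^sub>F e in F. real_linear_on X (\<lambda>x. r x e)"
    using F(1) by eventually_elim (use r_linear in blast)
  show "\<forall>\<^sub>F e in F. \<forall>x\<in>X. norm (r x e) \<le> norm x"
    using F(1)
  proof eventually_elim
    case (elim e)
    show ?case
    proof
      fix y assume "y \<in> X"
      then have "norm (r y e) \<le> norm y * norm e" using elim norm_r_le by blast
      also have "\<dots> \<le> norm y * 1" using elim by (intro mult_left_mono) auto
      finally show "norm (r y e) \<le> norm y" by simp
    qed
  qed
  fix s assume "s \<in> {r x b | x b. x \<in> X \<and> b \<in> B}"
  then obtain y b where yb: "y \<in> X" "b \<in> B" and s: "s = r y b" by blast
  have lim: "((\<lambda>e. norm y * norm ((b o\<^sub>L e) - b)) \<longlongrightarrow> norm y * norm (b - b)) F"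
    by (intro tendsto_mult tendsto_norm tendsto_diff tendsto_const F(2) yb)
  have le: "\<forall>\<^sub>F e in F. norm (r s e - s) \<le> norm y * norm ((b o\<^sub>L e) - b)"
    using F(1)
  proof eventually_elim
    case (elim e)
    have be: "b o\<^sub>L e \<in> B" "(b o\<^sub>L e) - b \<in> B"
      using elim yb mulB subspace_diff[OF subB] by auto
    have "r s e - s = r y ((b o\<^sub>L e) - b)"
      using real_linear_on_diff[OF r_linear2[OF yb(1)] subB be(1) yb(2)] elim yb by (simp add: s r_mult)
    then show ?case using norm_r_le[OF yb(1) be(2)] by simp
  qed
  have "((\<lambda>e. r s e - s) \<longlongrightarrow> 0) F"
    by (rule Lim_null_comparison[OF le]) (use lim in simp)
  then show "((\<lambda>e. r s e) \<longlongrightarrow> s) F" by (rule LIM_zero_cancel)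
qed (rule x)

lemma tendsto_l_unit:
  assumes F: "\<forall>\<^sub>F e in F. e \<in> A \<and> norm e \<le> 1" "\<And>a. a \<in> A \<Longrightarrow> ((\<lambda>e. e o\<^sub>L a) \<longlongrightarrow> a) F"
    and x: "x \<in> X"
  shows "((\<lambda>e. l e x) \<longlongrightarrow> x) F"
proof (rule tendsto_on_closure_span[OF subX])
  show "{l a x | a x. a \<in> A \<and> x \<in> X} \<subseteq> X" using l_in by blast
  show "x \<in> closure (span {l a x | a x. a \<in> A \<and> x \<in> X})"
    using nondeg x unfolding nondegenerate_bimodule_def by blast
  show "\<forall>\<^sub>F e in F. real_linear_on X (l e)"
    using F(1) by eventually_elim (use l_linear in blast)
  show "\<forall>\<^sub>F e in F. \<forall>x\<in>X. norm (l e x) \<le> norm x"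
    using F(1)
  proof eventually_elim
    case (elim e)
    show ?case
    proof
      fix y assume "y \<in> X"
      then have "norm (l e y) \<le> norm e * norm y" using elim norm_l_le by blast
      also have "\<dots> \<le> 1 * norm y" using elim by (intro mult_right_mono) auto
      finally show "norm (l e y) \<le> norm y" by simp
    qed
  qed
  fix s assume "s \<in> {l a x | a x. a \<in> A \<and> x \<in> X}"
  then obtain a y where ay: "a \<in> A" "y \<in> X" and s: "s = l a y" by blast
  have lim: "((\<lambda>e. norm ((e o\<^sub>L a) - a) * norm y) \<longlongrightarrow> norm (a - a) * norm y) F"
    by (intro tendsto_mult tendsto_norm tendsto_diff tendsto_const F(2) ay)
  have le: "\<forall>\<^sub>F e in F. norm (l e s - s) \<le> norm ((e o\<^sub>L a) - a) * norm y"
    using F(1)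
  proof eventually_elim
    case (elim e)
    have ea: "e o\<^sub>L a \<in> A" "(e o\<^sub>L a) - a \<in> A"
      using elim ay mulA subspace_diff[OF subA] by auto
    have "l e s - s = l ((e o\<^sub>L a) - a) y"
      using real_linear_on_diff[OF l_linear2[OF ay(2)] subA ea(1) ay(1)] elim ay by (simp add: s l_mult)
    then show ?case using norm_l_le[OF ay(2) ea(2)] by simp
  qed
  have "((\<lambda>e. l e s - s) \<longlongrightarrow> 0) F"
    by (rule Lim_null_comparison[OF le]) (use lim in simp)
  then show "((\<lambda>e. l e s) \<longlongrightarrow> s) F" by (rule LIM_zero_cancel)
qed (rule x)

end

section \<open>The representation attached to a family of states\<close>

text \<open>Entries from \<open>n\<close> on are fixed to 0, so that a row is determined by its
  first \<open>n\<close> entries; the comparison with the size of the index type relies on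
  this.\<close>

definition row_space :: "nat \<Rightarrow> 'b::real_vector set \<Rightarrow> (nat \<Rightarrow> 'b) set"
  where "row_space n B = {\<beta>. \<forall>j. \<beta> j \<in> B \<and> (n \<le> j \<longrightarrow> \<beta> j = 0)}"

definition row_families :: "('p \<Rightarrow> nat) \<Rightarrow> 'b::real_vector set \<Rightarrow> ('p \<Rightarrow> nat \<Rightarrow> 'b) set"
  where "row_families n B = {\<beta>. finite {p. \<beta> p \<noteq> 0} \<and> (\<forall>p. \<beta> p \<in> row_space (n p) B)}"

definition lmult :: "('h::real_normed_vector \<Rightarrow>\<^sub>L 'h) \<Rightarrow> ('p \<Rightarrow> nat \<Rightarrow> ('h \<Rightarrow>\<^sub>L 'h)) \<Rightarrow> 'p \<Rightarrow> nat \<Rightarrow> ('h \<Rightarrow>\<^sub>L 'h)"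
  where "lmult b \<beta> = (\<lambda>p j. b o\<^sub>L \<beta> p j)"

definition single_row :: "'p \<Rightarrow> (nat \<Rightarrow> 'b::real_vector) \<Rightarrow> 'p \<Rightarrow> nat \<Rightarrow> 'b"
  where "single_row p \<beta> = (\<lambda>q. if q = p then \<beta> else 0)"

lemma subspace_row_space:
  assumes "subspace B" shows "subspace (row_space n B)"
  by (rule subspaceI)
    (auto simp: row_space_def subspace_0[OF assms] subspace_add[OF assms] subspace_scale[OF assms])

lemma subspace_row_families:
  assumes "subspace B" shows "subspace (row_families n B)"
proof (rule subspaceI)
  note sub = subspace_row_space[OF assms]
  show "0 \<in> row_families n B"
    using subspace_0[OF sub] by (simp add: row_families_def)
  show "\<beta> + \<gamma> \<in> row_families n B" if "\<beta> \<in> row_families n B" "\<gamma> \<in> row_families n B" for \<beta> \<gamma>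
  proof -
    have "finite {p. (\<beta> + \<gamma>) p \<noteq> 0}"
      by (rule finite_subset[of _ "{p. \<beta> p \<noteq> 0} \<union> {p. \<gamma> p \<noteq> 0}"]) (use that in \<open>auto simp: row_families_def\<close>)
    then show ?thesis using that subspace_add[OF sub] by (simp add: row_families_def)
  qed
  show "c *\<^sub>R \<beta> \<in> row_families n B" if "\<beta> \<in> row_families n B" for c \<beta>
  proof -
    have "finite {p. (c *\<^sub>R \<beta>) p \<noteq> 0}"
      by (rule finite_subset[of _ "{p. \<beta> p \<noteq> 0}"]) (use that in \<open>auto simp: row_families_def\<close>)
    then show ?thesis using that subspace_scale[OF sub] by (simp add: row_families_def)
  qed
qed

lemma finite_support: "\<beta> \<in> row_families n B \<Longrightarrow> finite {p. \<beta> p \<noteq> 0}"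
  by (simp add: row_families_def)

lemma row_families_row: "\<beta> \<in> row_families n B \<Longrightarrow> \<beta> p \<in> row_space (n p) B"
  by (simp add: row_families_def)

lemma single_row_in: "subspace B \<Longrightarrow> \<beta> \<in> row_space (n p) B \<Longrightarrow> single_row p \<beta> \<in> row_families n B"
  using subspace_0[OF subspace_row_space]
  by (auto simp: row_families_def single_row_def)

lemma lmult_in:
  assumes "real_operator_algebra B" and "b \<in> B" and "\<beta> \<in> row_families n B"
  shows "lmult b \<beta> \<in> row_families n B"
proof -
  have "finite {p. lmult b \<beta> p \<noteq> 0}"
    by (rule finite_subset[OF _ finite_support[OF assms(3)]]) (auto simp: lmult_def zero_fun_def)
  then show ?thesis
    using assms by (auto simp: row_families_def row_space_def real_operator_algebra_def lmult_def)
qed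

lemma lmult_add: "lmult (a + b) \<beta> = lmult a \<beta> + lmult b \<beta>"
  by (intro ext blinfun_eqI) (simp add: lmult_def blinfun.add_left)

lemma lmult_scaleR: "lmult (c *\<^sub>R a) \<beta> = c *\<^sub>R lmult a \<beta>"
  by (intro ext blinfun_eqI) (simp add: lmult_def blinfun.scaleR_left)

lemma lmult_add_right: "lmult a (\<beta> + \<gamma>) = lmult a \<beta> + lmult a \<gamma>"
  by (intro ext blinfun_eqI) (simp add: lmult_def blinfun.add_left blinfun.add_right)

lemma lmult_scaleR_right: "lmult a (c *\<^sub>R \<beta>) = c *\<^sub>R lmult a \<beta>"
  by (intro ext blinfun_eqI) (simp add: lmult_def blinfun.scaleR_left blinfun.scaleR_right)

lemma lmult_compose: "lmult (a o\<^sub>L b) \<beta> = lmult a (lmult b \<beta>)"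
  by (intro ext blinfun_eqI) (simp add: lmult_def)

lemma real_linear_on_sum:
  assumes "real_linear_on X f" and "subspace X" and "\<And>i. i \<in> I \<Longrightarrow> x i \<in> X"
  shows "f (\<Sum>i\<in>I. x i) = (\<Sum>i\<in>I. f (x i))"
proof -
  have f0: "f 0 = 0"
    using assms(1) subspace_0[OF assms(2)] unfolding real_linear_on_def by (metis scaleR_zero_left)
  show ?thesis
    using assms(3)
  proof (induction I rule: infinite_finite_induct)
    case (insert i I)
    then have "(\<Sum>i\<in>I. x i) \<in> X" by (intro subspace_sum assms(2)) auto
    then show ?case using insert assms(1) by (simp add: real_linear_on_def)
  qed (simp_all add: f0)
qed

lemma bounded_operators_UNIV: "bounded_operators UNIV UNIV = UNIV"
proof -
  have "blinfun_apply T u = 0" if "\<forall>k. orthogonal k u" for T :: "'a \<Rightarrow>\<^sub>L 'a" and u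
  proof -
    have "u = 0" using that[rule_format, of u] by (simp add: orthogonal_def)
    then show ?thesis by (simp add: blinfun.zero_right)
  qed
  then show ?thesis by (auto simp: bounded_operators_def)
qed

text \<open>The orthogonal sum of the Hilbert spaces generated by the states \<open>t p\<close>,
  realised on the whole of \<open>'i ell2\<close>. Linearity of \<open>\<phi> p\<close> is not
  assumed; it is forced by the Gram relations together with totality.\<close>

locale gram_representation =
  fixes B :: "('h::{real_inner, complete_space} \<Rightarrow>\<^sub>L 'h) set"
    and n :: "'p \<Rightarrow> nat"
    and t :: "'p \<Rightarrow> (nat \<Rightarrow> ('h \<Rightarrow>\<^sub>L 'h)) \<Rightarrow> (nat \<Rightarrow> ('h \<Rightarrow>\<^sub>L 'h)) \<Rightarrow> real"
    and \<phi> :: "'p \<Rightarrow> (nat \<Rightarrow> ('h \<Rightarrow>\<^sub>L 'h)) \<Rightarrow> 'i ell2"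
  assumes algebra: "real_operator_algebra B"
    and unital: "approximately_unital B"
    and states: "t p \<in> row_states (n p)"
    and gram: "\<beta> \<in> row_space (n p) B \<Longrightarrow> \<gamma> \<in> row_space (n q) B \<Longrightarrow>
      \<phi> p \<beta> \<bullet> \<phi> q \<gamma> = (if p = q then t p \<beta> \<gamma> else 0)"
    and total: "(\<And>p \<beta>. \<beta> \<in> row_space (n p) B \<Longrightarrow> y \<bullet> \<phi> p \<beta> = 0) \<Longrightarrow> y = 0"
begin

abbreviation "V \<equiv> row_families n B"

lemma sub_B: "subspace B"
  using algebra by (simp add: real_operator_algebra_def)

lemmas sub_V = subspace_row_families[OF sub_B, of n]
lemmas sub_row = subspace_row_space[OF sub_B]

text \<open>The difference of the two sides has, by the Gram relations, inner product 0 with every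
  vector of a total family.\<close>

lemma phi_add:
  assumes "\<beta> \<in> row_space (n p) B" "\<gamma> \<in> row_space (n p) B"
  shows "\<phi> p (\<beta> + \<gamma>) = \<phi> p \<beta> + \<phi> p \<gamma>"
proof -
  have "\<phi> p (\<beta> + \<gamma>) - (\<phi> p \<beta> + \<phi> p \<gamma>) = 0"
  proof (rule total)
    fix q \<delta> assume "\<delta> \<in> row_space (n q) B"
    then show "(\<phi> p (\<beta> + \<gamma>) - (\<phi> p \<beta> + \<phi> p \<gamma>)) \<bullet> \<phi> q \<delta> = 0"
      using assms subspace_add[OF sub_row assms] linear_add[OF row_states_linear[OF states, of p \<delta>]]
      by (auto simp: inner_diff_left inner_add_left gram)
  qed
  then show ?thesis by simp
qed

lemma phi_scaleR:
  assumes "\<beta> \<in> row_space (n p) B"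
  shows "\<phi> p (c *\<^sub>R \<beta>) = c *\<^sub>R \<phi> p \<beta>"
proof -
  have "\<phi> p (c *\<^sub>R \<beta>) - c *\<^sub>R \<phi> p \<beta> = 0"
  proof (rule total)
    fix q \<delta> assume "\<delta> \<in> row_space (n q) B"
    then show "(\<phi> p (c *\<^sub>R \<beta>) - c *\<^sub>R \<phi> p \<beta>) \<bullet> \<phi> q \<delta> = 0"
      using assms subspace_scale[OF sub_row assms] linear_scale[OF row_states_linear[OF states, of p \<delta>]]
      by (auto simp: inner_diff_left gram)
  qed
  then show ?thesis by simp
qed

lemma phi_zero: "\<phi> p 0 = 0"
  using phi_scaleR[of 0 p 0] subspace_0[OF sub_row] by simp

definition vec :: "('p \<Rightarrow> nat \<Rightarrow> ('h \<Rightarrow>\<^sub>L 'h)) \<Rightarrow> 'i ell2"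
  where "vec \<beta> = (\<Sum>p | \<beta> p \<noteq> 0. \<phi> p (\<beta> p))"

lemma vec_eq:
  assumes "finite S" and "{p. \<beta> p \<noteq> 0} \<subseteq> S"
  shows "vec \<beta> = (\<Sum>p\<in>S. \<phi> p (\<beta> p))"
  unfolding vec_def using assms by (intro sum.mono_neutral_left) (auto simp: phi_zero)

lemma vec_linear: "real_linear_on V vec"
  unfolding real_linear_on_def
proof (intro conjI ballI allI)
  fix \<beta> \<gamma> assume V: "\<beta> \<in> V" "\<gamma> \<in> V"
  let ?S = "{p. \<beta> p \<noteq> 0} \<union> {p. \<gamma> p \<noteq> 0}"
  have S: "finite ?S" using V by (simp add: finite_support)
  have "vec (\<beta> + \<gamma>) = (\<Sum>p\<in>?S. \<phi> p (\<beta> p + \<gamma> p))"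
    by (subst vec_eq[OF S]) auto
  also have "\<dots> = (\<Sum>p\<in>?S. \<phi> p (\<beta> p)) + (\<Sum>p\<in>?S. \<phi> p (\<gamma> p))"
    using V by (simp add: phi_add row_families_row sum.distrib)
  also have "\<dots> = vec \<beta> + vec \<gamma>"
    by (intro arg_cong2[where f = "(+)"] vec_eq[OF S, symmetric]) auto
  finally show "vec (\<beta> + \<gamma>) = vec \<beta> + vec \<gamma>" .
next
  fix c \<beta> assume V: "\<beta> \<in> V"
  have "vec (c *\<^sub>R \<beta>) = (\<Sum>p | \<beta> p \<noteq> 0. \<phi> p (c *\<^sub>R \<beta> p))"
    by (subst vec_eq[OF finite_support[OF V]]) auto
  then show "vec (c *\<^sub>R \<beta>) = c *\<^sub>R vec \<beta>"
    using V by (simp add: phi_scaleR row_families_row vec_def scaleR_sum_right)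
qed

lemma vec_add: "\<beta> \<in> V \<Longrightarrow> \<gamma> \<in> V \<Longrightarrow> vec (\<beta> + \<gamma>) = vec \<beta> + vec \<gamma>"
  using vec_linear by (simp add: real_linear_on_def)

lemma vec_scaleR: "\<beta> \<in> V \<Longrightarrow> vec (c *\<^sub>R \<beta>) = c *\<^sub>R vec \<beta>"
  using vec_linear by (simp add: real_linear_on_def)

lemma inner_vec:
  assumes "\<beta> \<in> V" and "\<gamma> \<in> V"
  shows "vec \<beta> \<bullet> vec \<gamma> = (\<Sum>p | \<beta> p \<noteq> 0. t p (\<beta> p) (\<gamma> p))"
proof -
  have "\<phi> p (\<beta> p) \<bullet> vec \<gamma> = t p (\<beta> p) (\<gamma> p)" for p
  proof -
    have fin: "finite (insert p {p. \<gamma> p \<noteq> 0})" using finite_support[OF assms(2)] by simp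
    have "\<phi> p (\<beta> p) \<bullet> vec \<gamma> = (\<Sum>q\<in>insert p {p. \<gamma> p \<noteq> 0}. \<phi> p (\<beta> p) \<bullet> \<phi> q (\<gamma> q))"
      by (subst vec_eq[OF fin]) (auto simp: inner_sum_right)
    also have "\<dots> = (\<Sum>q\<in>insert p {p. \<gamma> p \<noteq> 0}. if p = q then t p (\<beta> p) (\<gamma> q) else 0)"
      using assms by (intro sum.cong refl gram) (auto simp: row_families_row)
    also have "\<dots> = t p (\<beta> p) (\<gamma> p)" using fin by (simp add: sum.delta)
    finally show ?thesis .
  qed
  then show ?thesis by (simp add: vec_def[of \<beta>] inner_sum_left)
qed

lemma norm_vec:
  assumes "\<beta> \<in> V" and "finite S" and "{p. \<beta> p \<noteq> 0} \<subseteq> S"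
  shows "(norm (vec \<beta>))\<^sup>2 = (\<Sum>p\<in>S. t p (\<beta> p) (\<beta> p))"
  unfolding power2_norm_eq_inner inner_vec[OF assms(1,1)]
  using assms by (intro sum.mono_neutral_left) (auto simp: row_states_zero[OF states])

lemma vec_single: "\<beta> \<in> row_space (n p) B \<Longrightarrow> vec (single_row p \<beta>) = \<phi> p \<beta>"
  by (subst vec_eq[of "{p}"]) (auto simp: single_row_def)

lemma norm_vec_single:
  "\<beta> \<in> row_space (n p) B \<Longrightarrow> (norm (vec (single_row p \<beta>)))\<^sup>2 = t p \<beta> \<beta>"
  by (simp add: vec_single power2_norm_eq_inner gram)

lemma vec_dense: "closure (vec ` V) = UNIV"
proof (rule dense_if_total)
  show "subspace (vec ` V)"
  proof (rule subspaceI)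
    have "vec 0 = 0" by (simp add: vec_def)
    then show "0 \<in> vec ` V" using subspace_0[OF sub_V] by (metis image_eqI)
    show "x + y \<in> vec ` V" if "x \<in> vec ` V" "y \<in> vec ` V" for x y
      using that subspace_add[OF sub_V] by (auto simp flip: vec_add)
    show "c *\<^sub>R x \<in> vec ` V" if "x \<in> vec ` V" for c x
      using that subspace_scale[OF sub_V] by (auto simp flip: vec_scaleR)
  qed
  show "x = 0" if "\<And>y. y \<in> vec ` V \<Longrightarrow> x \<bullet> y = 0" for x
  proof (rule total)
    fix p \<beta> assume "\<beta> \<in> row_space (n p) B"
    then show "x \<bullet> \<phi> p \<beta> = 0"
      using that[OF imageI[OF single_row_in[OF sub_B, of \<beta> n p]]] vec_single[of \<beta> p] by simp
  qed
qed

text \<open>The estimate holds in each of the finitely many blocks that occur, and blocks are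
  orthogonal. All entries of \<open>b\<close> act together, which gives complete contractivity of
  the representation.\<close>

lemma matrix_action_bound:
  assumes b: "b \<in> matrices m B" and \<beta>: "\<And>l. \<beta> l \<in> V"
  shows "(\<Sum>i<m. (norm (vec (\<Sum>l<m. lmult (b i l) (\<beta> l))))\<^sup>2)
    \<le> (matrix_norm m b)\<^sup>2 * (\<Sum>l<m. (norm (vec (\<beta> l)))\<^sup>2)"
proof -
  define S where "S = (\<Union>l<m. {p. \<beta> l p \<noteq> 0})"
  have S: "finite S" unfolding S_def using finite_support[OF \<beta>] by auto
  have row: "(\<Sum>l<m. lmult (b i l) (\<beta> l)) p = (\<lambda>j. \<Sum>l<m. b i l o\<^sub>L \<beta> l p j)" for i p
    by (rule ext) (simp add: sum_fun_apply lmult_def)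
  have in_V: "(\<Sum>l<m. lmult (b i l) (\<beta> l)) \<in> V" if "i < m" for i
    using that b \<beta> by (intro subspace_sum[OF sub_V] lmult_in[OF algebra]) (auto simp: matrices_def)
  have supp: "{p. (\<Sum>l<m. lmult (b i l) (\<beta> l)) p \<noteq> 0} \<subseteq> S" for i
  proof
    fix p assume "p \<in> {p. (\<Sum>l<m. lmult (b i l) (\<beta> l)) p \<noteq> 0}"
    then have "\<exists>l\<in>{..<m}. lmult (b i l) (\<beta> l) p \<noteq> 0"
      by (metis (mono_tags, lifting) mem_Collect_eq sum.neutral sum_fun_apply)
    then show "p \<in> S" by (auto simp: S_def lmult_def zero_fun_def)
  qed
  have "(\<Sum>i<m. (norm (vec (\<Sum>l<m. lmult (b i l) (\<beta> l))))\<^sup>2)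
    = (\<Sum>i<m. \<Sum>p\<in>S. t p (\<lambda>j. \<Sum>l<m. b i l o\<^sub>L \<beta> l p j) (\<lambda>j. \<Sum>l<m. b i l o\<^sub>L \<beta> l p j))"
    by (intro sum.cong refl) (subst norm_vec[OF in_V S supp], auto simp: row)
  also have "\<dots> = (\<Sum>p\<in>S. \<Sum>i<m. t p (\<lambda>j. \<Sum>l<m. b i l o\<^sub>L \<beta> l p j) (\<lambda>j. \<Sum>l<m. b i l o\<^sub>L \<beta> l p j))"
    by (rule sum.swap)
  also have "\<dots> \<le> (\<Sum>p\<in>S. (matrix_norm m b)\<^sup>2 * (\<Sum>l<m. t p (\<beta> l p) (\<beta> l p)))"
    by (intro sum_mono row_states_matrix_mult[OF states])
  also have "\<dots> = (matrix_norm m b)\<^sup>2 * (\<Sum>l<m. \<Sum>p\<in>S. t p (\<beta> l p) (\<beta> l p))"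
    unfolding sum_distrib_left[symmetric] by (simp add: sum.swap[of _ S])
  also have "(\<Sum>l<m. \<Sum>p\<in>S. t p (\<beta> l p) (\<beta> l p)) = (\<Sum>l<m. (norm (vec (\<beta> l)))\<^sup>2)"
    by (intro sum.cong refl norm_vec[symmetric] \<beta> S) (auto simp: S_def)
  finally show ?thesis .
qed

lemma action_bound:
  assumes "b \<in> B" and "\<beta> \<in> V"
  shows "norm (vec (lmult b \<beta>)) \<le> norm b * norm (vec \<beta>)"
proof -
  have "(norm (vec (lmult b \<beta>)))\<^sup>2 \<le> (norm b * norm (vec \<beta>))\<^sup>2"
    using matrix_action_bound[of "\<lambda>_ _. b" 1 "\<lambda>_. \<beta>"] assms matrix_norm_one[of "\<lambda>_ _. b"]
    by (simp add: matrices_def power_mult_distrib)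
  then show ?thesis by (rule power2_le_imp_le) simp
qed

definition rep :: "('h \<Rightarrow>\<^sub>L 'h) \<Rightarrow> ('i ell2 \<Rightarrow>\<^sub>L 'i ell2)"
  where "rep b = (SOME T. \<forall>\<beta>\<in>V. blinfun_apply T (vec \<beta>) = vec (lmult b \<beta>))"

lemma rep_vec:
  assumes b: "b \<in> B" and "\<beta> \<in> V"
  shows "blinfun_apply (rep b) (vec \<beta>) = vec (lmult b \<beta>)"
proof -
  have lin: "vec (lmult b (\<beta> + \<gamma>)) = vec (lmult b \<beta>) + vec (lmult b \<gamma>)"
    "vec (lmult b (c *\<^sub>R \<beta>)) = c *\<^sub>R vec (lmult b \<beta>)" if "\<beta> \<in> V" "\<gamma> \<in> V" for \<beta> \<gamma> c
    using lmult_in[OF algebra b that(1)] lmult_in[OF algebra b that(2)]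
    by (simp_all add: lmult_add_right lmult_scaleR_right vec_add vec_scaleR)
  obtain T where T: "\<And>\<beta> \<gamma>. \<beta> \<in> V \<Longrightarrow> \<gamma> \<in> V \<Longrightarrow> blinfun_apply T (vec \<beta>) \<bullet> vec \<gamma> = vec (lmult b \<beta>) \<bullet> vec \<gamma>"
  proof (rule operator_of_form[OF sub_V sub_V vec_linear vec_linear vec_dense vec_dense,
        where m = "\<lambda>\<beta> \<gamma>. vec (lmult b \<beta>) \<bullet> vec \<gamma>" and C = "norm b"])
    show "real_linear_on V (\<lambda>\<beta>. vec (lmult b \<beta>) \<bullet> vec \<gamma>)" if "\<gamma> \<in> V" for \<gamma>
      by (auto simp: real_linear_on_def lin inner_add_left)
    show "real_linear_on V (\<lambda>\<gamma>. vec (lmult b \<beta>) \<bullet> vec \<gamma>)" for \<beta>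
      using vec_linear by (auto simp: real_linear_on_def inner_add_right)
    show "\<bar>vec (lmult b \<beta>) \<bullet> vec \<gamma>\<bar> \<le> norm b * norm (vec \<beta>) * norm (vec \<gamma>)"
      if "\<beta> \<in> V" "\<gamma> \<in> V" for \<beta> \<gamma>
      using Cauchy_Schwarz_ineq2[of "vec (lmult b \<beta>)" "vec \<gamma>"]
        mult_right_mono[OF action_bound[OF b that(1)] norm_ge_zero[of "vec \<gamma>"]] by linarith
  qed blast
  have "blinfun_apply T (vec \<beta>) = vec (lmult b \<beta>)" if "\<beta> \<in> V" for \<beta>
    by (rule dense_inner_eqI[OF vec_dense]) (use T that in auto)
  then have "\<forall>\<beta>\<in>V. blinfun_apply (rep b) (vec \<beta>) = vec (lmult b \<beta>)"
    unfolding rep_def by (intro someI[where P = "\<lambda>T. \<forall>\<beta>\<in>V. blinfun_apply T (vec \<beta>) = vec (lmult b \<beta>)"]) blast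
  then show ?thesis using assms(2) by blast
qed

lemma rep_representation: "operator_representation B UNIV rep"
  unfolding operator_representation_def real_linear_on_def bounded_operators_UNIV
proof (intro conjI ballI allI subset_UNIV)
  fix a b assume ab: "a \<in> B" "b \<in> B"
  note lm = lmult_in[OF algebra]
  show "rep (a + b) = rep a + rep b"
  proof (rule blinfun_eq_on_dense[OF vec_dense], clarify)
    fix \<beta> assume "\<beta> \<in> V"
    then show "blinfun_apply (rep (a + b)) (vec \<beta>) = blinfun_apply (rep a + rep b) (vec \<beta>)"
      using ab lm[of a \<beta> n] lm[of b \<beta> n] subspace_add[OF sub_B ab]
      by (simp add: rep_vec lmult_add blinfun.add_left vec_add)
  qed
  show "rep (a o\<^sub>L b) = rep a o\<^sub>L rep b"
  proof (rule blinfun_eq_on_dense[OF vec_dense], clarify)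
    fix \<beta> assume "\<beta> \<in> V"
    moreover have "a o\<^sub>L b \<in> B" using ab algebra by (simp add: real_operator_algebra_def)
    ultimately show "blinfun_apply (rep (a o\<^sub>L b)) (vec \<beta>) = blinfun_apply (rep a o\<^sub>L rep b) (vec \<beta>)"
      using ab lm[of b \<beta> n] by (simp add: rep_vec lmult_compose)
  qed
next
  fix c a assume a: "a \<in> B"
  show "rep (c *\<^sub>R a) = c *\<^sub>R rep a"
  proof (rule blinfun_eq_on_dense[OF vec_dense], clarify)
    fix \<beta> assume "\<beta> \<in> V"
    then show "blinfun_apply (rep (c *\<^sub>R a)) (vec \<beta>) = blinfun_apply (c *\<^sub>R rep a) (vec \<beta>)"
      using a lmult_in[OF algebra a, of \<beta> n] subspace_scale[OF sub_B a]
      by (simp add: rep_vec lmult_scaleR blinfun.scaleR_left vec_scaleR)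
  qed
qed

lemma rep_matrix_vec:
  assumes "b \<in> matrices m B" and "\<And>l. \<beta> l \<in> V" and "i < m"
  shows "(\<Sum>l<m. blinfun_apply (rep (b i l)) (vec (\<beta> l))) = vec (\<Sum>l<m. lmult (b i l) (\<beta> l))"
proof -
  have b: "b i l \<in> B" if "l < m" for l using assms that by (auto simp: matrices_def)
  have "vec (\<Sum>l<m. lmult (b i l) (\<beta> l)) = (\<Sum>l<m. vec (lmult (b i l) (\<beta> l)))"
    using b assms(2) by (intro real_linear_on_sum[OF vec_linear sub_V] lmult_in[OF algebra]) auto
  then show ?thesis using b assms(2) by (simp add: rep_vec)
qed

lemma rep_contractive:
  assumes "b \<in> matrices m B"
  shows "matrix_norm m (\<lambda>i j. rep (b i j)) \<le> matrix_norm m b"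
proof (rule matrix_norm_leI_dense[OF matrix_norm_nonneg vec_dense])
  fix v :: "nat \<Rightarrow> 'i ell2" assume "\<And>j. v j \<in> vec ` V"
  then have "\<forall>j. \<exists>\<beta>. \<beta> \<in> V \<and> v j = vec \<beta>" by blast
  then obtain \<beta> where \<beta>: "\<And>j. \<beta> j \<in> V" "\<And>j. v j = vec (\<beta> j)" by metis
  then show "(\<Sum>i<m. (norm (\<Sum>j<m. blinfun_apply (rep (b i j)) (v j)))\<^sup>2)
      \<le> (matrix_norm m b)\<^sup>2 * (\<Sum>j<m. (norm (v j))\<^sup>2)"
    using matrix_action_bound[OF assms \<beta>(1)] rep_matrix_vec[OF assms \<beta>(1)] by simp
qed

lemma rep_norm_le:
  assumes "b \<in> B" shows "norm (rep b) \<le> norm b"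
  using rep_contractive[of "\<lambda>_ _. b" 1] assms matrix_norm_one[of "\<lambda>_ _. b"] matrix_norm_one[of "\<lambda>_ _. rep b"]
  by (simp add: matrices_def)

text \<open>Stronger than nondegeneracy: \<open>y\<close> is approximated from its own orbit. In
  this form the property can be used for the representation of \<open>A\<close>, which is obtained
  by passing to adjoints.\<close>

lemma rep_approximate_unit: "y \<in> closure {blinfun_apply (rep e) y | e. e \<in> B}"
  unfolding closure_approachable
proof (intro allI impI)
  fix \<epsilon> :: real assume \<epsilon>: "0 < \<epsilon>"
  obtain F where F: "F \<noteq> bot" "\<forall>\<^sub>F e in F. e \<in> B \<and> norm e \<le> 1"
    "\<And>a. a \<in> B \<Longrightarrow> ((\<lambda>e. e o\<^sub>L a) \<longlongrightarrow> a) F"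
    using unital unfolding approximately_unital_def by blast
  have "y \<in> closure (vec ` V)" by (simp add: vec_dense)
  then obtain \<beta> where \<beta>: "\<beta> \<in> V" "dist (vec \<beta>) y < \<epsilon> / 3"
    using \<epsilon> unfolding closure_approachable by (metis divide_pos_pos imageE zero_less_numeral)
  let ?S = "{p. \<beta> p \<noteq> 0}"
  \<comment> \<open>\<open>c e\<close> dominates the squared distance from
    \<open>vec \<beta>\<close> to its image under \<open>rep e\<close>, since a state is at most the
    sum of the squared norms of the entries. Only finitely many entries occur, so it tends to
    0.\<close>
  define c where "c e = (\<Sum>p\<in>?S. \<Sum>j<n p. (norm ((e o\<^sub>L \<beta> p j) - \<beta> p j))\<^sup>2)" for e :: "'h \<Rightarrow>\<^sub>L 'h"
  have \<beta>B: "\<beta> p j \<in> B" for p j using row_families_row[OF \<beta>(1), of p] by (auto simp: row_space_def)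
  have "(c \<longlongrightarrow> (\<Sum>p\<in>?S. \<Sum>j<n p. (norm (\<beta> p j - \<beta> p j))\<^sup>2)) F"
    unfolding c_def
    by (intro tendsto_sum tendsto_power tendsto_norm tendsto_diff tendsto_const F(3) \<beta>B)
  then have "(c \<longlongrightarrow> 0) F" by simp
  then have "\<forall>\<^sub>F e in F. c e < (\<epsilon> / 3)\<^sup>2" using \<epsilon> by (intro order_tendstoD(2)) auto
  then obtain e where e: "e \<in> B" "norm e \<le> 1" "c e < (\<epsilon> / 3)\<^sup>2"
    using eventually_happens[OF eventually_conj[OF F(2)]] F(1) by blast
  have el: "lmult e \<beta> \<in> V" using lmult_in[OF algebra e(1) \<beta>(1)] .
  have d: "lmult e \<beta> - \<beta> \<in> V" using subspace_diff[OF sub_V el \<beta>(1)] .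
  have "vec (lmult e \<beta>) = vec ((lmult e \<beta> - \<beta>) + \<beta>)" by simp
  also have "\<dots> = vec (lmult e \<beta> - \<beta>) + vec \<beta>"
    by (rule vec_add[OF d \<beta>(1)])
  finally have diff: "vec (lmult e \<beta>) - vec \<beta> = vec (lmult e \<beta> - \<beta>)" by simp
  have "(norm (vec (lmult e \<beta> - \<beta>)))\<^sup>2 = (\<Sum>p\<in>?S. t p ((lmult e \<beta> - \<beta>) p) ((lmult e \<beta> - \<beta>) p))"
    by (rule norm_vec[OF d finite_support[OF \<beta>(1)]]) (auto simp: lmult_def zero_fun_def)
  also have "\<dots> \<le> c e"
    unfolding c_def by (intro sum_mono order_trans[OF row_states_le[OF states]]) (simp add: lmult_def)
  finally have "(norm (vec (lmult e \<beta> - \<beta>)))\<^sup>2 < (\<epsilon> / 3)\<^sup>2" using e(3) by linarith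
  then have n2: "norm (blinfun_apply (rep e) (vec \<beta>) - vec \<beta>) < \<epsilon> / 3"
    using \<epsilon> unfolding rep_vec[OF e(1) \<beta>(1)] diff
    by (metis divide_pos_pos less_imp_le power_less_imp_less_base zero_less_numeral)
  have "norm (blinfun_apply (rep e) (y - vec \<beta>)) \<le> norm (rep e) * norm (y - vec \<beta>)"
    by (rule norm_blinfun)
  also have "\<dots> \<le> 1 * norm (y - vec \<beta>)"
    using rep_norm_le[OF e(1)] e(2) by (intro mult_right_mono) auto
  finally have n1: "norm (blinfun_apply (rep e) (y - vec \<beta>)) < \<epsilon> / 3"
    using \<beta>(2) by (simp add: dist_norm norm_minus_commute)
  have "blinfun_apply (rep e) y - y = blinfun_apply (rep e) (y - vec \<beta>)
      + (blinfun_apply (rep e) (vec \<beta>) - vec \<beta>) + (vec \<beta> - y)"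
    by (simp add: blinfun.diff_right)
  then have "norm (blinfun_apply (rep e) y - y) \<le> norm (blinfun_apply (rep e) (y - vec \<beta>))
      + norm (blinfun_apply (rep e) (vec \<beta>) - vec \<beta>) + norm (vec \<beta> - y)"
    by (metis norm_triangle_ineq norm_add_rule_thm order_refl)
  then have "dist (blinfun_apply (rep e) y) y < \<epsilon>"
    using n1 n2 \<beta>(2) by (simp add: dist_norm)
  then show "\<exists>x\<in>{blinfun_apply (rep e) y | e. e \<in> B}. dist x y < \<epsilon>" using e(1) by blast
qed

text \<open>In the block of the vector state of \<open>h\<close>, the diagonal rows with entry
  \<open>e\<close> behave like the tuple \<open>e h\<close>: the matrix \<open>b\<close> sends them
  to vectors with the norms of \<open>b e h\<close>. Along the approximate identity this tends to
  \<open>b h\<close>.\<close>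

lemma rep_isometric:
  assumes vs: "\<And>m h. (\<Sum>j<m. (norm (h j))\<^sup>2) \<le> 1 \<Longrightarrow> \<exists>p. n p = m \<and> t p = vector_state m h"
  shows "completely_isometric B rep"
  unfolding completely_isometric_def
proof (intro allI ballI antisym)
  fix m b assume b: "b \<in> matrices m B"
  show "matrix_norm m (\<lambda>i j. rep (b i j)) \<le> matrix_norm m b" by (rule rep_contractive[OF b])
  let ?M = "matrix_norm m (\<lambda>i j. rep (b i j))"
  obtain F where F: "F \<noteq> bot" "\<forall>\<^sub>F e in F. e \<in> B \<and> norm e \<le> 1"
    "\<And>a. a \<in> B \<Longrightarrow> ((\<lambda>e. a o\<^sub>L e) \<longlongrightarrow> a) F"
    using unital unfolding approximately_unital_def by blast
  have main: "(\<Sum>i<m. (norm (\<Sum>j<m. blinfun_apply (b i j) (h j)))\<^sup>2) \<le> ?M\<^sup>2"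
    if h: "(\<Sum>j<m. (norm (h j))\<^sup>2) \<le> 1" for h
  proof -
    obtain p where p: "n p = m" "t p = vector_state m h" using vs[OF h] by blast
    have le: "(\<Sum>i<m. (norm (\<Sum>j<m. blinfun_apply (b i j o\<^sub>L e) (h j)))\<^sup>2) \<le> ?M\<^sup>2"
      if e: "e \<in> B" "norm e \<le> 1" for e
    proof -
      \<comment> \<open>The condition \<open>l < m\<close> makes every \<open>\<delta> l\<close>,
        also outside the range of summation, a row in \<open>row_space (n p) B\<close>.\<close>
      define \<delta> where "\<delta> l = (\<lambda>j. if j = l \<and> l < m then e else 0)" for l
      have \<delta>: "\<delta> l \<in> row_space (n p) B" for l
        using e subspace_0[OF sub_B] by (auto simp: \<delta>_def row_space_def p)
      define \<beta> where "\<beta> l = single_row p (\<delta> l)" for l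
      have \<beta>: "\<beta> l \<in> V" for l unfolding \<beta>_def by (rule single_row_in[OF sub_B, where p = p and n = n, OF \<delta>])
      have "(\<Sum>l<m. (norm (vec (\<beta> l)))\<^sup>2) = (\<Sum>l<m. t p (\<lambda>j. if j = l then e else 0) (\<lambda>j. if j = l then e else 0))"
        unfolding \<beta>_def norm_vec_single[OF \<delta>] by (intro sum.cong refl) (simp add: \<delta>_def)
      also have "\<dots> \<le> 1" using row_states_diagonal[OF states[of p] e(2)] by (simp add: p)
      finally have s1: "(\<Sum>l<m. (norm (vec (\<beta> l)))\<^sup>2) \<le> 1" .
      have sum: "(\<Sum>l<m. lmult (b i l) (\<beta> l)) = single_row p (\<lambda>j. if j < m then b i j o\<^sub>L e else 0)" for i
      proof (intro ext)
        fix q j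
        have "(\<Sum>l<m. lmult (b i l) (\<beta> l)) q j = (\<Sum>l<m. if l = j then (if q = p then b i l o\<^sub>L e else 0) else 0)"
          unfolding sum_fun_apply
          by (intro sum.cong refl) (auto simp: lmult_def \<beta>_def single_row_def \<delta>_def)
        also have "\<dots> = single_row p (\<lambda>j. if j < m then b i j o\<^sub>L e else 0) q j"
          by (simp add: single_row_def)
        finally show "(\<Sum>l<m. lmult (b i l) (\<beta> l)) q j = single_row p (\<lambda>j. if j < m then b i j o\<^sub>L e else 0) q j" .
      qed
      have "(norm (\<Sum>l<m. blinfun_apply (rep (b i l)) (vec (\<beta> l))))\<^sup>2
          = (norm (\<Sum>j<m. blinfun_apply (b i j o\<^sub>L e) (h j)))\<^sup>2" if i: "i < m" for i
      proof -
        have "(\<lambda>j. if j < m then b i j o\<^sub>L e else 0) \<in> row_space (n p) B"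
          using b e i algebra subspace_0[OF sub_B]
          by (auto simp: row_space_def p matrices_def real_operator_algebra_def)
        then show ?thesis
          unfolding rep_matrix_vec[OF b \<beta> i] sum
          by (subst norm_vec_single) (simp_all add: p vector_state_def power2_norm_eq_inner)
      qed
      then have "(\<Sum>i<m. (norm (\<Sum>j<m. blinfun_apply (b i j o\<^sub>L e) (h j)))\<^sup>2)
          = (\<Sum>i<m. (norm (\<Sum>l<m. blinfun_apply (rep (b i l)) (vec (\<beta> l))))\<^sup>2)" by simp
      also have "\<dots> \<le> ?M\<^sup>2 * (\<Sum>l<m. (norm (vec (\<beta> l)))\<^sup>2)" by (rule matrix_norm_bound)
      also have "\<dots> \<le> ?M\<^sup>2" using s1 by (simp add: mult_left_le)
      finally show ?thesis .
    qed
    have bB: "b i j \<in> B" if "i \<in> {..<m}" "j \<in> {..<m}" for i j using b that by (auto simp: matrices_def)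
    have "((\<lambda>e. \<Sum>i<m. (norm (\<Sum>j<m. blinfun_apply (b i j o\<^sub>L e) (h j)))\<^sup>2)
        \<longlongrightarrow> (\<Sum>i<m. (norm (\<Sum>j<m. blinfun_apply (b i j) (h j)))\<^sup>2)) F"
      by (intro tendsto_sum tendsto_power tendsto_norm blinfun.tendsto tendsto_const F(3) bB)
    moreover have "\<forall>\<^sub>F e in F. (\<Sum>i<m. (norm (\<Sum>j<m. blinfun_apply (b i j o\<^sub>L e) (h j)))\<^sup>2) \<le> ?M\<^sup>2"
      using F(2) by eventually_elim (use le in auto)
    ultimately show ?thesis by (rule tendsto_upperbound[OF _ _ F(1)])
  qed
  have "(matrix_norm m b)\<^sup>2 \<le> ?M\<^sup>2"
  proof (rule field_le_epsilon)
    fix \<epsilon> :: real assume "0 < \<epsilon>"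
    then obtain h where "(\<Sum>j<m. (norm (h j))\<^sup>2) \<le> 1"
      "(matrix_norm m b)\<^sup>2 - \<epsilon> < (\<Sum>i<m. (norm (\<Sum>j<m. blinfun_apply (b i j) (h j)))\<^sup>2)"
      using matrix_norm_approx_sq by blast
    then show "(matrix_norm m b)\<^sup>2 \<le> ?M\<^sup>2 + \<epsilon>" using main[of h] by linarith
  qed
  then show "matrix_norm m b \<le> ?M" by (rule power2_le_imp_le) simp
qed

end

text \<open>The label \<open>mult p\<close> divides the blocks \<open>p\<close> into
  \<open>'i\<close> many classes, each with a nonzero vector, while \<open>g\<close> shows that
  there are no more rows than elements of \<open>'i\<close>. These are the two bounds that allow the
  vectors to be total in \<open>'i ell2\<close>.\<close>

lemma gram_representation_exists:
  fixes B :: "('h::{real_inner, complete_space} \<Rightarrow>\<^sub>L 'h) set"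
    and n :: "'p \<Rightarrow> nat"
    and t :: "'p \<Rightarrow> (nat \<Rightarrow> ('h \<Rightarrow>\<^sub>L 'h)) \<Rightarrow> (nat \<Rightarrow> ('h \<Rightarrow>\<^sub>L 'h)) \<Rightarrow> real"
    and mult :: "'p \<Rightarrow> 'i" and g :: "'p \<times> (nat \<Rightarrow> ('h \<Rightarrow>\<^sub>L 'h)) \<Rightarrow> 'i"
  assumes B: "real_operator_algebra B" "approximately_unital B"
    and states: "\<And>p. t p \<in> row_states (n p)"
    and g: "inj_on g {(p, \<beta>). \<beta> \<in> row_space (n p) B}"
    and nz: "\<And>i. \<exists>p \<beta>. mult p = i \<and> \<beta> \<in> row_space (n p) B \<and> t p \<beta> \<beta> \<noteq> 0"
  obtains \<phi> :: "'p \<Rightarrow> (nat \<Rightarrow> ('h \<Rightarrow>\<^sub>L 'h)) \<Rightarrow> 'i ell2" where "gram_representation B n t \<phi>"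
proof -
  define ok where "ok d \<longleftrightarrow> snd d \<in> row_space (n (fst d)) B" for d :: "'p \<times> (nat \<Rightarrow> ('h \<Rightarrow>\<^sub>L 'h))"
  \<comment> \<open>The Gram construction wants a kernel on a whole type. Pairs that are not rows
    get the zero kernel, hence the zero vector, and do not count towards the size.\<close>
  define k where "k d e = (if fst d = fst e \<and> ok d \<and> ok e then t (fst d) (snd d) (snd e) else 0)" for d e
  have sym: "k d e = k e d" for d e
    using row_states_sym[OF states, of "fst d" "snd d" "snd e"] by (auto simp: k_def)
  have psd: "0 \<le> (\<Sum>d\<in>T. \<Sum>e\<in>T. c d * c e * k d e)" if T: "finite T" for T c
  proof -
    \<comment> \<open>Separating the coefficients by blocks turns the quadratic form into a sum of
      values of the states at one row each.\<close>
    define w where "w p d = (if fst d = p \<and> ok d then c d else 0)" for p d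
    have "c d * c e * k d e = (\<Sum>p\<in>fst ` T. w p d * w p e * t p (snd d) (snd e))" if "d \<in> T" for d e
    proof -
      have "(\<Sum>p\<in>fst ` T. w p d * w p e * t p (snd d) (snd e))
          = (\<Sum>p\<in>fst ` T. if p = fst d then c d * c e * k d e else 0)"
        by (intro sum.cong refl) (auto simp: w_def k_def)
      then show ?thesis using that T by (simp add: sum.delta)
    qed
    then have "(\<Sum>d\<in>T. \<Sum>e\<in>T. c d * c e * k d e)
        = (\<Sum>d\<in>T. \<Sum>e\<in>T. \<Sum>p\<in>fst ` T. w p d * w p e * t p (snd d) (snd e))"
      by (intro sum.cong refl) auto
    also have "\<dots> = (\<Sum>d\<in>T. \<Sum>p\<in>fst ` T. \<Sum>e\<in>T. w p d * w p e * t p (snd d) (snd e))"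
      by (intro sum.cong refl sum.swap)
    also have "\<dots> = (\<Sum>p\<in>fst ` T. \<Sum>d\<in>T. \<Sum>e\<in>T. w p d * w p e * t p (snd d) (snd e))"
      by (rule sum.swap)
    also have "\<dots> = (\<Sum>p\<in>fst ` T. t p (\<Sum>d\<in>T. w p d *\<^sub>R snd d) (\<Sum>e\<in>T. w p e *\<^sub>R snd e))"
    proof -
      have "t p (\<Sum>d\<in>T. w p d *\<^sub>R snd d) x = (\<Sum>d\<in>T. w p d * t p (snd d) x)" for p x
        by (simp add: linear_sum[OF row_states_linear[OF states]] linear_scale[OF row_states_linear[OF states]])
      note left = this
      have "t p x (\<Sum>e\<in>T. w p e *\<^sub>R snd e) = (\<Sum>e\<in>T. w p e * t p x (snd e))" for p x
        by (simp add: linear_sum[OF row_states_linear2[OF states]] linear_scale[OF row_states_linear2[OF states]])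
      note right = this
      have "t p (\<Sum>d\<in>T. w p d *\<^sub>R snd d) (\<Sum>e\<in>T. w p e *\<^sub>R snd e)
          = (\<Sum>d\<in>T. \<Sum>e\<in>T. w p d * w p e * t p (snd d) (snd e))" for p
        by (subst left, subst right, simp add: sum_distrib_left mult.assoc)
      then show ?thesis by simp
    qed
    also have "0 \<le> \<dots>" by (intro sum_nonneg row_states_nonneg[OF states])
    finally show ?thesis .
  qed
  have inj: "inj_on g {d. k d d \<noteq> 0}"
    by (rule inj_on_subset[OF g]) (auto simp: k_def ok_def)
  have orth: "k d e = 0" if "mult (fst d) \<noteq> mult (fst e)" for d e using that by (auto simp: k_def)
  have ex: "\<exists>d. mult (fst d) = i \<and> k d d \<noteq> 0" for i
    using nz[of i] by (auto simp: k_def ok_def)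
  obtain \<phi> :: "'p \<times> (nat \<Rightarrow> ('h \<Rightarrow>\<^sub>L 'h)) \<Rightarrow> 'i ell2" where
    \<phi>: "\<And>d e. \<phi> d \<bullet> \<phi> e = k d e" and tot: "\<And>y. (\<And>d. y \<bullet> \<phi> d = 0) \<Longrightarrow> y = 0"
    by (rule total_gram_vectors[OF sym psd orth ex inj]) blast+
  have "gram_representation B n t (\<lambda>p \<beta>. \<phi> (p, \<beta>))"
  proof
    fix y assume y: "\<And>p \<beta>. \<beta> \<in> row_space (n p) B \<Longrightarrow> y \<bullet> \<phi> (p, \<beta>) = 0"
    show "y = 0"
    proof (rule tot)
      fix d :: "'p \<times> (nat \<Rightarrow> ('h \<Rightarrow>\<^sub>L 'h))"
      show "y \<bullet> \<phi> d = 0"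
      proof (cases "ok d")
        case True
        then show ?thesis using y[of "snd d" "fst d"] by (simp add: ok_def)
      next
        case False
        then have "\<phi> d \<bullet> \<phi> d = 0" unfolding \<phi> by (simp add: k_def)
        then show ?thesis by simp
      qed
    qed
  qed (use B states in \<open>auto simp: \<phi> k_def ok_def\<close>)
  then show thesis using that by blast
qed

section \<open>Forms on rows and their domination by states\<close>

context contractive_bimodule
begin

definition rowsA :: "(nat \<Rightarrow> ('ha \<Rightarrow>\<^sub>L 'ha)) set" where "rowsA = {\<gamma>. \<forall>i. adj (\<gamma> i) \<in> A}"

definition rowsB :: "(nat \<Rightarrow> ('hb \<Rightarrow>\<^sub>L 'hb)) set" where "rowsB = {\<beta>. \<forall>j. \<beta> j \<in> B}"

text \<open>
  The left action enters through adjoints, so that \<open>A\<close> and \<open>B\<close> are both treated as acting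
  from the left on rows.
\<close>

definition form :: "nat \<Rightarrow> (nat \<Rightarrow> 'hx) \<Rightarrow> (nat \<Rightarrow> 'hx) \<Rightarrow>
    (nat \<Rightarrow> ('ha \<Rightarrow>\<^sub>L 'ha)) \<Rightarrow> ('hx \<Rightarrow>\<^sub>L 'hx) \<Rightarrow> (nat \<Rightarrow> ('hb \<Rightarrow>\<^sub>L 'hb)) \<Rightarrow> real"
  where "form n u v \<gamma> x \<beta> =
    (\<Sum>i<n. \<Sum>j<n. blinfun_apply (r (l (adj (\<gamma> i)) x) (\<beta> j)) (v j) \<bullet> u i)"

lemma subspace_rowsA: "subspace rowsA"
  by (rule subspaceI)
    (auto simp: rowsA_def adj_add adj_scaleR subspace_0[OF subA] subspace_add[OF subA] subspace_scale[OF subA])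

lemma subspace_rowsB: "subspace rowsB"
  by (rule subspaceI)
    (auto simp: rowsB_def subspace_0[OF subB] subspace_add[OF subB] subspace_scale[OF subB])

lemma form_linearA:
  assumes "x \<in> X" "\<beta> \<in> rowsB"
  shows "real_linear_on rowsA (\<lambda>\<gamma>. form n u v \<gamma> x \<beta>)"
proof -
  have 1: "r (l (a + a') x) (\<beta> j) = r (l a x) (\<beta> j) + r (l a' x) (\<beta> j)" if "a \<in> A" "a' \<in> A" for a a' j
    using l_linear2[OF assms(1)] r_linear[of "\<beta> j"] assms that l_in
    by (simp add: real_linear_on_def rowsB_def)
  have 2: "r (l (c *\<^sub>R a) x) (\<beta> j) = c *\<^sub>R r (l a x) (\<beta> j)" if "a \<in> A" for c a j
    using l_linear2[OF assms(1)] r_linear[of "\<beta> j"] assms that l_in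
    by (simp add: real_linear_on_def rowsB_def)
  show ?thesis
    unfolding real_linear_on_def form_def rowsA_def
    by (simp add: adj_add adj_scaleR 1 2 blinfun.add_left blinfun.scaleR_left inner_add_left
        sum.distrib sum_distrib_left)
qed

lemma form_linearX:
  assumes "\<gamma> \<in> rowsA" "\<beta> \<in> rowsB"
  shows "real_linear_on X (\<lambda>x. form n u v \<gamma> x \<beta>)"
proof -
  have 1: "r (l (adj (\<gamma> i)) (x + y)) (\<beta> j) = r (l (adj (\<gamma> i)) x) (\<beta> j) + r (l (adj (\<gamma> i)) y) (\<beta> j)"
    if "x \<in> X" "y \<in> X" for x y i j
    using l_linear[of "adj (\<gamma> i)"] r_linear[of "\<beta> j"] assms that l_in
    by (simp add: real_linear_on_def rowsA_def rowsB_def)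
  have 2: "r (l (adj (\<gamma> i)) (c *\<^sub>R x)) (\<beta> j) = c *\<^sub>R r (l (adj (\<gamma> i)) x) (\<beta> j)"
    if "x \<in> X" for c x i j
    using l_linear[of "adj (\<gamma> i)"] r_linear[of "\<beta> j"] assms that l_in
    by (simp add: real_linear_on_def rowsA_def rowsB_def)
  show ?thesis
    unfolding real_linear_on_def form_def
    by (simp add: 1 2 blinfun.add_left blinfun.scaleR_left inner_add_left sum.distrib sum_distrib_left)
qed

lemma form_linearB:
  assumes "\<gamma> \<in> rowsA" "x \<in> X"
  shows "real_linear_on rowsB (\<lambda>\<beta>. form n u v \<gamma> x \<beta>)"
proof -
  have 1: "r (l (adj (\<gamma> i)) x) (b + b') = r (l (adj (\<gamma> i)) x) b + r (l (adj (\<gamma> i)) x) b'"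
    if "b \<in> B" "b' \<in> B" for b b' i
    using r_linear2[OF l_in, of "adj (\<gamma> i)" x] assms that by (simp add: real_linear_on_def rowsA_def)
  have 2: "r (l (adj (\<gamma> i)) x) (c *\<^sub>R b) = c *\<^sub>R r (l (adj (\<gamma> i)) x) b" if "b \<in> B" for c b i
    using r_linear2[OF l_in, of "adj (\<gamma> i)" x] assms that by (simp add: real_linear_on_def rowsA_def)
  show ?thesis
    unfolding real_linear_on_def form_def rowsB_def
    by (simp add: 1 2 blinfun.add_left blinfun.scaleR_left inner_add_left sum.distrib sum_distrib_left)
qed

lemma form_left:
  assumes "a \<in> A" "\<gamma> \<in> rowsA" "x \<in> X" "\<beta> \<in> rowsB"
  shows "form n u v (\<lambda>i. adj a o\<^sub>L \<gamma> i) x \<beta> = form n u v \<gamma> (l a x) \<beta>"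
  using assms by (simp add: form_def rowsA_def adj_compose l_mult)

lemma form_right:
  assumes "b \<in> B" "\<gamma> \<in> rowsA" "x \<in> X" "\<beta> \<in> rowsB"
  shows "form n u v \<gamma> x (\<lambda>j. b o\<^sub>L \<beta> j) = form n u v \<gamma> (r x b) \<beta>"
  using assms by (simp add: form_def rowsA_def rowsB_def r_mult l_in lr)

lemma form_zeroX: "\<gamma> \<in> rowsA \<Longrightarrow> \<beta> \<in> rowsB \<Longrightarrow> form n u v \<gamma> 0 \<beta> = 0"
  using real_linear_on_zero[OF form_linearX subX] .

lemma form_scale:
  assumes "\<gamma> \<in> rowsA" "x \<in> X" "\<beta> \<in> rowsB"
  shows "form n u v (c *\<^sub>R \<gamma>) x (c *\<^sub>R \<beta>) = c\<^sup>2 * form n u v \<gamma> x \<beta>"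
  using form_linearA[of x "c *\<^sub>R \<beta>" n u v] form_linearB[of \<gamma> x n u v] assms
    subspace_scale[OF subspace_rowsB assms(3)]
  by (simp add: real_linear_on_def power2_eq_square)

text \<open>Stacked rows form rectangular matrices \<open>\<gamma>\<close> and
  \<open>\<beta>\<close>, and the double sum is a vector functional applied to
  \<open>\<gamma>* x \<beta>\<close>. Padding to the size \<open>N\<close> makes all factors square,
  so the contractivity of the actions applies.\<close>

lemma form_le:
  assumes u: "(\<Sum>j<n. (norm (u j))\<^sup>2) \<le> 1" and v: "(\<Sum>j<n. (norm (v j))\<^sup>2) \<le> 1"
    and N: "n \<le> N" "m \<le> N"
    and x: "x \<in> matrices m X" "matrix_norm m x \<le> 1"
    and \<gamma>: "\<And>k. \<gamma> k \<in> rowsA" and \<beta>: "\<And>k. \<beta> k \<in> rowsB"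
  shows "(\<Sum>k<m. \<Sum>k'<m. form n u v (\<gamma> k) (x k k') (\<beta> k'))
    \<le> matrix_norm N (\<lambda>k j. if k < m \<and> j < n then \<gamma> k j else 0)
      * matrix_norm N (\<lambda>k j. if k < m \<and> j < n then \<beta> k j else 0)"
proof -
  let ?g = "\<lambda>k j. if k < m \<and> j < n then \<gamma> k j else 0"
  let ?b = "\<lambda>k j. if k < m \<and> j < n then \<beta> k j else 0"
  let ?a = "\<lambda>i k. adj (?g k i)"
  let ?x = "\<lambda>k k'. if k < m \<and> k' < m then x k k' else 0"
  let ?y = "right_matrix_action N r (left_matrix_action N l ?a ?x) ?b"
  let ?u = "\<lambda>i. if i < n then u i else 0" and ?v = "\<lambda>i. if i < n then v i else 0"
  have xX: "x k k' \<in> X" if "k < m" "k' < m" for k k' using x(1) that by (simp add: matrices_def)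
  have aA: "adj (\<gamma> k i) \<in> A" for k i using \<gamma>[of k] by (simp add: rowsA_def)
  have bB: "\<beta> k j \<in> B" for k j using \<beta>[of k] by (simp add: rowsB_def)
  have pad: "(\<Sum>i<N. f i) = (\<Sum>i<n'. g i)"
    if "n' \<le> N" "\<And>i. i < n' \<Longrightarrow> f i = g i" "\<And>i. n' \<le> i \<Longrightarrow> f i = 0"
    for f g :: "nat \<Rightarrow> 'c::comm_monoid_add" and n'
    using that by (intro sum.mono_neutral_cong_right) auto
  have y: "?y i j = (\<Sum>k<m. \<Sum>k'<m. r (l (adj (\<gamma> k i)) (x k k')) (\<beta> k' j))" if ij: "i < n" "j < n" for i j
  proof -
    have "left_matrix_action N l ?a ?x i k' = (\<Sum>k<m. l (adj (\<gamma> k i)) (x k k'))" if k': "k' < m" for k'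
      unfolding left_matrix_action_def
      by (rule pad[OF N(2)]) (use ij k' l_zero subspace_0[OF subX] in auto)
    then have "r (left_matrix_action N l ?a ?x i k') (?b k' j) = (\<Sum>k<m. r (l (adj (\<gamma> k i)) (x k k')) (\<beta> k' j))"
      if k': "k' < m" for k'
      using k' ij real_linear_on_sum[OF r_linear[OF bB] subX, of "{..<m}" "\<lambda>k. l (adj (\<gamma> k i)) (x k k')"]
        l_in aA xX by simp
    moreover have "left_matrix_action N l ?a ?x i k' \<in> X" for k'
      unfolding left_matrix_action_def
      by (intro subspace_sum[OF subX] l_in) (auto simp: aA subspace_0[OF subA] subspace_0[OF subX] xX)
    then have "r (left_matrix_action N l ?a ?x i k') (?b k' j) = 0" if k': "m \<le> k'" for k'
      using k' r_zero by simp
    ultimately have "?y i j = (\<Sum>k'<m. \<Sum>k<m. r (l (adj (\<gamma> k i)) (x k k')) (\<beta> k' j))"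
      unfolding right_matrix_action_def by (intro pad[OF N(2)]) auto
    also have "\<dots> = (\<Sum>k<m. \<Sum>k'<m. r (l (adj (\<gamma> k i)) (x k k')) (\<beta> k' j))" by (rule sum.swap)
    finally show ?thesis .
  qed
  have "(\<Sum>k<m. \<Sum>k'<m. form n u v (\<gamma> k) (x k k') (\<beta> k'))
      = (\<Sum>k<m. \<Sum>i<n. \<Sum>k'<m. \<Sum>j<n. blinfun_apply (r (l (adj (\<gamma> k i)) (x k k')) (\<beta> k' j)) (v j) \<bullet> u i)"
    unfolding form_def by (rule sum.cong[OF refl], rule sum.swap)
  also have "\<dots> = (\<Sum>k<m. \<Sum>i<n. \<Sum>j<n. \<Sum>k'<m. blinfun_apply (r (l (adj (\<gamma> k i)) (x k k')) (\<beta> k' j)) (v j) \<bullet> u i)"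
    by (rule sum.cong[OF refl], rule sum.cong[OF refl], rule sum.swap)
  also have "\<dots> = (\<Sum>i<n. \<Sum>k<m. \<Sum>j<n. \<Sum>k'<m. blinfun_apply (r (l (adj (\<gamma> k i)) (x k k')) (\<beta> k' j)) (v j) \<bullet> u i)"
    by (rule sum.swap)
  also have "\<dots> = (\<Sum>i<n. \<Sum>j<n. \<Sum>k<m. \<Sum>k'<m. blinfun_apply (r (l (adj (\<gamma> k i)) (x k k')) (\<beta> k' j)) (v j) \<bullet> u i)"
    by (rule sum.cong[OF refl], rule sum.swap)
  also have "\<dots> = (\<Sum>i<n. \<Sum>j<n. blinfun_apply (?y i j) (v j) \<bullet> u i)"
    by (intro sum.cong refl) (simp add: y blinfun.sum_left inner_sum_left)
  also have "\<dots> = (\<Sum>i<N. \<Sum>j<N. blinfun_apply (?y i j) (?v j) \<bullet> ?u i)"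
    by (rule pad[OF N(1), symmetric]) (auto intro!: pad[OF N(1)] simp: blinfun.zero_right)
  also have "\<dots> \<le> matrix_norm N ?y"
  proof (rule matrix_norm_form)
    show "(\<Sum>j<N. (norm (?v j))\<^sup>2) \<le> 1"
    proof -
      have "(\<Sum>j<N. (norm (?v j))\<^sup>2) = (\<Sum>j<n. (norm (v j))\<^sup>2)" by (rule pad[OF N(1)]) auto
      then show ?thesis using v by simp
    qed
    show "(\<Sum>j<N. (norm (?u j))\<^sup>2) \<le> 1"
    proof -
      have "(\<Sum>j<N. (norm (?u j))\<^sup>2) = (\<Sum>j<n. (norm (u j))\<^sup>2)" by (rule pad[OF N(1)]) auto
      then show ?thesis using u by simp
    qed
  qed
  also have "\<dots> \<le> matrix_norm N ?a * matrix_norm N ?x * matrix_norm N ?b"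
  proof -
    have "?a \<in> matrices N A" "?x \<in> matrices N X" "?b \<in> matrices N B"
      using aA bB xX subspace_0[OF subA] subspace_0[OF subB] subspace_0[OF subX]
      by (auto simp: matrices_def)
    then show ?thesis using contr unfolding completely_contractive_actions_def by blast
  qed
  also have "\<dots> \<le> matrix_norm N ?a * 1 * matrix_norm N ?b"
    using order_trans[OF matrix_norm_pad[OF N(2)] x(2)]
    by (intro mult_right_mono mult_left_mono) auto
  also have "matrix_norm N ?a = matrix_norm N ?g" by (rule matrix_norm_adj)
  finally show ?thesis by simp
qed

text \<open>Each choice of \<open>m\<close>, \<open>x\<close>, \<open>\<gamma>\<close>,
  \<open>\<beta>\<close> gives an affine function on pairs of states. Together these functions are
  closed under sums and nonnegative multiples, and each single one is nearly nonnegative at suitable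
  vector states; minimax yields one pair of states good for all of them.\<close>

lemma dominating_states:
  assumes u: "(\<Sum>j<n. (norm (u j))\<^sup>2) \<le> 1" and v: "(\<Sum>j<n. (norm (v j))\<^sup>2) \<le> 1"
  obtains s t where "s \<in> row_states n" and "t \<in> row_states n"
    and "\<And>m x (\<gamma> :: nat \<Rightarrow> _) (\<beta> :: nat \<Rightarrow> _). x \<in> matrices m X \<Longrightarrow> matrix_norm m x \<le> 1 \<Longrightarrow>
      (\<And>k. \<gamma> k \<in> rowsA) \<Longrightarrow> (\<And>k. \<beta> k \<in> rowsB) \<Longrightarrow>
      2 * (\<Sum>k<m. \<Sum>k'<m. form n u v (\<gamma> k) (x k k') (\<beta> k'))
        \<le> (\<Sum>k<m. s (\<gamma> k) (\<gamma> k)) + (\<Sum>k<m. t (\<beta> k) (\<beta> k))"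
proof -
  let ?f = "form n u v"
  define \<Psi> where "\<Psi> m x \<gamma> \<beta> = (\<lambda>p. (\<Sum>k<m. fst p (\<gamma> k) (\<gamma> k)) + (\<Sum>k<m. snd p (\<beta> k) (\<beta> k))
      - 2 * (\<Sum>k<m. \<Sum>k'<m. ?f (\<gamma> k) (x k k') (\<beta> k')))"
    for m :: nat and x \<gamma> \<beta> and p :: "((nat \<Rightarrow> ('ha \<Rightarrow>\<^sub>L 'ha)) \<Rightarrow> (nat \<Rightarrow> ('ha \<Rightarrow>\<^sub>L 'ha)) \<Rightarrow> real)
      \<times> ((nat \<Rightarrow> ('hb \<Rightarrow>\<^sub>L 'hb)) \<Rightarrow> (nat \<Rightarrow> ('hb \<Rightarrow>\<^sub>L 'hb)) \<Rightarrow> real)"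
  define ok where "ok m x \<gamma> \<beta> \<longleftrightarrow> x \<in> matrices m X \<and> matrix_norm m x \<le> 1 \<and>
      (\<forall>k. \<gamma> k \<in> rowsA) \<and> (\<forall>k. \<beta> k \<in> rowsB)"
    for m :: nat and x and \<gamma> :: "nat \<Rightarrow> nat \<Rightarrow> ('ha \<Rightarrow>\<^sub>L 'ha)" and \<beta> :: "nat \<Rightarrow> nat \<Rightarrow> ('hb \<Rightarrow>\<^sub>L 'hb)"
  define P where "P = {\<Psi> m x \<gamma> \<beta> | m x \<gamma> \<beta>. ok m x \<gamma> \<beta>}"
  have "\<exists>p\<in>row_states n \<times> row_states n. \<forall>\<psi>\<in>P. 0 \<le> \<psi> p"
  proof (rule minimax)
    show "compact (row_states n \<times> row_states n :: (((nat \<Rightarrow> ('ha \<Rightarrow>\<^sub>L 'ha)) \<Rightarrow> (nat \<Rightarrow> ('ha \<Rightarrow>\<^sub>L 'ha)) \<Rightarrow> real)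
      \<times> ((nat \<Rightarrow> ('hb \<Rightarrow>\<^sub>L 'hb)) \<Rightarrow> (nat \<Rightarrow> ('hb \<Rightarrow>\<^sub>L 'hb)) \<Rightarrow> real)) set)"
      by (intro compact_Times compact_row_states)
    show "convex (row_states n \<times> row_states n :: (((nat \<Rightarrow> ('ha \<Rightarrow>\<^sub>L 'ha)) \<Rightarrow> (nat \<Rightarrow> ('ha \<Rightarrow>\<^sub>L 'ha)) \<Rightarrow> real)
      \<times> ((nat \<Rightarrow> ('hb \<Rightarrow>\<^sub>L 'hb)) \<Rightarrow> (nat \<Rightarrow> ('hb \<Rightarrow>\<^sub>L 'hb)) \<Rightarrow> real)) set)"
      by (intro convex_Times convex_row_states)
    have "vector_state n (\<lambda>_. 0 :: 'ha) \<in> row_states n" "vector_state n (\<lambda>_. 0 :: 'hb) \<in> row_states n"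
      by (intro vector_state_in_row_states, simp)+
    then show "row_states n \<times> row_states n \<noteq> ({} :: (((nat \<Rightarrow> ('ha \<Rightarrow>\<^sub>L 'ha)) \<Rightarrow> (nat \<Rightarrow> ('ha \<Rightarrow>\<^sub>L 'ha)) \<Rightarrow> real)
      \<times> ((nat \<Rightarrow> ('hb \<Rightarrow>\<^sub>L 'hb)) \<Rightarrow> (nat \<Rightarrow> ('hb \<Rightarrow>\<^sub>L 'hb)) \<Rightarrow> real)) set)"
      by blast
  next
    fix \<psi> assume "\<psi> \<in> P"
    then obtain m x \<gamma> \<beta> where \<psi>: "\<psi> = \<Psi> m x \<gamma> \<beta>" by (auto simp: P_def)
    have c1: "continuous_on UNIV (\<lambda>p :: ((nat \<Rightarrow> ('ha \<Rightarrow>\<^sub>L 'ha)) \<Rightarrow> (nat \<Rightarrow> ('ha \<Rightarrow>\<^sub>L 'ha)) \<Rightarrow> real)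
      \<times> ((nat \<Rightarrow> ('hb \<Rightarrow>\<^sub>L 'hb)) \<Rightarrow> (nat \<Rightarrow> ('hb \<Rightarrow>\<^sub>L 'hb)) \<Rightarrow> real). fst p \<delta> \<delta>')" for \<delta> \<delta>'
      by (rule continuous_on_compose2[OF continuous_on_eval2 continuous_on_fst[OF continuous_on_id]]) simp
    have c2: "continuous_on UNIV (\<lambda>p :: ((nat \<Rightarrow> ('ha \<Rightarrow>\<^sub>L 'ha)) \<Rightarrow> (nat \<Rightarrow> ('ha \<Rightarrow>\<^sub>L 'ha)) \<Rightarrow> real)
      \<times> ((nat \<Rightarrow> ('hb \<Rightarrow>\<^sub>L 'hb)) \<Rightarrow> (nat \<Rightarrow> ('hb \<Rightarrow>\<^sub>L 'hb)) \<Rightarrow> real). snd p \<delta> \<delta>')" for \<delta> \<delta>'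
      by (rule continuous_on_compose2[OF continuous_on_eval2 continuous_on_snd[OF continuous_on_id]]) simp
    show "continuous_on UNIV \<psi>"
      unfolding \<psi> \<Psi>_def
      by (intro continuous_on_add continuous_on_diff continuous_on_sum continuous_on_const c1 c2)
    show "\<psi> ((1 - w) *\<^sub>R p + w *\<^sub>R q) = (1 - w) * \<psi> p + w * \<psi> q" for p q w
      unfolding \<psi> \<Psi>_def by (simp add: sum.distrib flip: sum_distrib_left) (simp add: algebra_simps)
  next
    fix \<psi> \<omega> assume "\<psi> \<in> P" "\<omega> \<in> P"
    then obtain m x \<gamma> \<beta> m' x' \<gamma>' \<beta>' where \<psi>: "\<psi> = \<Psi> m x \<gamma> \<beta>" "ok m x \<gamma> \<beta>"
      and \<omega>: "\<omega> = \<Psi> m' x' \<gamma>' \<beta>'" "ok m' x' \<gamma>' \<beta>'" by (auto simp: P_def)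
    \<comment> \<open>Sum of two functions: diagonal blocks for the matrices, concatenation for the
      rows. The mixed terms vanish because the matrix is 0 there.\<close>
    define y where "y = (\<lambda>i j. if i < m \<and> j < m then x i j else if m \<le> i \<and> m \<le> j then x' (i - m) (j - m) else 0)"
    define \<delta> where "\<delta> k = (if k < m then \<gamma> k else \<gamma>' (k - m))" for k
    define \<epsilon> where "\<epsilon> k = (if k < m then \<beta> k else \<beta>' (k - m))" for k
    have "matrix_norm (m + m') y \<le> 1"
      unfolding y_def using \<psi>(2) \<omega>(2) by (intro matrix_norm_block_diag) (auto simp: ok_def)
    moreover have "y \<in> matrices (m + m') X"
      using \<psi>(2) \<omega>(2) subspace_0[OF subX] by (auto simp: y_def ok_def matrices_def)
    ultimately have "ok (m + m') y \<delta> \<epsilon>"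
      using \<psi>(2) \<omega>(2) by (auto simp: ok_def \<delta>_def \<epsilon>_def)
    moreover have "\<Psi> (m + m') y \<delta> \<epsilon> = (\<lambda>p. \<psi> p + \<omega> p)"
    proof -
      have "(\<Sum>k<m + m'. \<Sum>k'<m + m'. ?f (\<delta> k) (y k k') (\<epsilon> k'))
        = (\<Sum>k<m. \<Sum>k'<m. ?f (\<gamma> k) (x k k') (\<beta> k')) + (\<Sum>k<m'. \<Sum>k'<m'. ?f (\<gamma>' k) (x' k k') (\<beta>' k'))"
        using \<psi>(2) \<omega>(2) by (simp add: sum_lessThan_add \<delta>_def \<epsilon>_def y_def ok_def form_zeroX)
      then show ?thesis
        by (intro ext) (simp add: \<psi> \<omega> \<Psi>_def, simp add: sum_lessThan_add \<delta>_def \<epsilon>_def)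
    qed
    ultimately show "(\<lambda>p. \<psi> p + \<omega> p) \<in> P" unfolding P_def by (metis (mono_tags, lifting) mem_Collect_eq)
  next
    fix \<psi> and c :: real assume "\<psi> \<in> P" and c: "0 \<le> c"
    then obtain m x \<gamma> \<beta> where \<psi>: "\<psi> = \<Psi> m x \<gamma> \<beta>" "ok m x \<gamma> \<beta>" by (auto simp: P_def)
    \<comment> \<open>Only the rows are scaled, both by \<open>sqrt c\<close>: the form is bilinear
      in them and the states are quadratic, whereas \<open>x\<close> has to keep norm at most
      1.\<close>
    have "ok m x (\<lambda>k. sqrt c *\<^sub>R \<gamma> k) (\<lambda>k. sqrt c *\<^sub>R \<beta> k)"
      using \<psi>(2) by (simp add: ok_def subspace_scale[OF subspace_rowsA] subspace_scale[OF subspace_rowsB])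
    then have "\<Psi> m x (\<lambda>k. sqrt c *\<^sub>R \<gamma> k) (\<lambda>k. sqrt c *\<^sub>R \<beta> k) \<in> P"
      unfolding P_def by blast
    moreover have "\<Psi> m x (\<lambda>k. sqrt c *\<^sub>R \<gamma> k) (\<lambda>k. sqrt c *\<^sub>R \<beta> k) p = c * \<psi> p"
      if "p \<in> row_states n \<times> row_states n" for p
    proof -
      have p: "fst p \<in> row_states n" "snd p \<in> row_states n" using that by auto
      have "(\<Sum>k<m. \<Sum>k'<m. ?f (sqrt c *\<^sub>R \<gamma> k) (x k k') (sqrt c *\<^sub>R \<beta> k'))
          = (\<Sum>k<m. \<Sum>k'<m. c * ?f (\<gamma> k) (x k k') (\<beta> k'))"
        using \<psi>(2) c by (intro sum.cong refl) (auto simp: form_scale ok_def matrices_def)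
      then show ?thesis
        using c by (simp add: \<psi>(1) \<Psi>_def row_states_scale[OF p(1)] row_states_scale[OF p(2)]
            flip: sum_distrib_left) (simp add: algebra_simps)
    qed
    ultimately show "\<exists>\<omega>\<in>P. \<forall>p\<in>row_states n \<times> row_states n. \<omega> p = c * \<psi> p" by blast
  next
    have "matrix_norm 0 (\<lambda>_ _. 0 :: 'hx \<Rightarrow>\<^sub>L 'hx) \<le> 1" by (rule matrix_norm_leI) auto
    then have "ok 0 (\<lambda>_ _. 0) (\<lambda>_. 0) (\<lambda>_. 0)"
      using subspace_0[OF subspace_rowsA] subspace_0[OF subspace_rowsB] by (simp add: ok_def matrices_def)
    then have "\<Psi> 0 (\<lambda>_ _. 0) (\<lambda>_. 0) (\<lambda>_. 0) \<in> P" unfolding P_def by blast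
    then show "(\<lambda>p. 0) \<in> P" by (simp add: \<Psi>_def)
  next
    fix \<psi> and e :: real assume "\<psi> \<in> P" and e: "0 < e"
    then obtain m x \<gamma> \<beta> where \<psi>: "\<psi> = \<Psi> m x \<gamma> \<beta>" "ok m x \<gamma> \<beta>" by (auto simp: P_def)
    \<comment> \<open>The stacks are \<open>m\<close> by \<open>n\<close>, so this is the smallest
      common square size. Each state is allowed half of the error, and the inequality between
      geometric and arithmetic mean connects the product bound with the sum of squares.\<close>
    define N where "N = max m n"
    define a where "a = matrix_norm N (\<lambda>k j. if k < m \<and> j < n then \<gamma> k j else 0)"
    define b where "b = matrix_norm N (\<lambda>k j. if k < m \<and> j < n then \<beta> k j else 0)"
    have N: "m \<le> N" "n \<le> N" by (auto simp: N_def)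
    have e2: "0 < e / 2" using e by simp
    obtain s where s: "s \<in> row_states n" "a\<^sup>2 - e / 2 < (\<Sum>k<m. s (\<gamma> k) (\<gamma> k))"
      unfolding a_def by (rule row_states_approx[OF N e2])
    obtain t where t: "t \<in> row_states n" "b\<^sup>2 - e / 2 < (\<Sum>k<m. t (\<beta> k) (\<beta> k))"
      unfolding b_def by (rule row_states_approx[OF N e2])
    have "(\<Sum>k<m. \<Sum>k'<m. ?f (\<gamma> k) (x k k') (\<beta> k')) \<le> a * b"
      unfolding a_def b_def using \<psi>(2) by (intro form_le[OF u v N(2,1)]) (auto simp: ok_def)
    moreover have "2 * (a * b) \<le> a\<^sup>2 + b\<^sup>2" using sum_squares_bound[of a b] by simp
    ultimately have "- e < \<psi> (s, t)" using s(2) t(2) by (simp add: \<psi> \<Psi>_def)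
    then show "\<exists>p\<in>row_states n \<times> row_states n. - e < \<psi> p" using s(1) t(1) by blast
  qed
  then obtain s t where st: "s \<in> row_states n" "t \<in> row_states n" "\<forall>\<psi>\<in>P. 0 \<le> \<psi> (s, t)" by auto
  show thesis
  proof (rule that[OF st(1,2)])
    fix m x and \<gamma> :: "nat \<Rightarrow> nat \<Rightarrow> ('ha \<Rightarrow>\<^sub>L 'ha)" and \<beta> :: "nat \<Rightarrow> nat \<Rightarrow> ('hb \<Rightarrow>\<^sub>L 'hb)"
    assume "x \<in> matrices m X" "matrix_norm m x \<le> 1" "\<And>k. \<gamma> k \<in> rowsA" "\<And>k. \<beta> k \<in> rowsB"
    then have "\<Psi> m x \<gamma> \<beta> \<in> P" by (auto simp: P_def ok_def)
    then have "0 \<le> \<Psi> m x \<gamma> \<beta> (s, t)" using st(3) by blast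
    then show "2 * (\<Sum>k<m. \<Sum>k'<m. form n u v (\<gamma> k) (x k k') (\<beta> k'))
        \<le> (\<Sum>k<m. s (\<gamma> k) (\<gamma> k)) + (\<Sum>k<m. t (\<beta> k) (\<beta> k))"
      by (simp add: \<Psi>_def)
  qed
qed

end

section \<open>Adjoint algebras, nonzero rows and criteria for nondegeneracy\<close>

lemma real_operator_algebra_adj:
  assumes "real_operator_algebra A" shows "real_operator_algebra (adj ` A)"
  using assms unfolding real_operator_algebra_def
  by (auto intro!: linear_subspace_image[OF linear_adj] simp flip: adj_compose)

text \<open>Adjoints reverse products, so convergence from the left and from the right exchange
  their roles.\<close>

lemma approximately_unital_adj:
  assumes "approximately_unital A" shows "approximately_unital (adj ` A)"
proof -
  obtain F where F: "F \<noteq> bot" "\<forall>\<^sub>F e in F. e \<in> A \<and> norm e \<le> 1"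
    "\<And>a. a \<in> A \<Longrightarrow> ((\<lambda>e. e o\<^sub>L a) \<longlongrightarrow> a) F" "\<And>a. a \<in> A \<Longrightarrow> ((\<lambda>e. a o\<^sub>L e) \<longlongrightarrow> a) F"
    using assms unfolding approximately_unital_def by blast
  have bl: "bounded_linear (adj :: ('a \<Rightarrow>\<^sub>L 'a) \<Rightarrow> ('a \<Rightarrow>\<^sub>L 'a))"
    by (rule bounded_linear_intro[of _ 1]) (simp_all add: adj_add adj_scaleR)
  have "filtermap adj F \<noteq> bot" using F(1) by (simp add: filtermap_bot_iff)
  moreover have "\<forall>\<^sub>F e in filtermap adj F. e \<in> adj ` A \<and> norm e \<le> 1"
    unfolding eventually_filtermap using F(2) by eventually_elim auto
  moreover have "((\<lambda>e. e o\<^sub>L adj a) \<longlongrightarrow> adj a) (filtermap adj F)"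
    "((\<lambda>e. adj a o\<^sub>L e) \<longlongrightarrow> adj a) (filtermap adj F)" if "a \<in> A" for a
    using bounded_linear.tendsto[OF bl F(4)[OF that]] bounded_linear.tendsto[OF bl F(3)[OF that]]
    by (simp_all add: filterlim_filtermap adj_compose)
  ultimately show ?thesis unfolding approximately_unital_def by blast
qed

text \<open>Provides a vector state with a nonzero value, so that every copy of the blocks contains
  a nonzero vector. This is where a zero algebra has to be excluded.\<close>

lemma row_states_nonzero:
  fixes B :: "('h::{real_inner, complete_space} \<Rightarrow>\<^sub>L 'h) set"
  assumes "B \<noteq> {0}" and "subspace B"
  obtains h and \<beta> :: "nat \<Rightarrow> ('h \<Rightarrow>\<^sub>L 'h)" where "norm h \<le> 1" and "\<beta> \<in> row_space 1 B"
    and "vector_state 1 (\<lambda>_. h) \<beta> \<beta> \<noteq> 0"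
proof -
  obtain b where b: "b \<in> B" "b \<noteq> 0" using assms subspace_0 by blast
  then obtain y where y: "blinfun_apply b y \<noteq> 0" by (metis blinfun_eqI zero_blinfun.rep_eq)
  then have "y \<noteq> 0" by (auto simp: blinfun.zero_right)
  define h where "h = (1 / norm y) *\<^sub>R y"
  have "norm h \<le> 1" by (simp add: h_def)
  moreover have "(\<lambda>j. if j = 0 then b else 0) \<in> row_space 1 B"
    using b subspace_0[OF assms(2)] by (auto simp: row_space_def)
  moreover have "vector_state 1 (\<lambda>_. h) (\<lambda>j. if j = 0 then b else 0) (\<lambda>j. if j = 0 then b else 0) \<noteq> 0"
    using y \<open>y \<noteq> 0\<close> by (simp add: vector_state_def h_def blinfun.scaleR_right)
  ultimately show thesis using that by blast
qed

lemma infinite_pairing: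
  assumes "infinite (UNIV :: 'i set)"
  obtains f :: "'i \<times> 'i \<Rightarrow> 'i" where "inj f"
proof -
  have "\<exists>f. bij_betw f ((UNIV :: 'i set) \<times> (UNIV :: 'i set)) (UNIV :: 'i set)"
    by (rule card_of_ordIso[THEN iffD2, OF card_of_Times_same_infinite[OF assms]])
  then show thesis using that by (auto simp: bij_betw_def)
qed

text \<open>The additive bound becomes the product bound at the scaling \<open>s = b\<close> and
  \<open>t = a\<close> or \<open>t = - a\<close>, where its two squares are equal.\<close>

lemma bilinear_bound:
  fixes M C a b :: real
  assumes "\<And>s t. 2 * (s * t * M) \<le> C * (s\<^sup>2 * a\<^sup>2 + t\<^sup>2 * b\<^sup>2)" and "0 \<le> a" "0 \<le> b"
  shows "\<bar>M\<bar> \<le> C * a * b"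
proof (cases "a = 0 \<or> b = 0")
  case True
  have "M = 0"
  proof (rule ccontr)
    assume M: "M \<noteq> 0"
    from True show False
    proof
      assume "a = 0"
      \<comment> \<open>With \<open>a = 0\<close> and \<open>t = 1\<close> the bound reads
        \<open>2 * s * M \<le> C * b\<^sup>2\<close>; this \<open>s\<close> violates it by 1. The
        other case is symmetric.\<close>
      then show False using assms(1)[of "(C * b\<^sup>2 + 1) / (2 * M)" 1] M by simp
    next
      assume "b = 0"
      then show False using assms(1)[of 1 "(C * a\<^sup>2 + 1) / (2 * M)"] M by simp
    qed
  qed
  then show ?thesis using True by auto
next
  case False
  then have ab: "0 < a * b" using assms by simp
  have "(a * b) * M \<le> (a * b) * (C * a * b)" "(a * b) * (- M) \<le> (a * b) * (C * a * b)"
    using assms(1)[of b a] assms(1)[of b "- a"] by (simp_all add: power2_eq_square algebra_simps)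
  then have "M \<le> C * a * b" "- M \<le> C * a * b"
    using ab by (simp_all only: mult_le_cancel_left_pos)
  then show ?thesis by linarith
qed

lemma nondegenerate_UNIV:
  assumes "operator_representation B UNIV \<pi>" and "\<And>y. y \<in> closure {blinfun_apply (\<pi> e) y | e. e \<in> B}"
  shows "nondegenerate_representation B UNIV \<pi>"
proof -
  have "y \<in> closure (span {blinfun_apply (\<pi> a) h | a h. a \<in> B \<and> h \<in> UNIV})" for y
  proof -
    have "{blinfun_apply (\<pi> e) y | e. e \<in> B} \<subseteq> span {blinfun_apply (\<pi> a) h | a h. a \<in> B \<and> h \<in> UNIV}"
      by (auto intro: span_base)
    then show ?thesis using assms(2)[of y] closure_mono by blast
  qed
  then show ?thesis using assms(1) by (auto simp: nondegenerate_representation_def)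
qed

text \<open>A vector orthogonal to the ranges of all \<open>\<theta> a\<close> is annihilated by all
  their adjoints, and is then zero because it is a limit of its images under these.\<close>

lemma nondegenerate_UNIV_adj:
  assumes "operator_representation A UNIV \<theta>"
    and "\<And>y. y \<in> closure {blinfun_apply (adj (\<theta> a)) y | a. a \<in> A}"
  shows "nondegenerate_representation A UNIV \<theta>"
proof -
  have "closure (span {blinfun_apply (\<theta> a) h | a h. a \<in> A \<and> h \<in> UNIV}) = UNIV"
  proof (rule dense_if_total[OF subspace_span])
    fix x assume x: "\<And>y. y \<in> span {blinfun_apply (\<theta> a) h | a h. a \<in> A \<and> h \<in> UNIV} \<Longrightarrow> x \<bullet> y = 0"
    have "blinfun_apply (adj (\<theta> a)) x = 0" if "a \<in> A" for a
    proof -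
      have "x \<bullet> blinfun_apply (\<theta> a) (blinfun_apply (adj (\<theta> a)) x) = 0"
        using that by (intro x span_base) blast
      then show ?thesis by (metis adj_left inner_eq_zero_iff)
    qed
    then have "{blinfun_apply (adj (\<theta> a)) x | a. a \<in> A} \<subseteq> {0}" by blast
    then have "closure {blinfun_apply (adj (\<theta> a)) x | a. a \<in> A} \<subseteq> {0}"
      by (rule closure_minimal) (rule closed_singleton)
    then show "x = 0" using assms(2)[of x] by blast
  qed
  then show ?thesis using assms(1) by (simp add: nondegenerate_representation_def)
qed

lemma vector_state_cong:
  "(\<And>j. j < n \<Longrightarrow> h j = h' j) \<Longrightarrow> vector_state n h = vector_state n h'"
  by (intro ext) (simp add: vector_state_def)

section \<open>Choice of the blocks\<close>

context contractive_bimodule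
begin

lemma form_cong:
  "(\<And>j. j < n \<Longrightarrow> u j = u' j) \<Longrightarrow> (\<And>j. j < n \<Longrightarrow> v j = v' j) \<Longrightarrow> form n u v = form n u' v'"
  by (intro ext) (simp add: form_def)

text \<open>Rows with a single entry pick out one entry of the operator, with \<open>a\<close> and
  \<open>b\<close> acting on the two sides; they are the test rows for the lower bound on
  \<open>\<Phi>\<close>.\<close>

lemma form_delta:
  assumes "a \<in> A" "b \<in> B" "x \<in> X" "k < n" "k' < n"
  shows "form n u v (\<lambda>i. if i = k \<and> k < n then adj a else 0) x (\<lambda>j. if j = k' \<and> k' < n then b else 0)
    = blinfun_apply (r (l a x) b) (v k') \<bullet> u k"
proof -
  have "form n u v (\<lambda>i. if i = k \<and> k < n then adj a else 0) x (\<lambda>j. if j = k' \<and> k' < n then b else 0)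
    = (\<Sum>i<n. \<Sum>j<n. if j = k' then (if i = k then blinfun_apply (r (l a x) b) (v k') \<bullet> u k else 0) else 0)"
    unfolding form_def using assms
    by (intro sum.cong refl) (auto simp: l_zero r_zero r_zero2 l_in subspace_0[OF subX])
  then show ?thesis using assms by simp
qed

definition admissible where
  "admissible n u v s t \<longleftrightarrow> s \<in> row_states n \<and> t \<in> row_states n \<and>
    (\<forall>m x \<gamma> \<beta>. x \<in> matrices m X \<longrightarrow> matrix_norm m x \<le> 1 \<longrightarrow>
      (\<forall>k. \<gamma> k \<in> rowsA) \<longrightarrow> (\<forall>k. \<beta> k \<in> rowsB) \<longrightarrow>
      2 * (\<Sum>k<m. \<Sum>k'<m. form n u v (\<gamma> (k::nat)) (x k k') (\<beta> k'))
        \<le> (\<Sum>k<m. s (\<gamma> k) (\<gamma> k)) + (\<Sum>k<m. t (\<beta> k) (\<beta> k)))"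

text \<open>For the blocks without a functional: the zero tuples give the zero form, which every
  pair of states dominates.\<close>

lemma admissible_zero:
  assumes "s \<in> row_states n" "t \<in> row_states n"
  shows "admissible n (\<lambda>_. 0) (\<lambda>_. 0) s t"
proof -
  have "0 \<le> (\<Sum>k<m. s (\<gamma> k) (\<gamma> k)) + (\<Sum>k<m. t (\<beta> k) (\<beta> k))" for m :: nat and \<gamma> \<beta>
    by (intro add_nonneg_nonneg sum_nonneg row_states_nonneg[OF assms(1)] row_states_nonneg[OF assms(2)])
  then show ?thesis unfolding admissible_def form_def using assms by simp
qed

end

text \<open>
  The blocks of the Hilbert spaces, each repeated \<open>'i\<close> many times: those with \<open>True\<close> are for the
  functionals on matrices over \<open>X\<close>, those with \<open>False\<close> make the representations isometric.
\<close>

type_synonym ('a1, 'b1, 'x1, 'i1) block =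
  "(bool \<times> 'x1 list \<times> 'x1 list \<times> 'a1 list \<times> 'b1 list) \<times> 'i1"

context contractive_bimodule
begin

text \<open>All data are chosen at once, one tuple of data for each code. Lists agree with the coded
  tuples only below their length, which is all that \<open>form\<close> and
  \<open>vector_state\<close> depend on.\<close>

lemma block_choice:
  obtains n u v s t where
    "\<And>p :: ('ha, 'hb, 'hx, 'i) block. admissible (n p) (u p) (v p) (s p) (t p)"
    and "\<And>m x y i. (\<Sum>j<m. (norm (x j))\<^sup>2) \<le> 1 \<Longrightarrow> (\<Sum>j<m. (norm (y j))\<^sup>2) \<le> 1 \<Longrightarrow>
      \<exists>p. snd p = i \<and> n p = m \<and> form (n p) (u p) (v p) = form m x y"
    and "\<And>m h i. (\<Sum>j<m. (norm (h j))\<^sup>2) \<le> 1 \<Longrightarrow> \<exists>p. snd p = i \<and> n p = m \<and> s p = vector_state m h"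
    and "\<And>m h i. (\<Sum>j<m. (norm (h j))\<^sup>2) \<le> 1 \<Longrightarrow> \<exists>p. snd p = i \<and> n p = m \<and> t p = vector_state m h"
proof -
  \<comment> \<open>The implications constrain only meaningful codes: lists of equal length with
    tuples in the unit ball. Other codes may receive any admissible data.\<close>
  define spec where "spec p n u v s t \<longleftrightarrow> (case p of ((b, us, vs, hs, ks), i) \<Rightarrow>
      (b \<longrightarrow> length vs = length us \<longrightarrow> (\<Sum>j<length us. (norm (us ! j))\<^sup>2) \<le> 1 \<longrightarrow>
        (\<Sum>j<length us. (norm (vs ! j))\<^sup>2) \<le> 1 \<longrightarrow> n = length us \<and> u = (!) us \<and> v = (!) vs) \<and>
      (\<not> b \<longrightarrow> length ks = length hs \<longrightarrow> (\<Sum>j<length hs. (norm (hs ! j))\<^sup>2) \<le> 1 \<longrightarrow>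
        (\<Sum>j<length hs. (norm (ks ! j))\<^sup>2) \<le> 1 \<longrightarrow>
        n = length hs \<and> s = vector_state n ((!) hs) \<and> t = vector_state n ((!) ks)))"
    for p :: "('ha, 'hb, 'hx, 'i) block" and n u v s t
  have ex: "\<exists>n u v s t. admissible n u v s t \<and> spec p n u v s t" for p
  proof -
    obtain b us vs hs ks i where p: "p = ((b, us, vs, hs, ks), i)" by (metis prod.exhaust)
    \<comment> \<open>The block of size 0, assigned to codes without meaning.\<close>
    have ad0: "admissible 0 (\<lambda>_. 0) (\<lambda>_. 0) (vector_state 0 (\<lambda>_. 0)) (vector_state 0 (\<lambda>_. 0))"
      by (intro admissible_zero vector_state_in_row_states) simp_all
    show ?thesis
    proof (cases b)
      case True
      show ?thesis
      proof (cases "length vs = length us \<and> (\<Sum>j<length us. (norm (us ! j))\<^sup>2) \<le> 1 \<and>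
          (\<Sum>j<length us. (norm (vs ! j))\<^sup>2) \<le> 1")
        case c: True
        then have c1: "(\<Sum>j<length us. (norm (us ! j))\<^sup>2) \<le> 1" and c2: "(\<Sum>j<length us. (norm (vs ! j))\<^sup>2) \<le> 1"
          by simp_all
        obtain s t where "s \<in> row_states (length us)" "t \<in> row_states (length us)"
          and "\<And>m x (\<gamma> :: nat \<Rightarrow> _) (\<beta> :: nat \<Rightarrow> _). x \<in> matrices m X \<Longrightarrow> matrix_norm m x \<le> 1 \<Longrightarrow>
            (\<And>k. \<gamma> k \<in> rowsA) \<Longrightarrow> (\<And>k. \<beta> k \<in> rowsB) \<Longrightarrow>
            2 * (\<Sum>k<m. \<Sum>k'<m. form (length us) ((!) us) ((!) vs) (\<gamma> k) (x k k') (\<beta> k'))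
              \<le> (\<Sum>k<m. s (\<gamma> k) (\<gamma> k)) + (\<Sum>k<m. t (\<beta> k) (\<beta> k))"
          by (rule dominating_states[where u = "(!) us" and v = "(!) vs", OF c1 c2]) blast
        then have "admissible (length us) ((!) us) ((!) vs) s t" unfolding admissible_def by blast
        moreover have "spec p (length us) ((!) us) ((!) vs) s t" using True by (simp add: spec_def p)
        ultimately show ?thesis by blast
      next
        case False
        then have "spec p 0 (\<lambda>_. 0) (\<lambda>_. 0) (vector_state 0 (\<lambda>_. 0)) (vector_state 0 (\<lambda>_. 0))"
          using True by (auto simp: spec_def p)
        then show ?thesis using ad0 by blast
      qed
    next
      case False
      show ?thesis
      proof (cases "length ks = length hs \<and> (\<Sum>j<length hs. (norm (hs ! j))\<^sup>2) \<le> 1 \<and>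
          (\<Sum>j<length hs. (norm (ks ! j))\<^sup>2) \<le> 1")
        case c: True
        then have "admissible (length hs) (\<lambda>_. 0) (\<lambda>_. 0) (vector_state (length hs) ((!) hs))
            (vector_state (length hs) ((!) ks))"
          by (intro admissible_zero vector_state_in_row_states) auto
        moreover have "spec p (length hs) (\<lambda>_. 0) (\<lambda>_. 0) (vector_state (length hs) ((!) hs))
            (vector_state (length hs) ((!) ks))"
          using False by (simp add: spec_def p)
        ultimately show ?thesis by blast
      next
        case c: False
        then have "spec p 0 (\<lambda>_. 0) (\<lambda>_. 0) (vector_state 0 (\<lambda>_. 0)) (vector_state 0 (\<lambda>_. 0))"
          using False by (auto simp: spec_def p)
        then show ?thesis using ad0 by blast
      qed
    qed
  qed
  obtain n u v s t where ch: "\<And>p. admissible (n p) (u p) (v p) (s p) (t p)"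
      "\<And>p. spec p (n p) (u p) (v p) (s p) (t p)"
    using ex by metis
  show thesis
  proof (rule that[OF ch(1)])
    fix m and x y :: "nat \<Rightarrow> 'hx" and i
    assume "(\<Sum>j<m. (norm (x j))\<^sup>2) \<le> 1" "(\<Sum>j<m. (norm (y j))\<^sup>2) \<le> 1"
    then have "n ((True, map x [0..<m], map y [0..<m], [], []), i) = m"
      "u ((True, map x [0..<m], map y [0..<m], [], []), i) = (!) (map x [0..<m])"
      "v ((True, map x [0..<m], map y [0..<m], [], []), i) = (!) (map y [0..<m])"
      using ch(2)[of "((True, map x [0..<m], map y [0..<m], [], []), i)"] by (simp_all add: spec_def)
    then show "\<exists>p. snd p = i \<and> n p = m \<and> form (n p) (u p) (v p) = form m x y"
      by (intro exI[of _ "((True, map x [0..<m], map y [0..<m], [], []), i)"]) (auto intro: form_cong)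
  next
    fix m and h :: "nat \<Rightarrow> 'ha" and i
    assume "(\<Sum>j<m. (norm (h j))\<^sup>2) \<le> 1"
    \<comment> \<open>Both states of a block share one size, so the tuple for the other algebra is
      filled with zeros.\<close>
    then have "n ((False, [], [], map h [0..<m], replicate m 0), i) = m"
      "s ((False, [], [], map h [0..<m], replicate m 0), i) = vector_state m ((!) (map h [0..<m]))"
      using ch(2)[of "((False, [], [], map h [0..<m], replicate m 0), i)"] by (simp_all add: spec_def)
    then show "\<exists>p. snd p = i \<and> n p = m \<and> s p = vector_state m h"
      by (intro exI[of _ "((False, [], [], map h [0..<m], replicate m 0), i)"])
        (auto intro: vector_state_cong)
  next
    fix m and h :: "nat \<Rightarrow> 'hb" and i
    assume "(\<Sum>j<m. (norm (h j))\<^sup>2) \<le> 1"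
    then have "n ((False, [], [], replicate m 0, map h [0..<m]), i) = m"
      "t ((False, [], [], replicate m 0, map h [0..<m]), i) = vector_state m ((!) (map h [0..<m]))"
      using ch(2)[of "((False, [], [], replicate m 0, map h [0..<m]), i)"] by (simp_all add: spec_def)
    then show "\<exists>p. snd p = i \<and> n p = m \<and> t p = vector_state m h"
      by (intro exI[of _ "((False, [], [], replicate m 0, map h [0..<m]), i)"])
        (auto intro: vector_state_cong)
  qed
qed

end

section \<open>The maps on \<open>X\<close>, \<open>A\<close> and \<open>B\<close> built from the
  blocks\<close>

lemma blinfun_eq_on_dense_form:
  fixes S T :: "'e::real_normed_vector \<Rightarrow>\<^sub>L 'f::real_inner"
  assumes "closure Z = UNIV" "closure Y = UNIV"
    and "\<And>z y. z \<in> Z \<Longrightarrow> y \<in> Y \<Longrightarrow> blinfun_apply S z \<bullet> y = blinfun_apply T z \<bullet> y"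
  shows "S = T"
  using assms(3) by (intro blinfun_eq_on_dense[OF assms(1)] dense_inner_eqI[OF assms(2)])

locale bimodule_representation = contractive_bimodule A B X l r
  for A :: "('ha::{real_inner, complete_space} \<Rightarrow>\<^sub>L 'ha) set"
    and B :: "('hb::{real_inner, complete_space} \<Rightarrow>\<^sub>L 'hb) set"
    and X :: "('hx::{real_inner, complete_space} \<Rightarrow>\<^sub>L 'hx) set"
    and l r +
  fixes n :: "'p \<Rightarrow> nat" and u v :: "'p \<Rightarrow> nat \<Rightarrow> 'hx"
    and s :: "'p \<Rightarrow> (nat \<Rightarrow> ('ha \<Rightarrow>\<^sub>L 'ha)) \<Rightarrow> (nat \<Rightarrow> ('ha \<Rightarrow>\<^sub>L 'ha)) \<Rightarrow> real"
    and t :: "'p \<Rightarrow> (nat \<Rightarrow> ('hb \<Rightarrow>\<^sub>L 'hb)) \<Rightarrow> (nat \<Rightarrow> ('hb \<Rightarrow>\<^sub>L 'hb)) \<Rightarrow> real"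
    and \<phi> :: "'p \<Rightarrow> (nat \<Rightarrow> ('ha \<Rightarrow>\<^sub>L 'ha)) \<Rightarrow> 'i ell2"
    and \<psi> :: "'p \<Rightarrow> (nat \<Rightarrow> ('hb \<Rightarrow>\<^sub>L 'hb)) \<Rightarrow> 'i ell2"
  assumes adm: "admissible (n p) (u p) (v p) (s p) (t p)"
    and gramA: "gram_representation (adj ` A) n s \<phi>"
    and gramB: "gram_representation B n t \<psi>"
    and forms: "(\<Sum>j<m. (norm (x j))\<^sup>2) \<le> 1 \<Longrightarrow> (\<Sum>j<m. (norm (y j))\<^sup>2) \<le> 1 \<Longrightarrow>
      \<exists>p. n p = m \<and> form (n p) (u p) (v p) = form m x y"
    and vsA: "(\<Sum>j<m. (norm (h j))\<^sup>2) \<le> 1 \<Longrightarrow> \<exists>p. n p = m \<and> s p = vector_state m h"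
    and vsB: "(\<Sum>j<m. (norm (k j))\<^sup>2) \<le> 1 \<Longrightarrow> \<exists>p. n p = m \<and> t p = vector_state m k"
begin

sublocale GA: gram_representation "adj ` A" n s \<phi> by (rule gramA)
sublocale GB: gram_representation B n t \<psi> by (rule gramB)

lemma rowA: "\<gamma> \<in> GA.V \<Longrightarrow> \<gamma> p \<in> rowsA"
  using row_families_row[of \<gamma> n "adj ` A" p] by (auto simp: row_space_def rowsA_def) (metis adj_adj imageE)

lemma rowB: "\<beta> \<in> GB.V \<Longrightarrow> \<beta> p \<in> rowsB"
  using row_families_row[of \<beta> n B p] by (auto simp: row_space_def rowsB_def)

text \<open>Blocks do not interact. Summing over the support of \<open>\<beta>\<close> alone keeps
  the sum finite and omits only zero terms.\<close>

definition total_form where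
  "total_form \<gamma> x \<beta> = (\<Sum>p | \<beta> p \<noteq> 0. form (n p) (u p) (v p) (\<gamma> p) x (\<beta> p))"

lemma form_zeroB: "\<gamma> \<in> rowsA \<Longrightarrow> x \<in> X \<Longrightarrow> form m y z \<gamma> x 0 = 0"
  using real_linear_on_zero[OF form_linearB subspace_rowsB] .

lemma total_form_eq:
  assumes "\<gamma> \<in> GA.V" "x \<in> X" "finite S" "{p. \<beta> p \<noteq> 0} \<subseteq> S"
  shows "total_form \<gamma> x \<beta> = (\<Sum>p\<in>S. form (n p) (u p) (v p) (\<gamma> p) x (\<beta> p))"
  unfolding total_form_def using assms
  by (intro sum.mono_neutral_left) (auto simp: form_zeroB rowA)

lemma total_form_linearA:
  assumes "x \<in> X" "\<beta> \<in> GB.V"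
  shows "real_linear_on GA.V (\<lambda>\<gamma>. total_form \<gamma> x \<beta>)"
  using form_linearA[OF assms(1) rowB[OF assms(2)]] rowA
  by (simp add: real_linear_on_def total_form_def sum.distrib sum_distrib_left)

lemma total_form_linearX:
  assumes "\<gamma> \<in> GA.V" "\<beta> \<in> GB.V"
  shows "real_linear_on X (\<lambda>x. total_form \<gamma> x \<beta>)"
  using form_linearX[OF rowA[OF assms(1)] rowB[OF assms(2)]]
  by (simp add: real_linear_on_def total_form_def sum.distrib sum_distrib_left)

lemma total_form_linearB:
  assumes "\<gamma> \<in> GA.V" "x \<in> X"
  shows "real_linear_on GB.V (total_form \<gamma> x)"
  unfolding real_linear_on_def
proof (intro conjI ballI allI)
  note lin = form_linearB[OF rowA[OF assms(1)] assms(2), unfolded real_linear_on_def]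
  fix \<beta> \<beta>' assume V: "\<beta> \<in> GB.V" "\<beta>' \<in> GB.V"
  let ?S = "{p. \<beta> p \<noteq> 0} \<union> {p. \<beta>' p \<noteq> 0}"
  have S: "finite ?S" using V by (simp add: finite_support)
  have "total_form \<gamma> x (\<beta> + \<beta>') = (\<Sum>p\<in>?S. form (n p) (u p) (v p) (\<gamma> p) x (\<beta> p + \<beta>' p))"
    by (subst total_form_eq[OF assms S]) auto
  also have "\<dots> = (\<Sum>p\<in>?S. form (n p) (u p) (v p) (\<gamma> p) x (\<beta> p))
      + (\<Sum>p\<in>?S. form (n p) (u p) (v p) (\<gamma> p) x (\<beta>' p))"
    using lin rowB[OF V(1)] rowB[OF V(2)] by (simp add: sum.distrib)
  also have "\<dots> = total_form \<gamma> x \<beta> + total_form \<gamma> x \<beta>'"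
    by (intro arg_cong2[where f = "(+)"] total_form_eq[OF assms S, symmetric]) auto
  finally show "total_form \<gamma> x (\<beta> + \<beta>') = total_form \<gamma> x \<beta> + total_form \<gamma> x \<beta>'" .
next
  note lin = form_linearB[OF rowA[OF assms(1)] assms(2), unfolded real_linear_on_def]
  fix c \<beta> assume V: "\<beta> \<in> GB.V"
  have "total_form \<gamma> x (c *\<^sub>R \<beta>) = (\<Sum>p | \<beta> p \<noteq> 0. form (n p) (u p) (v p) (\<gamma> p) x (c *\<^sub>R \<beta> p))"
    by (subst total_form_eq[OF assms finite_support[OF V]]) auto
  also have "\<dots> = c *\<^sub>R total_form \<gamma> x \<beta>"
    using lin rowB[OF V] by (simp add: total_form_def sum_distrib_left)
  finally show "total_form \<gamma> x (c *\<^sub>R \<beta>) = c *\<^sub>R total_form \<gamma> x \<beta>" .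
qed

lemma total_form_left:
  assumes "a \<in> A" "\<gamma> \<in> GA.V" "x \<in> X" "\<beta> \<in> GB.V"
  shows "total_form (lmult (adj a) \<gamma>) x \<beta> = total_form \<gamma> (l a x) \<beta>"
  unfolding total_form_def
  by (intro sum.cong refl) (simp add: lmult_def form_left[OF assms(1) rowA[OF assms(2)] assms(3) rowB[OF assms(4)]])

lemma total_form_right:
  assumes "b \<in> B" "\<gamma> \<in> GA.V" "x \<in> X" "\<beta> \<in> GB.V"
  shows "total_form \<gamma> x (lmult b \<beta>) = total_form \<gamma> (r x b) \<beta>"
proof -
  have "total_form \<gamma> x (lmult b \<beta>) = (\<Sum>p | \<beta> p \<noteq> 0. form (n p) (u p) (v p) (\<gamma> p) x (lmult b \<beta> p))"
    by (rule total_form_eq[OF assms(2,3) finite_support[OF assms(4)]]) (auto simp: lmult_def zero_fun_def)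
  then show ?thesis
    unfolding total_form_def
    by (simp add: lmult_def form_right[OF assms(1) rowA[OF assms(2)] assms(3) rowB[OF assms(4)]])
qed

lemma total_form_single:
  assumes "\<gamma> \<in> row_space (n p) (adj ` A)" "x \<in> X"
  shows "total_form (single_row p \<gamma>) x (single_row p \<beta>) = form (n p) (u p) (v p) \<gamma> x \<beta>"
  using assms by (subst total_form_eq[of _ _ "{p}"])
    (auto simp: single_row_def intro!: single_row_in[OF GA.sub_B, unfolded single_row_def])

text \<open>The states dominate in every block, and their values add up to the square norms of the
  vectors. \<open>C\<close> lies strictly above the norm of \<open>x\<close> so that it is positive
  and \<open>x\<close> can be scaled to norm at most 1, also if its norm is 0.\<close>

lemma total_form_dominated:
  assumes x: "x \<in> matrices m X" and C: "matrix_norm m x < C"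
    and \<gamma>: "\<And>k. \<gamma> k \<in> GA.V" and \<beta>: "\<And>k. \<beta> k \<in> GB.V"
  shows "2 * (\<Sum>k<m. \<Sum>k'<m. total_form (\<gamma> k) (x k k') (\<beta> k'))
    \<le> C * ((\<Sum>k<m. (norm (GB.vec (\<beta> k)))\<^sup>2) + (\<Sum>k<m. (norm (GA.vec (\<gamma> k)))\<^sup>2))"
proof -
  have C0: "0 < C" using C matrix_norm_nonneg[of m x] by linarith
  define y where "y k k' = (1 / C) *\<^sub>R x k k'" for k k'
  have xX: "x k k' \<in> X" if "k < m" "k' < m" for k k' using x that by (simp add: matrices_def)
  have y: "y \<in> matrices m X" using xX subspace_scale[OF subX] by (simp add: y_def matrices_def)
  have "matrix_norm m y \<le> \<bar>1 / C\<bar> * matrix_norm m x" unfolding y_def by (rule matrix_norm_scaleR_le)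
  also have "\<dots> \<le> 1" using C C0 by (simp add: field_simps)
  finally have y1: "matrix_norm m y \<le> 1" .
  define S where "S = (\<Union>k<m. {p. \<beta> k p \<noteq> 0} \<union> {p. \<gamma> k p \<noteq> 0})"
  have S: "finite S" unfolding S_def using finite_support[OF \<beta>] finite_support[OF \<gamma>] by auto
  have "2 * (\<Sum>k<m. \<Sum>k'<m. total_form (\<gamma> k) (y k k') (\<beta> k'))
      = 2 * (\<Sum>k<m. \<Sum>k'<m. \<Sum>p\<in>S. form (n p) (u p) (v p) (\<gamma> k p) (y k k') (\<beta> k' p))"
    using y by (intro arg_cong[where f = "(*) 2"] sum.cong refl total_form_eq[OF \<gamma> _ S])
      (auto simp: S_def matrices_def)
  also have "\<dots> = 2 * (\<Sum>k<m. \<Sum>p\<in>S. \<Sum>k'<m. form (n p) (u p) (v p) (\<gamma> k p) (y k k') (\<beta> k' p))"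
    by (rule arg_cong[where f = "(*) 2"], rule sum.cong[OF refl], rule sum.swap)
  also have "\<dots> = 2 * (\<Sum>p\<in>S. \<Sum>k<m. \<Sum>k'<m. form (n p) (u p) (v p) (\<gamma> k p) (y k k') (\<beta> k' p))"
    by (rule arg_cong[where f = "(*) 2"], rule sum.swap)
  also have "\<dots> = (\<Sum>p\<in>S. 2 * (\<Sum>k<m. \<Sum>k'<m. form (n p) (u p) (v p) (\<gamma> k p) (y k k') (\<beta> k' p)))"
    by (rule sum_distrib_left)
  also have "\<dots> \<le> (\<Sum>p\<in>S. (\<Sum>k<m. s p (\<gamma> k p) (\<gamma> k p)) + (\<Sum>k<m. t p (\<beta> k p) (\<beta> k p)))"
  proof (rule sum_mono)
    fix p
    have rA: "\<forall>k. (\<lambda>k. \<gamma> k p) k \<in> rowsA" and rB: "\<forall>k. (\<lambda>k. \<beta> k p) k \<in> rowsB"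
      using rowA[OF \<gamma>] rowB[OF \<beta>] by auto
    show "2 * (\<Sum>k<m. \<Sum>k'<m. form (n p) (u p) (v p) (\<gamma> k p) (y k k') (\<beta> k' p))
        \<le> (\<Sum>k<m. s p (\<gamma> k p) (\<gamma> k p)) + (\<Sum>k<m. t p (\<beta> k p) (\<beta> k p))"
      using adm[of p, unfolded admissible_def, THEN conjunct2, THEN conjunct2,
          rule_format, OF y y1, of "\<lambda>k. \<gamma> k p" "\<lambda>k. \<beta> k p"] rA rB by blast
  qed
  also have "\<dots> = (\<Sum>k<m. \<Sum>p\<in>S. s p (\<gamma> k p) (\<gamma> k p)) + (\<Sum>k<m. \<Sum>p\<in>S. t p (\<beta> k p) (\<beta> k p))"
    unfolding sum.distrib by (rule arg_cong2[where f = "(+)"]; rule sum.swap)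
  also have "\<dots> = (\<Sum>k<m. (norm (GA.vec (\<gamma> k)))\<^sup>2) + (\<Sum>k<m. (norm (GB.vec (\<beta> k)))\<^sup>2)"
    by (intro arg_cong2[where f = "(+)"] sum.cong refl GA.norm_vec[symmetric] GB.norm_vec[symmetric] \<gamma> \<beta> S)
      (auto simp: S_def)
  finally have main: "2 * (\<Sum>k<m. \<Sum>k'<m. total_form (\<gamma> k) (y k k') (\<beta> k'))
    \<le> (\<Sum>k<m. (norm (GA.vec (\<gamma> k)))\<^sup>2) + (\<Sum>k<m. (norm (GB.vec (\<beta> k)))\<^sup>2)" .
  have "total_form (\<gamma> k) (x k k') (\<beta> k') = C * total_form (\<gamma> k) (y k k') (\<beta> k')" if "k < m" "k' < m" for k k'
    using total_form_linearX[OF \<gamma> \<beta>, of k k'] xX[OF that] C0 by (simp add: y_def real_linear_on_def)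
  then have "2 * (\<Sum>k<m. \<Sum>k'<m. total_form (\<gamma> k) (x k k') (\<beta> k'))
      = C * (2 * (\<Sum>k<m. \<Sum>k'<m. total_form (\<gamma> k) (y k k') (\<beta> k')))"
    by (simp add: sum_distrib_left mult.left_commute)
  also have "\<dots> \<le> C * ((\<Sum>k<m. (norm (GA.vec (\<gamma> k)))\<^sup>2) + (\<Sum>k<m. (norm (GB.vec (\<beta> k)))\<^sup>2))"
    using main C0 by (intro mult_left_mono) auto
  finally show ?thesis by (simp add: add.commute)
qed

text \<open>The constant only has to be finite, for the sake of defining \<open>\<Phi> x\<close>;
  the \<open>+ 1\<close> meets the strict inequality in \<open>total_form_dominated\<close>. The
  sharp norm comes from the matrix estimates.\<close>

lemma total_form_bounded:
  assumes x: "x \<in> X" and \<gamma>: "\<gamma> \<in> GA.V" and \<beta>: "\<beta> \<in> GB.V"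
  shows "\<bar>total_form \<gamma> x \<beta>\<bar> \<le> (norm x + 1) * norm (GB.vec \<beta>) * norm (GA.vec \<gamma>)"
proof (rule bilinear_bound)
  fix a b :: real
  have V: "b *\<^sub>R \<gamma> \<in> GA.V" "a *\<^sub>R \<beta> \<in> GB.V"
    using subspace_scale[OF GA.sub_V \<gamma>] subspace_scale[OF GB.sub_V \<beta>] by auto
  have "2 * total_form (b *\<^sub>R \<gamma>) x (a *\<^sub>R \<beta>)
    \<le> (norm x + 1) * ((norm (GB.vec (a *\<^sub>R \<beta>)))\<^sup>2 + (norm (GA.vec (b *\<^sub>R \<gamma>)))\<^sup>2)"
    using total_form_dominated[of "\<lambda>_ _. x" 1 "norm x + 1" "\<lambda>_. b *\<^sub>R \<gamma>" "\<lambda>_. a *\<^sub>R \<beta>"]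
      x V matrix_norm_one[of "\<lambda>_ _. x"] by (simp add: matrices_def)
  moreover have "total_form (b *\<^sub>R \<gamma>) x (a *\<^sub>R \<beta>) = b * (a * total_form \<gamma> x \<beta>)"
    using total_form_linearA[OF x V(2)] total_form_linearB[OF \<gamma> x] \<gamma> \<beta>
    by (simp add: real_linear_on_def)
  ultimately show "2 * (a * b * total_form \<gamma> x \<beta>)
      \<le> (norm x + 1) * (a\<^sup>2 * (norm (GB.vec \<beta>))\<^sup>2 + b\<^sup>2 * (norm (GA.vec \<gamma>))\<^sup>2)"
    using \<gamma> \<beta> by (simp add: GA.vec_scaleR GB.vec_scaleR power_mult_distrib mult.assoc mult.left_commute)
qed simp_all

definition \<Phi> :: "('hx \<Rightarrow>\<^sub>L 'hx) \<Rightarrow> ('i ell2 \<Rightarrow>\<^sub>L 'i ell2)"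
  where "\<Phi> x = (SOME T. \<forall>\<beta>\<in>GB.V. \<forall>\<gamma>\<in>GA.V. blinfun_apply T (GB.vec \<beta>) \<bullet> GA.vec \<gamma> = total_form \<gamma> x \<beta>)"

lemma \<Phi>_form:
  assumes x: "x \<in> X" and "\<beta> \<in> GB.V" "\<gamma> \<in> GA.V"
  shows "blinfun_apply (\<Phi> x) (GB.vec \<beta>) \<bullet> GA.vec \<gamma> = total_form \<gamma> x \<beta>"
proof -
  obtain T where T: "\<And>\<beta> \<gamma>. \<beta> \<in> GB.V \<Longrightarrow> \<gamma> \<in> GA.V \<Longrightarrow>
      blinfun_apply T (GB.vec \<beta>) \<bullet> GA.vec \<gamma> = total_form \<gamma> x \<beta>"
    by (rule operator_of_form[OF GB.sub_V GA.sub_V GB.vec_linear GA.vec_linear GB.vec_dense GA.vec_dense,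
          where m = "\<lambda>\<beta> \<gamma>. total_form \<gamma> x \<beta>"])
      (use total_form_linearA[OF x] total_form_linearB[OF _ x] total_form_bounded[OF x] in blast)+
  then have "\<forall>\<beta>\<in>GB.V. \<forall>\<gamma>\<in>GA.V. blinfun_apply (\<Phi> x) (GB.vec \<beta>) \<bullet> GA.vec \<gamma> = total_form \<gamma> x \<beta>"
    unfolding \<Phi>_def
    by (intro someI[where P = "\<lambda>T. \<forall>\<beta>\<in>GB.V. \<forall>\<gamma>\<in>GA.V. blinfun_apply T (GB.vec \<beta>) \<bullet> GA.vec \<gamma> = total_form \<gamma> x \<beta>"]) blast
  then show ?thesis using assms by blast
qed

lemma \<Phi>_linear: "real_linear_on X \<Phi>"
  unfolding real_linear_on_def
proof (intro conjI ballI allI)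
  show "\<Phi> (x + y) = \<Phi> x + \<Phi> y" if "x \<in> X" "y \<in> X" for x y
  proof (rule blinfun_eq_on_dense_form[OF GB.vec_dense GA.vec_dense], clarify)
    fix \<beta> \<gamma> assume "\<beta> \<in> GB.V" "\<gamma> \<in> GA.V"
    then show "blinfun_apply (\<Phi> (x + y)) (GB.vec \<beta>) \<bullet> GA.vec \<gamma>
        = blinfun_apply (\<Phi> x + \<Phi> y) (GB.vec \<beta>) \<bullet> GA.vec \<gamma>"
      using that subspace_add[OF subX that] total_form_linearX[of \<gamma> \<beta>]
      by (simp add: \<Phi>_form blinfun.add_left inner_add_left real_linear_on_def)
  qed
  show "\<Phi> (c *\<^sub>R x) = c *\<^sub>R \<Phi> x" if "x \<in> X" for c x
  proof (rule blinfun_eq_on_dense_form[OF GB.vec_dense GA.vec_dense], clarify)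
    fix \<beta> \<gamma> assume "\<beta> \<in> GB.V" "\<gamma> \<in> GA.V"
    then show "blinfun_apply (\<Phi> (c *\<^sub>R x)) (GB.vec \<beta>) \<bullet> GA.vec \<gamma>
        = blinfun_apply (c *\<^sub>R \<Phi> x) (GB.vec \<beta>) \<bullet> GA.vec \<gamma>"
      using that subspace_scale[OF subX that] total_form_linearX[of \<gamma> \<beta>]
      by (simp add: \<Phi>_form blinfun.scaleR_left real_linear_on_def)
  qed
qed

lemma \<Phi>_contractive:
  assumes x: "x \<in> matrices m X"
  shows "matrix_norm m (\<lambda>i j. \<Phi> (x i j)) \<le> matrix_norm m x"
proof (rule field_le_epsilon)
  fix e :: real assume e: "0 < e"
  show "matrix_norm m (\<lambda>i j. \<Phi> (x i j)) \<le> matrix_norm m x + e"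
  proof (rule matrix_norm_leI_form[OF _ GB.vec_dense GA.vec_dense])
    show "0 \<le> matrix_norm m x + e" using e by (simp add: add_nonneg_nonneg)
    fix y z :: "nat \<Rightarrow> 'i ell2"
    assume "\<And>j. y j \<in> GB.vec ` GB.V" "\<And>i. z i \<in> GA.vec ` GA.V"
    then have "\<forall>j. \<exists>\<beta>. \<beta> \<in> GB.V \<and> y j = GB.vec \<beta>" "\<forall>j. \<exists>\<gamma>. \<gamma> \<in> GA.V \<and> z j = GA.vec \<gamma>" by blast+
    then obtain \<beta> \<gamma> where \<beta>: "\<And>j. \<beta> j \<in> GB.V" "\<And>j. y j = GB.vec (\<beta> j)"
      and \<gamma>: "\<And>j. \<gamma> j \<in> GA.V" "\<And>j. z j = GA.vec (\<gamma> j)" by metis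
    have "(\<Sum>i<m. \<Sum>j<m. blinfun_apply (\<Phi> (x i j)) (y j) \<bullet> z i) = (\<Sum>i<m. \<Sum>j<m. total_form (\<gamma> i) (x i j) (\<beta> j))"
      using x by (intro sum.cong refl) (simp add: \<beta> \<gamma> \<Phi>_form matrices_def)
    then show "2 * (\<Sum>i<m. \<Sum>j<m. blinfun_apply (\<Phi> (x i j)) (y j) \<bullet> z i)
        \<le> (matrix_norm m x + e) * ((\<Sum>j<m. (norm (y j))\<^sup>2) + (\<Sum>i<m. (norm (z i))\<^sup>2))"
      using total_form_dominated[OF x _ \<gamma>(1) \<beta>(1), of "matrix_norm m x + e"] e by (simp add: \<beta>(2) \<gamma>(2))
  qed
qed

lemma delta_family:
  assumes "subspace D" "e \<in> D" and "n p = m"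
  shows "(\<lambda>j. if j = k \<and> k < m then e else 0) \<in> row_space (n p) D"
  using assms subspace_0[OF assms(1)] by (auto simp: row_space_def)

text \<open>The test vectors are the diagonal rows with entries \<open>adj a\<close> and
  \<open>b\<close> in a block whose functional is given by \<open>z\<close> and \<open>y\<close>.
  The states give them total square norm at most 1.\<close>

lemma \<Phi>_lower:
  assumes x: "x \<in> matrices m X" and y: "(\<Sum>j<m. (norm (y j))\<^sup>2) \<le> 1" and z: "(\<Sum>j<m. (norm (z j))\<^sup>2) \<le> 1"
    and a: "a \<in> A" "norm a \<le> 1" and b: "b \<in> B" "norm b \<le> 1"
  shows "(\<Sum>i<m. \<Sum>j<m. blinfun_apply (r (l a (x i j)) b) (y j) \<bullet> z i) \<le> matrix_norm m (\<lambda>i j. \<Phi> (x i j))"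
proof -
  \<comment> \<open>The tuple paired with the values comes first in \<open>form\<close>, hence
    \<open>z\<close> before \<open>y\<close>.\<close>
  obtain p where p: "n p = m" "form (n p) (u p) (v p) = form m z y" using forms[OF z y] by blast
  define \<delta>a where "\<delta>a k = (\<lambda>j. if j = k \<and> k < m then adj a else 0)" for k
  define \<delta>b where "\<delta>b k = (\<lambda>j. if j = k \<and> k < m then b else 0)" for k
  have da: "\<delta>a k \<in> row_space (n p) (adj ` A)" for k
    unfolding \<delta>a_def using a p by (intro delta_family GA.sub_B) auto
  have db: "\<delta>b k \<in> row_space (n p) B" for k
    unfolding \<delta>b_def using b p by (intro delta_family GB.sub_B) auto
  have 1: "(\<Sum>k<m. (norm (GA.vec (single_row p (\<delta>a k))))\<^sup>2) \<le> 1"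
  proof -
    have "(\<Sum>k<m. (norm (GA.vec (single_row p (\<delta>a k))))\<^sup>2)
        = (\<Sum>k<m. s p (\<lambda>j. if j = k then adj a else 0) (\<lambda>j. if j = k then adj a else 0))"
      unfolding GA.norm_vec_single[OF da] by (intro sum.cong refl) (simp add: \<delta>a_def)
    then show ?thesis using row_states_diagonal[OF GA.states[of p], of "adj a"] a by (simp add: p)
  qed
  have 2: "(\<Sum>k<m. (norm (GB.vec (single_row p (\<delta>b k))))\<^sup>2) \<le> 1"
  proof -
    have "(\<Sum>k<m. (norm (GB.vec (single_row p (\<delta>b k))))\<^sup>2)
        = (\<Sum>k<m. t p (\<lambda>j. if j = k then b else 0) (\<lambda>j. if j = k then b else 0))"
      unfolding GB.norm_vec_single[OF db] by (intro sum.cong refl) (simp add: \<delta>b_def)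
    then show ?thesis using row_states_diagonal[OF GB.states[of p], of b] b by (simp add: p)
  qed
  have "(\<Sum>i<m. \<Sum>j<m. blinfun_apply (r (l a (x i j)) b) (y j) \<bullet> z i)
      = (\<Sum>i<m. \<Sum>j<m. blinfun_apply (\<Phi> (x i j)) (GB.vec (single_row p (\<delta>b j))) \<bullet> GA.vec (single_row p (\<delta>a i)))"
  proof (intro sum.cong refl)
    fix i j assume ij: "i \<in> {..<m}" "j \<in> {..<m}"
    then have xX: "x i j \<in> X" using x by (simp add: matrices_def)
    have "blinfun_apply (\<Phi> (x i j)) (GB.vec (single_row p (\<delta>b j))) \<bullet> GA.vec (single_row p (\<delta>a i))
        = form m z y (\<delta>a i) (x i j) (\<delta>b j)"
      using single_row_in[OF GA.sub_B, of "\<delta>a i" n p, OF da] single_row_in[OF GB.sub_B, of "\<delta>b j" n p, OF db] xX da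
      by (simp add: \<Phi>_form total_form_single p(2))
    also have "\<dots> = blinfun_apply (r (l a (x i j)) b) (y j) \<bullet> z i"
      unfolding \<delta>a_def \<delta>b_def using a b xX ij by (intro form_delta) auto
    finally show "blinfun_apply (r (l a (x i j)) b) (y j) \<bullet> z i
      = blinfun_apply (\<Phi> (x i j)) (GB.vec (single_row p (\<delta>b j))) \<bullet> GA.vec (single_row p (\<delta>a i))" by simp
  qed
  also have "\<dots> \<le> matrix_norm m (\<lambda>i j. \<Phi> (x i j))" by (rule matrix_norm_form[OF 2 1])
  finally show ?thesis .
qed

text \<open>For the lower bound the approximate identities are removed from
  \<open>\<Phi>_lower\<close> one after the other: the limit over \<open>B\<close> is taken with
  \<open>a\<close> fixed, and then the limit over \<open>A\<close>.\<close>

lemma \<Phi>_isometric: "completely_isometric X \<Phi>"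
  unfolding completely_isometric_def
proof (intro allI ballI antisym)
  fix m x assume x: "x \<in> matrices m X"
  show "matrix_norm m (\<lambda>i j. \<Phi> (x i j)) \<le> matrix_norm m x" by (rule \<Phi>_contractive[OF x])
  obtain FA where FA: "FA \<noteq> bot" "\<forall>\<^sub>F e in FA. e \<in> A \<and> norm e \<le> 1"
    "\<And>a. a \<in> A \<Longrightarrow> ((\<lambda>e. e o\<^sub>L a) \<longlongrightarrow> a) FA"
    using unitA unfolding approximately_unital_def by blast
  obtain FB where FB: "FB \<noteq> bot" "\<forall>\<^sub>F e in FB. e \<in> B \<and> norm e \<le> 1"
    "\<And>b. b \<in> B \<Longrightarrow> ((\<lambda>e. b o\<^sub>L e) \<longlongrightarrow> b) FB"
    using unitB unfolding approximately_unital_def by blast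
  let ?M = "matrix_norm m (\<lambda>i j. \<Phi> (x i j))"
  have xX: "x i j \<in> X" if "i \<in> {..<m}" "j \<in> {..<m}" for i j using x that by (simp add: matrices_def)
  show "matrix_norm m x \<le> ?M"
  proof (rule field_le_epsilon)
    fix e :: real assume "0 < e"
    then obtain y z where y: "(\<Sum>j<m. (norm (y j))\<^sup>2) \<le> 1" and z: "(\<Sum>j<m. (norm (z j))\<^sup>2) \<le> 1"
      and gt: "matrix_norm m x - e < (\<Sum>i<m. \<Sum>j<m. blinfun_apply (x i j) (y j) \<bullet> z i)"
      by (rule matrix_norm_approx_form)
    have le1: "(\<Sum>i<m. \<Sum>j<m. blinfun_apply (l a (x i j)) (y j) \<bullet> z i) \<le> ?M" if a: "a \<in> A" "norm a \<le> 1" for a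
    proof (rule tendsto_upperbound[OF _ _ FB(1)])
      show "((\<lambda>b. \<Sum>i<m. \<Sum>j<m. blinfun_apply (r (l a (x i j)) b) (y j) \<bullet> z i)
          \<longlongrightarrow> (\<Sum>i<m. \<Sum>j<m. blinfun_apply (l a (x i j)) (y j) \<bullet> z i)) FB"
        by (intro tendsto_sum tendsto_inner blinfun.tendsto tendsto_const
            tendsto_r_unit[OF FB(2,3)] l_in[OF a(1)] xX)
      show "\<forall>\<^sub>F b in FB. (\<Sum>i<m. \<Sum>j<m. blinfun_apply (r (l a (x i j)) b) (y j) \<bullet> z i) \<le> ?M"
        using FB(2) by eventually_elim (use \<Phi>_lower[OF x y z a] in blast)
    qed
    have "(\<Sum>i<m. \<Sum>j<m. blinfun_apply (x i j) (y j) \<bullet> z i) \<le> ?M"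
    proof (rule tendsto_upperbound[OF _ _ FA(1)])
      show "((\<lambda>a. \<Sum>i<m. \<Sum>j<m. blinfun_apply (l a (x i j)) (y j) \<bullet> z i)
          \<longlongrightarrow> (\<Sum>i<m. \<Sum>j<m. blinfun_apply (x i j) (y j) \<bullet> z i)) FA"
        by (intro tendsto_sum tendsto_inner blinfun.tendsto tendsto_const
            tendsto_l_unit[OF FA(2,3)] xX)
      show "\<forall>\<^sub>F a in FA. (\<Sum>i<m. \<Sum>j<m. blinfun_apply (l a (x i j)) (y j) \<bullet> z i) \<le> ?M"
        using FA(2) by eventually_elim (use le1 in blast)
    qed
    then show "matrix_norm m x \<le> ?M + e" using gt by linarith
  qed
qed

text \<open>\<open>GA.rep\<close> is multiplicative on the adjoints of elements of \<open>A\<close>;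
  the outer adjoint reverses products a second time, so that \<open>\<theta>\<close> is
  multiplicative on \<open>A\<close>.\<close>

definition \<theta> :: "('ha \<Rightarrow>\<^sub>L 'ha) \<Rightarrow> ('i ell2 \<Rightarrow>\<^sub>L 'i ell2)"
  where "\<theta> a = adj (GA.rep (adj a))"

lemma \<theta>_representation: "operator_representation A UNIV \<theta>"
  using GA.rep_representation
  by (auto simp: operator_representation_def real_linear_on_def bounded_operators_UNIV \<theta>_def
      adj_add adj_scaleR adj_compose)

lemma \<theta>_isometric: "completely_isometric A \<theta>"
  unfolding completely_isometric_def
proof (intro allI ballI)
  fix m a assume a: "a \<in> matrices m A"
  have iso: "completely_isometric (adj ` A) GA.rep" by (rule GA.rep_isometric) (rule vsA)
  \<comment> \<open>Each adjoint of an operator matrix transposes it; the two adjoints in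
    \<open>\<theta>\<close> restore the order of the indices.\<close>
  have "(\<lambda>i j. adj (a j i)) \<in> matrices m (adj ` A)" using a by (simp add: matrices_def)
  then have "matrix_norm m (\<lambda>i j. GA.rep (adj (a j i))) = matrix_norm m (\<lambda>i j. adj (a j i))"
    by (rule iso[unfolded completely_isometric_def, rule_format])
  then show "matrix_norm m (\<lambda>i j. \<theta> (a i j)) = matrix_norm m a"
    using matrix_norm_adj[of m "\<lambda>i j. GA.rep (adj (a j i))"] matrix_norm_adj[of m a] by (simp add: \<theta>_def)
qed

lemma \<theta>_nondegenerate: "nondegenerate_representation A UNIV \<theta>"
proof (rule nondegenerate_UNIV_adj[OF \<theta>_representation])
  fix y
  have "{blinfun_apply (GA.rep e) y | e. e \<in> adj ` A} = {blinfun_apply (adj (\<theta> a)) y | a. a \<in> A}"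
    by (auto simp: \<theta>_def)
  then show "y \<in> closure {blinfun_apply (adj (\<theta> a)) y | a. a \<in> A}"
    using GA.rep_approximate_unit[of y] by simp
qed

text \<open>Moved across the inner product, \<open>\<theta> a\<close> multiplies a row of adjoints
  by \<open>adj a\<close>, which in the form amounts to acting by \<open>a\<close> on
  \<open>x\<close>. On the right, multiplication of the row by \<open>b\<close> directly amounts to
  acting by \<open>b\<close>.\<close>

lemma \<Phi>_intertwines: "intertwines A B X l r \<Phi> \<theta> GB.rep"
  unfolding intertwines_def
proof (intro conjI ballI)
  fix a x assume ax: "a \<in> A" "x \<in> X"
  show "\<theta> a o\<^sub>L \<Phi> x = \<Phi> (l a x)"
  proof (rule blinfun_eq_on_dense_form[OF GB.vec_dense GA.vec_dense], clarify)
    fix \<beta> \<gamma> assume V: "\<beta> \<in> GB.V" "\<gamma> \<in> GA.V"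
    have a': "adj a \<in> adj ` A" using ax by simp
    have "blinfun_apply (\<theta> a o\<^sub>L \<Phi> x) (GB.vec \<beta>) \<bullet> GA.vec \<gamma>
        = blinfun_apply (\<Phi> x) (GB.vec \<beta>) \<bullet> GA.vec (lmult (adj a) \<gamma>)"
      by (simp add: \<theta>_def adj_left GA.rep_vec[OF a' V(2)])
    also have "\<dots> = blinfun_apply (\<Phi> (l a x)) (GB.vec \<beta>) \<bullet> GA.vec \<gamma>"
      using V ax lmult_in[OF GA.algebra a' V(2)] by (simp add: \<Phi>_form l_in total_form_left)
    finally show "blinfun_apply (\<theta> a o\<^sub>L \<Phi> x) (GB.vec \<beta>) \<bullet> GA.vec \<gamma>
        = blinfun_apply (\<Phi> (l a x)) (GB.vec \<beta>) \<bullet> GA.vec \<gamma>" .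
  qed
next
  fix x b assume xb: "x \<in> X" "b \<in> B"
  show "\<Phi> x o\<^sub>L GB.rep b = \<Phi> (r x b)"
  proof (rule blinfun_eq_on_dense_form[OF GB.vec_dense GA.vec_dense], clarify)
    fix \<beta> \<gamma> assume V: "\<beta> \<in> GB.V" "\<gamma> \<in> GA.V"
    then show "blinfun_apply (\<Phi> x o\<^sub>L GB.rep b) (GB.vec \<beta>) \<bullet> GA.vec \<gamma>
        = blinfun_apply (\<Phi> (r x b)) (GB.vec \<beta>) \<bullet> GA.vec \<gamma>"
      using xb lmult_in[OF GB.algebra xb(2) V(1)]
      by (simp add: GB.rep_vec \<Phi>_form r_in total_form_right)
  qed
qed

end

section \<open>Realisation on the whole of one prescribed Hilbert space\<close>

context contractive_bimodule
begin

text \<open>The five injections bound the number of block codes and rows by the size of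
  \<open>'i\<close>; the copies of nonzero blocks give the opposite bound. Both Gram constructions
  therefore fill \<open>'i ell2\<close>, which makes the two Hilbert spaces equal.\<close>

theorem representation_on_full_space:
  fixes e1 :: "'hx list \<Rightarrow> 'i" and e2 :: "'ha list \<Rightarrow> 'i" and e3 :: "'hb list \<Rightarrow> 'i"
    and e4 :: "('ha \<Rightarrow>\<^sub>L 'ha) list \<Rightarrow> 'i" and e5 :: "('hb \<Rightarrow>\<^sub>L 'hb) list \<Rightarrow> 'i"
  assumes A0: "A \<noteq> {0}" and B0: "B \<noteq> {0}" and inf: "infinite (UNIV :: 'i set)"
    and inj: "inj e1" "inj e2" "inj e3" "inj e4" "inj e5"
  obtains \<Phi> \<theta> \<pi> :: "_ \<Rightarrow> ('i ell2 \<Rightarrow>\<^sub>L 'i ell2)" where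
    "real_linear_on X \<Phi>" and "completely_isometric X \<Phi>"
    and "nondegenerate_representation A UNIV \<theta>" and "completely_isometric A \<theta>"
    and "nondegenerate_representation B UNIV \<pi>" and "completely_isometric B \<pi>"
    and "intertwines A B X l r \<Phi> \<theta> \<pi>"
proof -
  obtain n u v s t where
    adm: "\<And>p :: ('ha, 'hb, 'hx, 'i) block. admissible (n p) (u p) (v p) (s p) (t p)"
    and forms: "\<And>m x y i. (\<Sum>j<m. (norm (x j))\<^sup>2) \<le> 1 \<Longrightarrow> (\<Sum>j<m. (norm (y j))\<^sup>2) \<le> 1 \<Longrightarrow>
      \<exists>p. snd p = i \<and> n p = m \<and> form (n p) (u p) (v p) = form m x y"
    and vsA: "\<And>m h i. (\<Sum>j<m. (norm (h j))\<^sup>2) \<le> 1 \<Longrightarrow> \<exists>p. snd p = i \<and> n p = m \<and> s p = vector_state m h"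
    and vsB: "\<And>m h i. (\<Sum>j<m. (norm (h j))\<^sup>2) \<le> 1 \<Longrightarrow> \<exists>p. snd p = i \<and> n p = m \<and> t p = vector_state m h"
    using block_choice by blast
  obtain pr :: "'i \<times> 'i \<Rightarrow> 'i" where pr: "inj pr" using infinite_pairing[OF inf] by blast
  obtain d0 d1 :: 'i where d: "d0 \<noteq> d1" using ex_new_if_finite[OF inf, of "{undefined}"] by auto
  \<comment> \<open>Iterated pairing codes a block, including its copy number \<open>i\<close>, by a
    single element of \<open>'i\<close>.\<close>
  define E where "E p = (case p of ((b, us, vs, hs, ks), i) \<Rightarrow>
      pr (if b then d0 else d1, pr (e1 us, pr (e1 vs, pr (e2 hs, pr (e3 ks, i))))))"
    for p :: "('ha, 'hb, 'hx, 'i) block"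
  have E: "inj E"
    using d by (intro injI) (auto simp: E_def inj_eq[OF pr] inj_eq[OF inj(1)] inj_eq[OF inj(2)] inj_eq[OF inj(3)]
        split: if_splits)
  \<comment> \<open>A row is coded by its entries below \<open>n p\<close>; the remaining ones are 0
    by the definition of \<open>row_space\<close>.\<close>
  have rows: "inj_on (\<lambda>(p, \<beta>). pr (E p, e (map \<beta> [0..<n p]))) {(p, \<beta>). \<beta> \<in> row_space (n p) D}"
    if "inj e" for e :: "'d::real_vector list \<Rightarrow> 'i" and D
  proof (rule inj_onI, clarify)
    fix p q \<beta> \<gamma>
    assume \<beta>: "\<beta> \<in> row_space (n p) D" and \<gamma>: "\<gamma> \<in> row_space (n q) D"
      and eq: "pr (E p, e (map \<beta> [0..<n p])) = pr (E q, e (map \<gamma> [0..<n q]))"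
    from injD[OF pr eq] have "E p = E q" and "e (map \<beta> [0..<n p]) = e (map \<gamma> [0..<n q])"
      by (simp_all only: prod.inject)
    then have pq: "p = q" and m: "map \<beta> [0..<n p] = map \<gamma> [0..<n q]"
      by (simp_all only: inj_eq[OF E] inj_eq[OF that])
    have "\<beta> j = \<gamma> j" for j
    proof (cases "j < n p")
      case True
      then show ?thesis using arg_cong[OF m, of "\<lambda>xs. xs ! j"] pq by simp
    next
      case False
      then show ?thesis using \<beta> \<gamma> pq by (simp add: row_space_def)
    qed
    then show "p = q \<and> \<beta> = \<gamma>" using pq by auto
  qed
  have states: "s p \<in> row_states (n p)" "t p \<in> row_states (n p)" for p
    using adm by (auto simp: admissible_def)
  have A'0: "adj ` A \<noteq> {0}"
  proof
    assume "adj ` A = {0}"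
    then have "adj ` adj ` A = {0}" by simp
    then show False using A0 by (simp add: image_image)
  qed
  have nzA: "\<exists>p \<beta>. snd p = i \<and> \<beta> \<in> row_space (n p) (adj ` A) \<and> s p \<beta> \<beta> \<noteq> 0" for i
  proof -
    obtain h \<beta> where h: "norm h \<le> 1" and \<beta>: "\<beta> \<in> row_space 1 (adj ` A)" "vector_state 1 (\<lambda>_. h) \<beta> \<beta> \<noteq> 0"
      using row_states_nonzero[OF A'0] linear_subspace_image[OF linear_adj subA] by blast
    have "(\<Sum>j<1::nat. (norm h)\<^sup>2) \<le> 1" using h by (simp add: power_le_one)
    then obtain p where "snd p = i" "n p = 1" "s p = vector_state 1 (\<lambda>_. h)" using vsA[of "\<lambda>_. h" 1 i] by blast
    then show ?thesis using \<beta> by (intro exI[of _ p] exI[of _ \<beta>]) simp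
  qed
  have nzB: "\<exists>p \<beta>. snd p = i \<and> \<beta> \<in> row_space (n p) B \<and> t p \<beta> \<beta> \<noteq> 0" for i
  proof -
    obtain h \<beta> where h: "norm h \<le> 1" and \<beta>: "\<beta> \<in> row_space 1 B" "vector_state 1 (\<lambda>_. h) \<beta> \<beta> \<noteq> 0"
      using row_states_nonzero[OF B0 subB] by blast
    have "(\<Sum>j<1::nat. (norm h)\<^sup>2) \<le> 1" using h by (simp add: power_le_one)
    then obtain p where "snd p = i" "n p = 1" "t p = vector_state 1 (\<lambda>_. h)" using vsB[of "\<lambda>_. h" 1 i] by blast
    then show ?thesis using \<beta> by (intro exI[of _ p] exI[of _ \<beta>]) simp
  qed
  obtain \<phi> :: "('ha, 'hb, 'hx, 'i) block \<Rightarrow> _ \<Rightarrow> 'i ell2" where \<phi>: "gram_representation (adj ` A) n s \<phi>"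
    by (rule gram_representation_exists[OF real_operator_algebra_adj[OF algA] approximately_unital_adj[OF unitA]
          states(1) rows[OF inj(4)] nzA])
  obtain \<psi> :: "('ha, 'hb, 'hx, 'i) block \<Rightarrow> _ \<Rightarrow> 'i ell2" where \<psi>: "gram_representation B n t \<psi>"
    by (rule gram_representation_exists[OF algB unitB states(2) rows[OF inj(5)] nzB])
  interpret R: bimodule_representation A B X l r n u v s t \<phi> \<psi>
    by (rule bimodule_representation.intro[OF contractive_bimodule_axioms bimodule_representation_axioms.intro,
          OF adm \<phi> \<psi>])
      (use forms vsA vsB in blast)+
  show thesis
  proof (rule that)
    show "nondegenerate_representation B UNIV R.GB.rep"
      by (rule nondegenerate_UNIV[OF R.GB.rep_representation R.GB.rep_approximate_unit])
    show "completely_isometric B R.GB.rep"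
      by (rule R.GB.rep_isometric) (rule R.vsB)
  qed (rule R.\<Phi>_linear R.\<Phi>_isometric R.\<theta>_nondegenerate R.\<theta>_isometric R.\<Phi>_intertwines)+
qed

end

section \<open>Sums of two representations on one space\<close>

text \<open>\<open>R\<close> and \<open>S\<close> are the two components of an identification of the
  space with the orthogonal sum of two copies of itself; their adjoints are the embeddings of the
  copies.\<close>

locale orthogonal_splitting =
  fixes R S :: "'u::{real_inner, complete_space} \<Rightarrow>\<^sub>L 'u"
  assumes RR: "blinfun_apply R (blinfun_apply (adj R) y) = y"
    and SS: "blinfun_apply S (blinfun_apply (adj S) y) = y"
    and RS: "blinfun_apply R (blinfun_apply (adj S) y) = 0"
    and SR: "blinfun_apply S (blinfun_apply (adj R) y) = 0"
    and sum: "blinfun_apply (adj R) (blinfun_apply R z) + blinfun_apply (adj S) (blinfun_apply S z) = z"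
begin

lemma norm_split: "(norm z)\<^sup>2 = (norm (blinfun_apply R z))\<^sup>2 + (norm (blinfun_apply S z))\<^sup>2"
proof -
  have "z \<bullet> z = z \<bullet> (blinfun_apply (adj R) (blinfun_apply R z) + blinfun_apply (adj S) (blinfun_apply S z))"
    by (simp add: sum)
  then show ?thesis by (simp add: power2_norm_eq_inner inner_add_right flip: adj_right)
qed

lemma norm_S_le: "(norm (blinfun_apply S z))\<^sup>2 \<le> (norm z)\<^sup>2"
  using norm_split[of z] by simp

lemma norm_adj_R: "norm (blinfun_apply (adj R) y) = norm y"
  by (simp add: norm_eq_sqrt_inner adj_left RR)

lemma norm_adj_S: "norm (blinfun_apply (adj S) y) = norm y"
  by (simp add: norm_eq_sqrt_inner adj_left SS)

definition direct_sum :: "('u \<Rightarrow>\<^sub>L 'u) \<Rightarrow> ('u \<Rightarrow>\<^sub>L 'u) \<Rightarrow> ('u \<Rightarrow>\<^sub>L 'u)"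
  where "direct_sum P Q = (adj R o\<^sub>L P o\<^sub>L R) + (adj S o\<^sub>L Q o\<^sub>L S)"

text \<open>The off-diagonal position of a two by two block matrix. From the left it meets only the
  first summand of a direct sum, and from the right only the second.\<close>

definition corner :: "('u \<Rightarrow>\<^sub>L 'u) \<Rightarrow> ('u \<Rightarrow>\<^sub>L 'u)"
  where "corner P = adj R o\<^sub>L P o\<^sub>L S"

lemma direct_sum_apply: "blinfun_apply (direct_sum P Q) z =
    blinfun_apply (adj R) (blinfun_apply P (blinfun_apply R z))
      + blinfun_apply (adj S) (blinfun_apply Q (blinfun_apply S z))"
  by (simp add: direct_sum_def blinfun.add_left)

lemma corner_apply: "blinfun_apply (corner P) z = blinfun_apply (adj R) (blinfun_apply P (blinfun_apply S z))"
  by (simp add: corner_def)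

lemma direct_sum_compose: "direct_sum P Q o\<^sub>L direct_sum P' Q' = direct_sum (P o\<^sub>L P') (Q o\<^sub>L Q')"
  by (rule blinfun_eqI) (simp add: direct_sum_apply blinfun.add_right RR RS SR SS blinfun.zero_right)

lemma direct_sum_corner: "direct_sum P Q o\<^sub>L corner P' = corner (P o\<^sub>L P')"
  by (rule blinfun_eqI) (simp add: direct_sum_apply corner_apply RR SR blinfun.zero_right)

lemma corner_direct_sum: "corner P' o\<^sub>L direct_sum P Q = corner (P' o\<^sub>L Q)"
  by (rule blinfun_eqI) (simp add: direct_sum_apply corner_apply blinfun.add_right SS SR blinfun.zero_right)

lemma matrix_norm_corner: "matrix_norm n (\<lambda>i j. corner (P i j)) = matrix_norm n P"
proof (rule antisym)
  have eq: "(\<Sum>j<n. blinfun_apply (corner (P i j)) (v j))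
      = blinfun_apply (adj R) (\<Sum>j<n. blinfun_apply (P i j) (blinfun_apply S (v j)))" for i v
    by (simp add: corner_apply blinfun.sum_right)
  show "matrix_norm n (\<lambda>i j. corner (P i j)) \<le> matrix_norm n P"
  proof (rule matrix_norm_leI[OF matrix_norm_nonneg])
    fix v
    have "(\<Sum>i<n. (norm (\<Sum>j<n. blinfun_apply (corner (P i j)) (v j)))\<^sup>2)
        \<le> (matrix_norm n P)\<^sup>2 * (\<Sum>j<n. (norm (blinfun_apply S (v j)))\<^sup>2)"
      unfolding eq norm_adj_R by (rule matrix_norm_bound)
    also have "\<dots> \<le> (matrix_norm n P)\<^sup>2 * (\<Sum>j<n. (norm (v j))\<^sup>2)"
      by (intro mult_left_mono sum_mono norm_S_le) simp
    finally show "(\<Sum>i<n. (norm (\<Sum>j<n. blinfun_apply (corner (P i j)) (v j)))\<^sup>2)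
        \<le> (matrix_norm n P)\<^sup>2 * (\<Sum>j<n. (norm (v j))\<^sup>2)" .
  qed
  show "matrix_norm n P \<le> matrix_norm n (\<lambda>i j. corner (P i j))"
  proof (rule matrix_norm_leI[OF matrix_norm_nonneg])
    fix v
    show "(\<Sum>i<n. (norm (\<Sum>j<n. blinfun_apply (P i j) (v j)))\<^sup>2)
        \<le> (matrix_norm n (\<lambda>i j. corner (P i j)))\<^sup>2 * (\<Sum>j<n. (norm (v j))\<^sup>2)"
      using matrix_norm_bound[where n = n and T = "\<lambda>i j. corner (P i j)" and v = "\<lambda>j. blinfun_apply (adj S) (v j)"]
      unfolding eq SS norm_adj_R norm_adj_S .
  qed
qed

lemma matrix_norm_direct_sum:
  assumes P: "matrix_norm n P = C" and Q: "matrix_norm n Q = C"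
  shows "matrix_norm n (\<lambda>i j. direct_sum (P i j) (Q i j)) = C"
proof (rule antisym)
  let ?D = "\<lambda>i j. direct_sum (P i j) (Q i j)"
  have C: "0 \<le> C" using P matrix_norm_nonneg[of n P] by simp
  have eqR: "blinfun_apply R (\<Sum>j<n. blinfun_apply (?D i j) (v j)) = (\<Sum>j<n. blinfun_apply (P i j) (blinfun_apply R (v j)))"
    and eqS: "blinfun_apply S (\<Sum>j<n. blinfun_apply (?D i j) (v j)) = (\<Sum>j<n. blinfun_apply (Q i j) (blinfun_apply S (v j)))" for i v
    by (simp_all add: direct_sum_apply blinfun.sum_right blinfun.add_right RR RS SR SS)
  show "matrix_norm n ?D \<le> C"
  proof (rule matrix_norm_leI[OF C])
    fix v
    have "(\<Sum>i<n. (norm (\<Sum>j<n. blinfun_apply (?D i j) (v j)))\<^sup>2)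
      = (\<Sum>i<n. (norm (\<Sum>j<n. blinfun_apply (P i j) (blinfun_apply R (v j))))\<^sup>2)
        + (\<Sum>i<n. (norm (\<Sum>j<n. blinfun_apply (Q i j) (blinfun_apply S (v j))))\<^sup>2)"
      unfolding norm_split[of "\<Sum>j<n. blinfun_apply (?D _ j) (v j)"] eqR eqS sum.distrib ..
    also have "\<dots> \<le> C\<^sup>2 * (\<Sum>j<n. (norm (blinfun_apply R (v j)))\<^sup>2) + C\<^sup>2 * (\<Sum>j<n. (norm (blinfun_apply S (v j)))\<^sup>2)"
      using matrix_norm_bound[where n = n and T = P] matrix_norm_bound[where n = n and T = Q]
      unfolding P Q by (intro add_mono)
    also have "\<dots> = C\<^sup>2 * (\<Sum>j<n. (norm (v j))\<^sup>2)"
      by (simp add: norm_split[of "v _"] sum.distrib distrib_left)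
    finally show "(\<Sum>i<n. (norm (\<Sum>j<n. blinfun_apply (?D i j) (v j)))\<^sup>2) \<le> C\<^sup>2 * (\<Sum>j<n. (norm (v j))\<^sup>2)" .
  qed
  have "matrix_norm n P \<le> matrix_norm n ?D"
  proof (rule matrix_norm_leI[OF matrix_norm_nonneg])
    fix v
    have "(\<Sum>j<n. blinfun_apply (?D i j) (blinfun_apply (adj R) (v j))) = blinfun_apply (adj R) (\<Sum>j<n. blinfun_apply (P i j) (v j))" for i
      by (simp add: direct_sum_apply RR SR blinfun.zero_right blinfun.sum_right)
    then show "(\<Sum>i<n. (norm (\<Sum>j<n. blinfun_apply (P i j) (v j)))\<^sup>2)
        \<le> (matrix_norm n ?D)\<^sup>2 * (\<Sum>j<n. (norm (v j))\<^sup>2)"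
      using matrix_norm_bound[where n = n and T = ?D and v = "\<lambda>j. blinfun_apply (adj R) (v j)"]
      by (simp add: norm_adj_R)
  qed
  then show "C \<le> matrix_norm n ?D" by (simp add: P)
qed

lemma direct_sum_representation:
  assumes "operator_representation A UNIV \<theta>" "operator_representation A UNIV \<pi>"
  shows "operator_representation A UNIV (\<lambda>a. direct_sum (\<theta> a) (\<pi> a))"
  unfolding operator_representation_def real_linear_on_def bounded_operators_UNIV
proof (intro conjI ballI allI subset_UNIV)
  note th = assms[unfolded operator_representation_def real_linear_on_def]
  show "direct_sum (\<theta> (a + b)) (\<pi> (a + b)) = direct_sum (\<theta> a) (\<pi> a) + direct_sum (\<theta> b) (\<pi> b)"
    if "a \<in> A" "b \<in> A" for a b
    using th that by (intro blinfun_eqI) (simp add: direct_sum_apply blinfun.add_left blinfun.add_right)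
  show "direct_sum (\<theta> (c *\<^sub>R a)) (\<pi> (c *\<^sub>R a)) = c *\<^sub>R direct_sum (\<theta> a) (\<pi> a)" if "a \<in> A" for c a
    using th that by (intro blinfun_eqI)
      (simp add: direct_sum_apply blinfun.scaleR_left blinfun.scaleR_right scaleR_add_right)
  show "direct_sum (\<theta> (a o\<^sub>L b)) (\<pi> (a o\<^sub>L b)) = direct_sum (\<theta> a) (\<pi> a) o\<^sub>L direct_sum (\<theta> b) (\<pi> b)"
    if "a \<in> A" "b \<in> A" for a b
    using th that by (simp add: direct_sum_compose)
qed

text \<open>Vectors of the form \<open>adj R h\<close> and \<open>adj S h\<close> isolate the
  summands, so both components of a vector orthogonal to the range are orthogonal to a dense
  span.\<close>

lemma direct_sum_nondegenerate:
  assumes "nondegenerate_representation A UNIV \<theta>" "nondegenerate_representation A UNIV \<pi>"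
  shows "nondegenerate_representation A UNIV (\<lambda>a. direct_sum (\<theta> a) (\<pi> a))"
proof -
  let ?T = "\<lambda>\<theta>. {blinfun_apply (\<theta> a) h | a h. a \<in> A \<and> h \<in> UNIV}"
  have zero: "y = 0" if "nondegenerate_representation A UNIV \<sigma>"
    and "\<And>a h. a \<in> A \<Longrightarrow> y \<bullet> blinfun_apply (\<sigma> a) h = 0" for \<sigma> :: "_ \<Rightarrow> ('u \<Rightarrow>\<^sub>L 'u)" and y
  proof -
    have "y \<in> closure (span (?T \<sigma>))" using that(1) unfolding nondegenerate_representation_def by blast
    then have "y \<bullet> y = 0"
    proof (rule orthogonal_closure[rotated])
      fix s assume "s \<in> span (?T \<sigma>)"
      then show "y \<bullet> s = 0" by (rule orthogonal_span[rotated]) (use that(2) in blast)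
    qed
    then show ?thesis by simp
  qed
  have "closure (span (?T (\<lambda>a. direct_sum (\<theta> a) (\<pi> a)))) = UNIV"
  proof (rule dense_if_total[OF subspace_span])
    fix x assume x: "\<And>y. y \<in> span (?T (\<lambda>a. direct_sum (\<theta> a) (\<pi> a))) \<Longrightarrow> x \<bullet> y = 0"
    have ort: "x \<bullet> blinfun_apply (direct_sum (\<theta> a) (\<pi> a)) h = 0" if "a \<in> A" for a h
      by (rule x, rule span_base) (use that in blast)
    have "blinfun_apply R x = 0"
    proof (rule zero[OF assms(1)])
      show "blinfun_apply R x \<bullet> blinfun_apply (\<theta> a) h = 0" if "a \<in> A" for a h
        using ort[OF that, of "blinfun_apply (adj R) h"]
        by (simp add: direct_sum_apply RR SR blinfun.zero_right adj_right)
    qed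
    moreover have "blinfun_apply S x = 0"
    proof (rule zero[OF assms(2)])
      show "blinfun_apply S x \<bullet> blinfun_apply (\<pi> a) h = 0" if "a \<in> A" for a h
        using ort[OF that, of "blinfun_apply (adj S) h"]
        by (simp add: direct_sum_apply SS RS blinfun.zero_right adj_right)
    qed
    ultimately show "x = 0" using sum[of x] by (simp add: blinfun.zero_right)
  qed
  then show ?thesis
    using direct_sum_representation[of A \<theta> \<pi>] assms by (simp add: nondegenerate_representation_def)
qed

end

text \<open>An infinite index set is equinumerous with two disjoint copies of itself, and the
  coordinates are divided accordingly.\<close>

lemma orthogonal_splitting_ell2:
  assumes "infinite (UNIV :: 'i set)"
  obtains R S :: "'i ell2 \<Rightarrow>\<^sub>L 'i ell2" where "orthogonal_splitting R S"
proof -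
  obtain h :: "'i + 'i \<Rightarrow> 'i" where h: "bij h"
  proof -
    have "\<exists>h. bij_betw h ((UNIV :: 'i set) <+> (UNIV :: 'i set)) (UNIV :: 'i set)"
      by (rule card_of_ordIso[THEN iffD2, OF card_of_Plus_infinite1[OF assms card_of_refl[THEN ordIso_imp_ordLeq]]])
    then show thesis using that by (auto simp: UNIV_Plus_UNIV)
  qed
  define a where "a i = h (Inl i)" for i
  define b where "b i = h (Inr i)" for i
  have ia: "inj a" and ib: "inj b" using bij_is_inj[OF h] by (auto simp: a_def b_def inj_def)
  have ab: "range a \<inter> range b = {}" using bij_is_inj[OF h] by (auto simp: a_def b_def inj_eq)
  have cover: "d \<in> range a \<or> d \<in> range b" for d
  proof -
    obtain s where "d = h s" using bij_is_surj[OF h] by (metis surjD)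
    then show ?thesis by (cases s) (auto simp: a_def b_def)
  qed
  have "orthogonal_splitting (reindex a) (reindex b)"
  proof
    fix z :: "'i ell2"
    show "blinfun_apply (adj (reindex a)) (blinfun_apply (reindex a) z)
        + blinfun_apply (adj (reindex b)) (blinfun_apply (reindex b) z) = z"
    proof (rule ell2_eqI)
      fix d
      consider i where "d = a i" "d \<notin> range b" | i where "d = b i" "d \<notin> range a"
        using cover[of d] ab by blast
      then show "coord (blinfun_apply (adj (reindex a)) (blinfun_apply (reindex a) z)
        + blinfun_apply (adj (reindex b)) (blinfun_apply (reindex b) z)) d = coord z d"
        by cases (simp_all add: coord_adj_reindex coord_reindex coord_adj_reindex_other ia ib)
    qed
  qed (use ab in \<open>auto simp: reindex_adj reindex_adj_disjoint ia ib Int_commute\<close>)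
  then show thesis using that by blast
qed

section \<open>The index type\<close>

text \<open>The prescribed index type is built from operators, whereas block codes contain vectors;
  rank one operators code a vector. On the zero space any map is injective.\<close>

lemma inj_rank_one:
  obtains f :: "'h::{real_inner, complete_space} \<Rightarrow> ('h \<Rightarrow>\<^sub>L 'h)" where "inj f"
proof (cases "\<exists>e :: 'h. e \<noteq> 0")
  case True
  then obtain e :: 'h where e: "e \<noteq> 0" by blast
  have bl: "bounded_linear (\<lambda>u. (u \<bullet> e) *\<^sub>R h)" for h :: 'h
    by (intro bounded_linear_scaleR_const bounded_linear_inner_left)
  have "inj (\<lambda>h :: 'h. Blinfun (\<lambda>u. (u \<bullet> e) *\<^sub>R h))"
  proof (rule injI)
    fix h k :: 'h assume "Blinfun (\<lambda>u. (u \<bullet> e) *\<^sub>R h) = Blinfun (\<lambda>u. (u \<bullet> e) *\<^sub>R k)"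
    then have "blinfun_apply (Blinfun (\<lambda>u. (u \<bullet> e) *\<^sub>R h)) e = blinfun_apply (Blinfun (\<lambda>u. (u \<bullet> e) *\<^sub>R k)) e"
      by (rule arg_cong)
    then show "h = k" using e by (simp add: bounded_linear_Blinfun_apply[OF bl])
  qed
  then show thesis by (rule that)
next
  case False
  then have "inj (\<lambda>_ :: 'h. 0 :: 'h \<Rightarrow>\<^sub>L 'h)" by (intro injI) metis
  then show thesis by (rule that)
qed

lemma inj_singleton_map: "inj f \<Longrightarrow> inj (\<lambda>xs. {map f xs})"
  by (auto simp: inj_def dest: map_injective[OF _ injI])

lemma infinite_list_sets: "infinite (UNIV :: 'c list set set)"
proof -
  have "inj (\<lambda>k :: nat. {replicate k (undefined :: 'c)})"
    by (auto simp: inj_def dest: arg_cong[where f = length])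
  then show ?thesis using finite_imageD[of "\<lambda>k :: nat. {replicate k (undefined :: 'c)}" UNIV]
      finite_subset[OF subset_UNIV] by blast
qed

context contractive_bimodule
begin

lemma representation_on_big_hilbert:
  assumes "A \<noteq> {0}" "B \<noteq> {0}"
  obtains \<Phi> \<theta> and \<pi> :: "_ \<Rightarrow> (('ha \<Rightarrow>\<^sub>L 'ha, 'hb \<Rightarrow>\<^sub>L 'hb, 'hx \<Rightarrow>\<^sub>L 'hx) big_hilbert \<Rightarrow>\<^sub>L
      ('ha \<Rightarrow>\<^sub>L 'ha, 'hb \<Rightarrow>\<^sub>L 'hb, 'hx \<Rightarrow>\<^sub>L 'hx) big_hilbert)" where
    "real_linear_on X \<Phi>" and "completely_isometric X \<Phi>"
    and "nondegenerate_representation A UNIV \<theta>" and "completely_isometric A \<theta>"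
    and "nondegenerate_representation B UNIV \<pi>" and "completely_isometric B \<pi>"
    and "intertwines A B X l r \<Phi> \<theta> \<pi>"
proof -
  obtain fa :: "'ha \<Rightarrow> ('ha \<Rightarrow>\<^sub>L 'ha)" where fa: "inj fa" by (rule inj_rank_one)
  obtain fb :: "'hb \<Rightarrow> ('hb \<Rightarrow>\<^sub>L 'hb)" where fb: "inj fb" by (rule inj_rank_one)
  obtain fx :: "'hx \<Rightarrow> ('hx \<Rightarrow>\<^sub>L 'hx)" where fx: "inj fx" by (rule inj_rank_one)
  \<comment> \<open>A list is coded entry by entry with triples that are 0 in the two other
    components, and the singleton turns it into an element of the index type.\<close>
  let ?c = "\<lambda>f xs. {map f xs} :: (('ha \<Rightarrow>\<^sub>L 'ha) \<times> ('hb \<Rightarrow>\<^sub>L 'hb) \<times> ('hx \<Rightarrow>\<^sub>L 'hx)) list set"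
  have 1: "inj (?c (\<lambda>h. (0, 0, fx h)))" using fx by (intro inj_singleton_map) (auto simp: inj_def)
  have 2: "inj (?c (\<lambda>h. (fa h, 0, 0)))" using fa by (intro inj_singleton_map) (auto simp: inj_def)
  have 3: "inj (?c (\<lambda>h. (0, fb h, 0)))" using fb by (intro inj_singleton_map) (auto simp: inj_def)
  have 4: "inj (?c (\<lambda>a. (a, 0, 0)))" by (intro inj_singleton_map) (auto simp: inj_def)
  have 5: "inj (?c (\<lambda>b. (0, b, 0)))" by (intro inj_singleton_map) (auto simp: inj_def)
  show thesis
    by (rule representation_on_full_space[OF assms infinite_list_sets 1 2 3 4 5]) (rule that)
qed

text \<open>If \<open>A\<close> or \<open>B\<close> is zero, the blocks supply no nonzero vector on
  that side. Nondegeneracy then forces \<open>X\<close> to vanish too, so that the zero map serves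
  as \<open>\<Phi>\<close>.\<close>

lemma X_zero:
  assumes "A = {0} \<or> B = {0}" shows "X = {0}"
proof -
  have "X \<subseteq> {0}"
    using assms
  proof
    assume A: "A = {0}"
    then have "{l a x | a x. a \<in> A \<and> x \<in> X} \<subseteq> {0}" using l_zero by auto
    then have "span {l a x | a x. a \<in> A \<and> x \<in> X} \<subseteq> {0}" by (rule span_minimal) (rule subspace_single_0)
    then have "closure (span {l a x | a x. a \<in> A \<and> x \<in> X}) \<subseteq> {0}" by (rule closure_minimal) (rule closed_singleton)
    then show ?thesis using nondeg unfolding nondegenerate_bimodule_def by blast
  next
    assume B: "B = {0}"
    then have "{r x b | x b. x \<in> X \<and> b \<in> B} \<subseteq> {0}" using r_zero by auto
    then have "span {r x b | x b. x \<in> X \<and> b \<in> B} \<subseteq> {0}" by (rule span_minimal) (rule subspace_single_0)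
    then have "closure (span {r x b | x b. x \<in> X \<and> b \<in> B}) \<subseteq> {0}" by (rule closure_minimal) (rule closed_singleton)
    then show ?thesis using nondeg unfolding nondegenerate_bimodule_def by blast
  qed
  then show ?thesis using subspace_0[OF subX] by blast
qed

lemma isometric_image_bimodule:
  fixes \<Phi> :: "_ \<Rightarrow> ('u::{real_inner, complete_space} \<Rightarrow>\<^sub>L 'u)"
  assumes lin: "real_linear_on X \<Phi>" and img: "\<Phi> ` X \<subseteq> bounded_operators K H"
    and iso: "completely_isometric X \<Phi>" and tw: "intertwines A B X l r \<Phi> \<theta> \<pi>"
  shows "concrete_operator_bimodule A B H K \<theta> \<pi> (\<Phi> ` X)"
    and "completely_bimodule_isometric A B X l r (\<Phi> ` X) (\<lambda>a y. \<theta> a o\<^sub>L y) (\<lambda>y b. y o\<^sub>L \<pi> b)"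
proof -
  have "subspace (\<Phi> ` X)"
  proof (rule subspaceI)
    show "0 \<in> \<Phi> ` X" using real_linear_on_zero[OF lin subX] subspace_0[OF subX] by (metis image_eqI)
    show "x + y \<in> \<Phi> ` X" if "x \<in> \<Phi> ` X" "y \<in> \<Phi> ` X" for x y
    proof -
      obtain a b where ab: "a \<in> X" "b \<in> X" "x = \<Phi> a" "y = \<Phi> b" using \<open>x \<in> \<Phi> ` X\<close> \<open>y \<in> \<Phi> ` X\<close> by blast
      then have "x + y = \<Phi> (a + b)" using lin by (simp add: real_linear_on_def)
      then show ?thesis using subspace_add[OF subX ab(1,2)] by simp
    qed
    show "c *\<^sub>R x \<in> \<Phi> ` X" if "x \<in> \<Phi> ` X" for c x
    proof -
      obtain a where ab: "a \<in> X" "x = \<Phi> a" using \<open>x \<in> \<Phi> ` X\<close> by blast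
      then have "c *\<^sub>R x = \<Phi> (c *\<^sub>R a)" using lin by (simp add: real_linear_on_def)
      then show ?thesis using subspace_scale[OF subX ab(1)] by simp
    qed
  qed
  then show "concrete_operator_bimodule A B H K \<theta> \<pi> (\<Phi> ` X)"
    using img tw l_in r_in by (auto simp: concrete_operator_bimodule_def intertwines_def)
  have "inj_on \<Phi> X"
  proof (rule inj_onI)
    fix x y assume xy: "x \<in> X" "y \<in> X" "\<Phi> x = \<Phi> y"
    have d: "x - y \<in> X" by (rule subspace_diff[OF subX xy(1,2)])
    have "\<Phi> (x - y) = 0" using real_linear_on_diff[OF lin subX xy(1,2)] xy(3) by simp
    moreover have "(\<lambda>_ _. x - y) \<in> matrices 1 X" using d by (simp add: matrices_def)
    then have "matrix_norm 1 (\<lambda>_ _. \<Phi> (x - y)) = matrix_norm 1 (\<lambda>_ _. x - y)"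
      by (rule iso[unfolded completely_isometric_def, rule_format])
    ultimately have "norm (x - y) = 0" unfolding matrix_norm_one by simp
    then show "x = y" by simp
  qed
  then have "bij_betw \<Phi> X (\<Phi> ` X)" by (rule inj_on_imp_bij_betw)
  then show "completely_bimodule_isometric A B X l r (\<Phi> ` X) (\<lambda>a y. \<theta> a o\<^sub>L y) (\<lambda>y b. y o\<^sub>L \<pi> b)"
    unfolding completely_bimodule_isometric_def using lin iso tw
    by (intro exI[of _ \<Phi>]) (auto simp: intertwines_def)
qed

end

section \<open>Zero maps and zero modules\<close>

lemma matrix_norm_zero: "matrix_norm n (\<lambda>_ _. 0) = 0"
  by (rule antisym[OF matrix_norm_leI matrix_norm_nonneg]) simp_all

lemma completely_isometric_zero: "completely_isometric {0} (\<lambda>_. 0)"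
proof -
  have "matrix_norm n x = 0" if "x \<in> matrices n {0}" for n and x :: "nat \<Rightarrow> nat \<Rightarrow> ('a \<Rightarrow>\<^sub>L 'a)"
    using matrix_norm_cong[of n x "\<lambda>_ _. 0"] that by (simp add: matrices_def matrix_norm_zero)
  then show ?thesis by (simp add: completely_isometric_def matrix_norm_zero)
qed

lemma completely_contractive_zero: "completely_contractive A (\<lambda>_. 0)"
  by (simp add: completely_contractive_def matrix_norm_zero)

lemma real_linear_on_const_zero: "real_linear_on X (\<lambda>_. 0)"
  by (simp add: real_linear_on_def)

lemma zero_in_bounded_operators: "0 \<in> H \<Longrightarrow> 0 \<in> bounded_operators K H"
  by (auto simp: bounded_operators_def)

lemma operator_representation_zero:
  assumes "0 \<in> H" shows "operator_representation A H (\<lambda>_. 0)"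
  using zero_in_bounded_operators[OF assms, of H]
  by (auto simp: operator_representation_def real_linear_on_def intro: blinfun_eqI)

lemma nondegenerate_representation_zero: "nondegenerate_representation A {0} (\<lambda>_. 0)"
  unfolding nondegenerate_representation_def
proof
  show "operator_representation A {0} (\<lambda>_. 0)" by (rule operator_representation_zero) simp
  show "{0} \<subseteq> closure (span {blinfun_apply ((\<lambda>_. 0) a) h | a h. a \<in> A \<and> h \<in> {0}})"
    using span_zero closure_subset by blast
qed

lemma real_hilbert_subspace_zero: "real_hilbert_subspace {0}"
  by (simp add: real_hilbert_subspace_def subspace_single_0)

lemma real_hilbert_subspace_UNIV: "real_hilbert_subspace UNIV"
  by (simp add: real_hilbert_subspace_def)

lemma intertwines_zero: "intertwines A B X l r (\<lambda>_. 0) \<theta> \<pi>"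
  by (auto simp: intertwines_def blinfun.zero_right intro: blinfun_eqI)

lemma contractive_bimodule_zero:
  assumes "real_operator_algebra A" "approximately_unital A"
    and "real_operator_algebra B" "approximately_unital B"
  shows "contractive_bimodule A B {0} (\<lambda>_ _. 0) (\<lambda>_ _. 0)"
proof
  show "real_operator_space {0 :: 'c \<Rightarrow>\<^sub>L 'c}" by (simp add: real_operator_space_def subspace_single_0)
  show "real_bimodule A B {0 :: 'c \<Rightarrow>\<^sub>L 'c} (\<lambda>_ _. 0) (\<lambda>_ _. 0)"
    by (simp add: real_bimodule_def real_linear_on_def)
  show "continuous_actions A B {0 :: 'c \<Rightarrow>\<^sub>L 'c} (\<lambda>_ _. 0) (\<lambda>_ _. 0)"
    by (simp add: continuous_actions_def)
  show "nondegenerate_bimodule A B {0 :: 'c \<Rightarrow>\<^sub>L 'c} (\<lambda>_ _. 0) (\<lambda>_ _. 0)"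
    unfolding nondegenerate_bimodule_def using span_zero closure_subset by blast
  show "completely_contractive_actions A B {0 :: 'c \<Rightarrow>\<^sub>L 'c} (\<lambda>_ _. 0) (\<lambda>_ _. 0)"
    by (simp add: completely_contractive_actions_def right_matrix_action_def matrix_norm_zero)
qed (rule assms)+

text \<open>The zero bimodule is nondegenerate, so the construction applied to it represents a
  single algebra.\<close>

lemma isometric_representation_exists:
  fixes B :: "('h::{real_inner, complete_space} \<Rightarrow>\<^sub>L 'h) set"
    and e1 :: "'h list \<Rightarrow> 'i" and e2 :: "('h \<Rightarrow>\<^sub>L 'h) list \<Rightarrow> 'i"
  assumes B: "real_operator_algebra B" "approximately_unital B" "B \<noteq> {0}"
    and inf: "infinite (UNIV :: 'i set)" and inj: "inj e1" "inj e2"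
  obtains \<pi> :: "('h \<Rightarrow>\<^sub>L 'h) \<Rightarrow> ('i ell2 \<Rightarrow>\<^sub>L 'i ell2)" where
    "nondegenerate_representation B UNIV \<pi>" and "completely_isometric B \<pi>"
proof -
  interpret Z: contractive_bimodule B B "{0 :: 'h \<Rightarrow>\<^sub>L 'h}" "\<lambda>_ _. 0" "\<lambda>_ _. 0"
    by (rule contractive_bimodule_zero[OF B(1,2) B(1,2)])
  show thesis
    by (rule Z.representation_on_full_space[OF B(3) B(3) inf inj(1) inj(1) inj(1) inj(2) inj(2)]) (rule that)
qed

lemma completely_isometric_imp_contractive: "completely_isometric A \<phi> \<Longrightarrow> completely_contractive A \<phi>"
  by (simp add: completely_isometric_def completely_contractive_def)

lemma nondegenerate_imp_representation:
  "nondegenerate_representation A H \<theta> \<Longrightarrow> operator_representation A H \<theta>"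
  by (simp add: nondegenerate_representation_def)

lemma image_subset_bounded_operators_UNIV: "f ` X \<subseteq> bounded_operators UNIV UNIV"
  by (simp add: bounded_operators_UNIV)

lemma image_zero_subset_bounded_operators: "0 \<in> H \<Longrightarrow> (\<lambda>_. 0) ` X \<subseteq> bounded_operators K H"
  using zero_in_bounded_operators by blast

section \<open>The assertions for two algebras and for one\<close>

context contractive_bimodule
begin

lemma representation_two_spaces:
  "\<exists>(H :: ('ha \<Rightarrow>\<^sub>L 'ha, 'hb \<Rightarrow>\<^sub>L 'hb, 'hx \<Rightarrow>\<^sub>L 'hx) big_hilbert set) K \<Phi> \<theta> \<pi>.
    real_hilbert_subspace H \<and> real_hilbert_subspace K \<and>
    real_linear_on X \<Phi> \<and> \<Phi> ` X \<subseteq> bounded_operators K H \<and> completely_isometric X \<Phi> \<and>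
    nondegenerate_representation A H \<theta> \<and> completely_contractive A \<theta> \<and>
    nondegenerate_representation B K \<pi> \<and> completely_contractive B \<pi> \<and>
    intertwines A B X l r \<Phi> \<theta> \<pi> \<and>
    concrete_operator_bimodule A B H K \<theta> \<pi> (\<Phi> ` X) \<and>
    completely_bimodule_isometric A B X l r
      (\<Phi> ` X) (\<lambda>a y. \<theta> a o\<^sub>L y) (\<lambda>y b. y o\<^sub>L \<pi> b)"
proof (cases "A = {0} \<or> B = {0}")
  case True
  define z :: "('hx \<Rightarrow>\<^sub>L 'hx) \<Rightarrow> (('ha \<Rightarrow>\<^sub>L 'ha, 'hb \<Rightarrow>\<^sub>L 'hb, 'hx \<Rightarrow>\<^sub>L 'hx) big_hilbert \<Rightarrow>\<^sub>L
      ('ha \<Rightarrow>\<^sub>L 'ha, 'hb \<Rightarrow>\<^sub>L 'hb, 'hx \<Rightarrow>\<^sub>L 'hx) big_hilbert)" where "z = (\<lambda>_. 0)"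
  have iso: "completely_isometric X z"
    unfolding z_def X_zero[OF True] by (rule completely_isometric_zero)
  have lin: "real_linear_on X z" unfolding z_def by (rule real_linear_on_const_zero)
  have img: "z ` X \<subseteq> bounded_operators {0} {0}"
    unfolding z_def by (rule image_zero_subset_bounded_operators) simp
  have tw: "intertwines A B X l r z (\<lambda>_. 0) (\<lambda>_. 0)" unfolding z_def by (rule intertwines_zero)
  note facts = real_hilbert_subspace_zero real_hilbert_subspace_zero lin img iso
    nondegenerate_representation_zero completely_contractive_zero nondegenerate_representation_zero
    completely_contractive_zero tw isometric_image_bimodule[OF lin img iso tw]
  show ?thesis by (intro exI conjI) (rule facts)+
next
  case False
  then obtain \<Phi> \<theta> and \<pi> :: "_ \<Rightarrow> (('ha \<Rightarrow>\<^sub>L 'ha, 'hb \<Rightarrow>\<^sub>L 'hb, 'hx \<Rightarrow>\<^sub>L 'hx) big_hilbert \<Rightarrow>\<^sub>L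
      ('ha \<Rightarrow>\<^sub>L 'ha, 'hb \<Rightarrow>\<^sub>L 'hb, 'hx \<Rightarrow>\<^sub>L 'hx) big_hilbert)" where
    f: "real_linear_on X \<Phi>" "completely_isometric X \<Phi>"
    "nondegenerate_representation A UNIV \<theta>" "completely_isometric A \<theta>"
    "nondegenerate_representation B UNIV \<pi>" "completely_isometric B \<pi>"
    "intertwines A B X l r \<Phi> \<theta> \<pi>"
    using representation_on_big_hilbert by blast
  note img = image_subset_bounded_operators_UNIV[of \<Phi> X]
  show ?thesis
    by (rule exI[of _ UNIV], rule exI[of _ UNIV], rule exI[of _ \<Phi>], rule exI[of _ \<theta>], rule exI[of _ \<pi>])
      (intro conjI real_hilbert_subspace_UNIV f img completely_isometric_imp_contractive
        isometric_image_bimodule[OF f(1) img f(2) f(7)])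
qed

text \<open>If exactly one algebra is zero, \<open>X\<close> is zero as well; the other algebra is
  represented alone, and the zero maps on the rest are isometric but the zero representation is
  degenerate there.\<close>

lemma representation_one_space:
  "\<exists>(H :: ('ha \<Rightarrow>\<^sub>L 'ha, 'hb \<Rightarrow>\<^sub>L 'hb, 'hx \<Rightarrow>\<^sub>L 'hx) big_hilbert set) \<Phi> \<theta> \<pi>.
    real_hilbert_subspace H \<and>
    real_linear_on X \<Phi> \<and> \<Phi> ` X \<subseteq> bounded_operators H H \<and> completely_isometric X \<Phi> \<and>
    operator_representation A H \<theta> \<and> completely_isometric A \<theta> \<and>
    operator_representation B H \<pi> \<and> completely_isometric B \<pi> \<and>
    ((A = {0} \<longrightarrow> B = {0}) \<longrightarrow> nondegenerate_representation A H \<theta>) \<and>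
    ((B = {0} \<longrightarrow> A = {0}) \<longrightarrow> nondegenerate_representation B H \<pi>) \<and>
    intertwines A B X l r \<Phi> \<theta> \<pi>"
proof -
  obtain fa :: "'ha \<Rightarrow> ('ha \<Rightarrow>\<^sub>L 'ha)" where fa: "inj fa" by (rule inj_rank_one)
  obtain fb :: "'hb \<Rightarrow> ('hb \<Rightarrow>\<^sub>L 'hb)" where fb: "inj fb" by (rule inj_rank_one)
  let ?c = "\<lambda>f xs. {map f xs} :: (('ha \<Rightarrow>\<^sub>L 'ha) \<times> ('hb \<Rightarrow>\<^sub>L 'hb) \<times> ('hx \<Rightarrow>\<^sub>L 'hx)) list set"
  have 2: "inj (?c (\<lambda>h. (fa h, 0, 0)))" using fa by (intro inj_singleton_map) (auto simp: inj_def)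
  have 3: "inj (?c (\<lambda>h. (0, fb h, 0)))" using fb by (intro inj_singleton_map) (auto simp: inj_def)
  have 4: "inj (?c (\<lambda>a. (a, 0, 0)))" by (intro inj_singleton_map) (auto simp: inj_def)
  have 5: "inj (?c (\<lambda>b. (0, b, 0)))" by (intro inj_singleton_map) (auto simp: inj_def)
  have zero: "completely_isometric X (\<lambda>_. 0 :: _ \<Rightarrow>\<^sub>L (('ha \<Rightarrow>\<^sub>L 'ha, 'hb \<Rightarrow>\<^sub>L 'hb, 'hx \<Rightarrow>\<^sub>L 'hx) big_hilbert))"
    if "A = {0} \<or> B = {0}"
    unfolding X_zero[OF that] by (rule completely_isometric_zero)
  consider "A \<noteq> {0}" "B \<noteq> {0}" | "A = {0}" "B = {0}" | "A = {0}" "B \<noteq> {0}" | "A \<noteq> {0}" "B = {0}" by blast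
  then show ?thesis
  proof cases
    case 1
    then obtain \<Phi> \<theta> and \<pi> :: "_ \<Rightarrow> (('ha \<Rightarrow>\<^sub>L 'ha, 'hb \<Rightarrow>\<^sub>L 'hb, 'hx \<Rightarrow>\<^sub>L 'hx) big_hilbert \<Rightarrow>\<^sub>L
        ('ha \<Rightarrow>\<^sub>L 'ha, 'hb \<Rightarrow>\<^sub>L 'hb, 'hx \<Rightarrow>\<^sub>L 'hx) big_hilbert)" where
      f: "real_linear_on X \<Phi>" "completely_isometric X \<Phi>"
      "nondegenerate_representation A UNIV \<theta>" "completely_isometric A \<theta>"
      "nondegenerate_representation B UNIV \<pi>" "completely_isometric B \<pi>"
      "intertwines A B X l r \<Phi> \<theta> \<pi>"
      using representation_on_big_hilbert by blast
    show ?thesis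
      by (rule exI[of _ UNIV], rule exI[of _ \<Phi>], rule exI[of _ \<theta>], rule exI[of _ \<pi>])
        (intro conjI impI real_hilbert_subspace_UNIV f image_subset_bounded_operators_UNIV
          nondegenerate_imp_representation[OF f(3)] nondegenerate_imp_representation[OF f(5)])
  next
    case 2
    show ?thesis
      by (rule exI[of _ "{0}"], rule exI[of _ "\<lambda>_. 0"], rule exI[of _ "\<lambda>_. 0"], rule exI[of _ "\<lambda>_. 0"])
        (use zero in \<open>simp add: 2 completely_isometric_zero real_hilbert_subspace_zero real_linear_on_const_zero
          image_zero_subset_bounded_operators operator_representation_zero nondegenerate_representation_zero
          intertwines_zero\<close>)
  next
    case 3
    obtain \<pi> :: "_ \<Rightarrow> (('ha \<Rightarrow>\<^sub>L 'ha, 'hb \<Rightarrow>\<^sub>L 'hb, 'hx \<Rightarrow>\<^sub>L 'hx) big_hilbert \<Rightarrow>\<^sub>L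
        ('ha \<Rightarrow>\<^sub>L 'ha, 'hb \<Rightarrow>\<^sub>L 'hb, 'hx \<Rightarrow>\<^sub>L 'hx) big_hilbert)" where
      p: "nondegenerate_representation B UNIV \<pi>" "completely_isometric B \<pi>"
      by (rule isometric_representation_exists[OF algB unitB 3(2) infinite_list_sets \<open>inj (?c (\<lambda>h. (0, fb h, 0)))\<close> 5])
    show ?thesis
      by (rule exI[of _ UNIV], rule exI[of _ "\<lambda>_. 0"], rule exI[of _ "\<lambda>_. 0"], rule exI[of _ \<pi>])
        (use zero p nondegenerate_imp_representation[OF p(1)] in
          \<open>simp add: 3 completely_isometric_zero real_hilbert_subspace_UNIV real_linear_on_const_zero
          bounded_operators_UNIV operator_representation_zero intertwines_zero\<close>)
  next
    case 4
    obtain \<theta> :: "_ \<Rightarrow> (('ha \<Rightarrow>\<^sub>L 'ha, 'hb \<Rightarrow>\<^sub>L 'hb, 'hx \<Rightarrow>\<^sub>L 'hx) big_hilbert \<Rightarrow>\<^sub>L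
        ('ha \<Rightarrow>\<^sub>L 'ha, 'hb \<Rightarrow>\<^sub>L 'hb, 'hx \<Rightarrow>\<^sub>L 'hx) big_hilbert)" where
      p: "nondegenerate_representation A UNIV \<theta>" "completely_isometric A \<theta>"
      by (rule isometric_representation_exists[OF algA unitA 4(1) infinite_list_sets \<open>inj (?c (\<lambda>h. (fa h, 0, 0)))\<close>
            \<open>inj (?c (\<lambda>a. (a, 0, 0)))\<close>])
    show ?thesis
      by (rule exI[of _ UNIV], rule exI[of _ "\<lambda>_. 0"], rule exI[of _ \<theta>], rule exI[of _ "\<lambda>_. 0"])
        (use zero p nondegenerate_imp_representation[OF p(1)] in
          \<open>simp add: 4 completely_isometric_zero real_hilbert_subspace_UNIV real_linear_on_const_zero
          bounded_operators_UNIV operator_representation_zero intertwines_zero\<close>)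
  qed
qed

end

text \<open>The space is split into two copies of itself. The direct sum of the left and right
  representations serves on both sides, because \<open>\<Phi>\<close> in the corner sees
  \<open>\<theta>\<close> from the left and \<open>\<pi>\<close> from the right. The sum is
  isometric since both summands are.\<close>

lemma representation_one_algebra:
  fixes A :: "('ha::{real_inner, complete_space} \<Rightarrow>\<^sub>L 'ha) set"
    and X :: "('hx::{real_inner, complete_space} \<Rightarrow>\<^sub>L 'hx) set"
  assumes "contractive_bimodule A A X l r"
  shows "\<exists>(H :: ('ha \<Rightarrow>\<^sub>L 'ha, 'ha \<Rightarrow>\<^sub>L 'ha, 'hx \<Rightarrow>\<^sub>L 'hx) big_hilbert set) \<Phi> \<theta> \<pi>.
    real_hilbert_subspace H \<and>
    real_linear_on X \<Phi> \<and> \<Phi> ` X \<subseteq> bounded_operators H H \<and> completely_isometric X \<Phi> \<and>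
    nondegenerate_representation A H \<theta> \<and> completely_isometric A \<theta> \<and>
    nondegenerate_representation A H \<pi> \<and> completely_isometric A \<pi> \<and>
    intertwines A A X l r \<Phi> \<theta> \<pi> \<and> \<pi> = \<theta>"
proof -
  interpret contractive_bimodule A A X l r by (rule assms)
  show ?thesis
  proof (cases "A = {0}")
    case True
    have X0: "X = {0}" by (rule X_zero) (use True in simp)
    show ?thesis
      by (rule exI[of _ "{0}"], rule exI[of _ "\<lambda>_. 0"], rule exI[of _ "\<lambda>_. 0"], rule exI[of _ "\<lambda>_. 0"])
        (use completely_isometric_zero in \<open>simp add: True X0 completely_isometric_zero real_hilbert_subspace_zero real_linear_on_const_zero
          zero_in_bounded_operators nondegenerate_representation_zero intertwines_zero\<close>)
  next
    case False
    obtain \<Phi> \<theta> and \<pi> :: "_ \<Rightarrow> (('ha \<Rightarrow>\<^sub>L 'ha, 'ha \<Rightarrow>\<^sub>L 'ha, 'hx \<Rightarrow>\<^sub>L 'hx) big_hilbert \<Rightarrow>\<^sub>L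
        ('ha \<Rightarrow>\<^sub>L 'ha, 'ha \<Rightarrow>\<^sub>L 'ha, 'hx \<Rightarrow>\<^sub>L 'hx) big_hilbert)" where
      f: "real_linear_on X \<Phi>" "completely_isometric X \<Phi>"
      "nondegenerate_representation A UNIV \<theta>" "completely_isometric A \<theta>"
      "nondegenerate_representation A UNIV \<pi>" "completely_isometric A \<pi>"
      "intertwines A A X l r \<Phi> \<theta> \<pi>"
      by (rule representation_on_big_hilbert[OF False False]) (rule that)
    obtain R S :: "('ha \<Rightarrow>\<^sub>L 'ha, 'ha \<Rightarrow>\<^sub>L 'ha, 'hx \<Rightarrow>\<^sub>L 'hx) big_hilbert \<Rightarrow>\<^sub>L _" where RS: "orthogonal_splitting R S"
      using orthogonal_splitting_ell2[OF infinite_list_sets] by blast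
    interpret orthogonal_splitting R S by (rule RS)
    define \<Psi> where "\<Psi> x = corner (\<Phi> x)" for x
    define \<sigma> where "\<sigma> a = direct_sum (\<theta> a) (\<pi> a)" for a
    have lin: "real_linear_on X \<Psi>"
      using f(1) by (auto simp: real_linear_on_def \<Psi>_def corner_apply blinfun.add_left blinfun.add_right
          blinfun.scaleR_left blinfun.scaleR_right intro!: blinfun_eqI)
    have iso: "completely_isometric X \<Psi>"
      using f(2) by (simp add: completely_isometric_def \<Psi>_def matrix_norm_corner)
    have nd: "nondegenerate_representation A UNIV \<sigma>"
      unfolding \<sigma>_def by (rule direct_sum_nondegenerate[OF f(3,5)])
    have isoA: "completely_isometric A \<sigma>"
      using f(4,6) by (simp add: completely_isometric_def \<sigma>_def matrix_norm_direct_sum)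
    have tw: "intertwines A A X l r \<Psi> \<sigma> \<sigma>"
      using f(7) by (simp add: intertwines_def \<Psi>_def \<sigma>_def direct_sum_corner corner_direct_sum)
    show ?thesis
      by (rule exI[of _ UNIV], rule exI[of _ \<Psi>], rule exI[of _ \<sigma>], rule exI[of _ \<sigma>])
        (intro conjI real_hilbert_subspace_UNIV lin image_subset_bounded_operators_UNIV iso nd isoA tw refl)
  qed
qed

theorem theorem2p4:
  fixes A :: "('ha::{real_inner, complete_space} \<Rightarrow>\<^sub>L 'ha) set"
    and B :: "('hb::{real_inner, complete_space} \<Rightarrow>\<^sub>L 'hb) set"
    and X :: "('hx::{real_inner, complete_space} \<Rightarrow>\<^sub>L 'hx) set"
    and l :: "('ha \<Rightarrow>\<^sub>L 'ha) \<Rightarrow> ('hx \<Rightarrow>\<^sub>L 'hx) \<Rightarrow> ('hx \<Rightarrow>\<^sub>L 'hx)"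
    and r :: "('hx \<Rightarrow>\<^sub>L 'hx) \<Rightarrow> ('hb \<Rightarrow>\<^sub>L 'hb) \<Rightarrow> ('hx \<Rightarrow>\<^sub>L 'hx)"
    and r\<^sub>A :: "('hx \<Rightarrow>\<^sub>L 'hx) \<Rightarrow> ('ha \<Rightarrow>\<^sub>L 'ha) \<Rightarrow> ('hx \<Rightarrow>\<^sub>L 'hx)"
  assumes "real_operator_algebra A" and "approximately_unital A"
    and "real_operator_algebra B" and "approximately_unital B"
    and "real_operator_space X"
  shows
    "(real_bimodule A B X l r \<and> continuous_actions A B X l r \<and>
      nondegenerate_bimodule A B X l r \<and> completely_contractive_actions A B X l r
      \<longrightarrow>
      (\<exists>(H :: ('ha \<Rightarrow>\<^sub>L 'ha, 'hb \<Rightarrow>\<^sub>L 'hb, 'hx \<Rightarrow>\<^sub>L 'hx) big_hilbert set) K \<Phi> \<theta> \<pi>.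
        real_hilbert_subspace H \<and> real_hilbert_subspace K \<and>
        real_linear_on X \<Phi> \<and> \<Phi> ` X \<subseteq> bounded_operators K H \<and> completely_isometric X \<Phi> \<and>
        nondegenerate_representation A H \<theta> \<and> completely_contractive A \<theta> \<and>
        nondegenerate_representation B K \<pi> \<and> completely_contractive B \<pi> \<and>
        intertwines A B X l r \<Phi> \<theta> \<pi> \<and>
        concrete_operator_bimodule A B H K \<theta> \<pi> (\<Phi> ` X) \<and>
        completely_bimodule_isometric A B X l r
          (\<Phi> ` X) (\<lambda>a y. \<theta> a o\<^sub>L y) (\<lambda>y b. y o\<^sub>L \<pi> b)) \<and>
      (\<exists>(H :: ('ha \<Rightarrow>\<^sub>L 'ha, 'hb \<Rightarrow>\<^sub>L 'hb, 'hx \<Rightarrow>\<^sub>L 'hx) big_hilbert set) \<Phi> \<theta> \<pi>.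
        real_hilbert_subspace H \<and>
        real_linear_on X \<Phi> \<and> \<Phi> ` X \<subseteq> bounded_operators H H \<and> completely_isometric X \<Phi> \<and>
        operator_representation A H \<theta> \<and> completely_isometric A \<theta> \<and>
        operator_representation B H \<pi> \<and> completely_isometric B \<pi> \<and>
        ((A = {0} \<longrightarrow> B = {0}) \<longrightarrow> nondegenerate_representation A H \<theta>) \<and>
        ((B = {0} \<longrightarrow> A = {0}) \<longrightarrow> nondegenerate_representation B H \<pi>) \<and>
        intertwines A B X l r \<Phi> \<theta> \<pi>)) \<and>
     (real_bimodule A A X l r\<^sub>A \<and> continuous_actions A A X l r\<^sub>A \<and>
      nondegenerate_bimodule A A X l r\<^sub>A \<and> completely_contractive_actions A A X l r\<^sub>A
      \<longrightarrow>
      (\<exists>(H :: ('ha \<Rightarrow>\<^sub>L 'ha, 'ha \<Rightarrow>\<^sub>L 'ha, 'hx \<Rightarrow>\<^sub>L 'hx) big_hilbert set) \<Phi> \<theta> \<pi>.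
        real_hilbert_subspace H \<and>
        real_linear_on X \<Phi> \<and> \<Phi> ` X \<subseteq> bounded_operators H H \<and> completely_isometric X \<Phi> \<and>
        nondegenerate_representation A H \<theta> \<and> completely_isometric A \<theta> \<and>
        nondegenerate_representation A H \<pi> \<and> completely_isometric A \<pi> \<and>
        intertwines A A X l r\<^sub>A \<Phi> \<theta> \<pi> \<and> \<pi> = \<theta>))"
proof (intro conjI impI)
  assume "real_bimodule A B X l r \<and> continuous_actions A B X l r \<and>
      nondegenerate_bimodule A B X l r \<and> completely_contractive_actions A B X l r"
  then interpret contractive_bimodule A B X l r
    using assms by unfold_locales auto
  show "\<exists>(H :: ('ha \<Rightarrow>\<^sub>L 'ha, 'hb \<Rightarrow>\<^sub>L 'hb, 'hx \<Rightarrow>\<^sub>L 'hx) big_hilbert set) K \<Phi> \<theta> \<pi>.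
        real_hilbert_subspace H \<and> real_hilbert_subspace K \<and>
        real_linear_on X \<Phi> \<and> \<Phi> ` X \<subseteq> bounded_operators K H \<and> completely_isometric X \<Phi> \<and>
        nondegenerate_representation A H \<theta> \<and> completely_contractive A \<theta> \<and>
        nondegenerate_representation B K \<pi> \<and> completely_contractive B \<pi> \<and>
        intertwines A B X l r \<Phi> \<theta> \<pi> \<and>
        concrete_operator_bimodule A B H K \<theta> \<pi> (\<Phi> ` X) \<and>
        completely_bimodule_isometric A B X l r
          (\<Phi> ` X) (\<lambda>a y. \<theta> a o\<^sub>L y) (\<lambda>y b. y o\<^sub>L \<pi> b)"
    by (rule representation_two_spaces)
  show "\<exists>(H :: ('ha \<Rightarrow>\<^sub>L 'ha, 'hb \<Rightarrow>\<^sub>L 'hb, 'hx \<Rightarrow>\<^sub>L 'hx) big_hilbert set) \<Phi> \<theta> \<pi>.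
        real_hilbert_subspace H \<and>
        real_linear_on X \<Phi> \<and> \<Phi> ` X \<subseteq> bounded_operators H H \<and> completely_isometric X \<Phi> \<and>
        operator_representation A H \<theta> \<and> completely_isometric A \<theta> \<and>
        operator_representation B H \<pi> \<and> completely_isometric B \<pi> \<and>
        ((A = {0} \<longrightarrow> B = {0}) \<longrightarrow> nondegenerate_representation A H \<theta>) \<and>
        ((B = {0} \<longrightarrow> A = {0}) \<longrightarrow> nondegenerate_representation B H \<pi>) \<and>
        intertwines A B X l r \<Phi> \<theta> \<pi>"
    by (rule representation_one_space)
next
  assume "real_bimodule A A X l r\<^sub>A \<and> continuous_actions A A X l r\<^sub>A \<and>
      nondegenerate_bimodule A A X l r\<^sub>A \<and> completely_contractive_actions A A X l r\<^sub>A"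
  then have "contractive_bimodule A A X l r\<^sub>A"
    using assms by unfold_locales auto
  then show "\<exists>(H :: ('ha \<Rightarrow>\<^sub>L 'ha, 'ha \<Rightarrow>\<^sub>L 'ha, 'hx \<Rightarrow>\<^sub>L 'hx) big_hilbert set) \<Phi> \<theta> \<pi>.
        real_hilbert_subspace H \<and>
        real_linear_on X \<Phi> \<and> \<Phi> ` X \<subseteq> bounded_operators H H \<and> completely_isometric X \<Phi> \<and>
        nondegenerate_representation A H \<theta> \<and> completely_isometric A \<theta> \<and>
        nondegenerate_representation A H \<pi> \<and> completely_isometric A \<pi> \<and>
        intertwines A A X l r\<^sub>A \<Phi> \<theta> \<pi> \<and> \<pi> = \<theta>"
    by (rule representation_one_algebra)
qed

end
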